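(* Let $M$ be a monoid with monoid presentation $\langle X_M : R_M\rangle$ via a surjective morphism $\phi_M:X_M^*\to M$, and write $\overline x=x\phi_M$ for $x\in X_M$. Let $\Gamma$ be the digraph with vertex set $\mathbb N=\{0,1,2,\ldots\}$ and the following (pairwise distinct) edges, for all $n\in\mathbb N$: - loops $s_{i;n}$ at $n$ for $1\le i<n$; - loops $e_{i;n}$ at $n$ for $1\le i\le n$; - loops $x^{(i;n)}$ at $n$ for $x\in X_M$ and $1\le i\le n$; - an edge $\lambda_n:n\to n+1$ and an edge $\rho_n:n+1\to n$. For $u=x_1\cdots x_k\in X_M^*$ and $1\le i\le n$ write $u^{(i;n)}=x_1^{(i;n)}\cdots x_k^{(i;n)}$, interpreted as the empty path $\iota_n$ at $n$ if $k=0$. Let $\Omega$ be the following set of relations between paths in $\Gamma$, where $x,y\in X_M$, $n\in\mathbb N$, and sub/superscripts range over all values for which the edges are defined, subject to stated constraints: (1) $s_{i;n}^2=\iota_n$; $e_{i;n}^2=e_{i;n}$; $e_{i;n}e_{j;n}=e_{j;n}e_{i;n}$; $s_{i;n}e_{j;n}=e_{j;n}s_{i;n}$ if $j\ne i,i+1$; (2) $s_{i;n}e_{i;n}=e_{i+1;n}s_{i;n}$; $e_{i;n}e_{i+1;n}s_{i;n}=e_{i;n}e_{i+1;n}$; (3) $s_{i;n}s_{j;n}=s_{j;n}s_{i;n}$ if $|i-j|>1$; $s_{i;n}s_{j;n}s_{i;n}=s_{j;n}s_{i;n}s_{j;n}$ if $|i-j|=1$; (4) $u^{(i;n)}=v^{(i;n)}$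 for $(u,v)\in R_M$; $x^{(i;n)}y^{(j;n)}=y^{(j;n)}x^{(i;n)}$ if $i\ne j$; (5) $s_{i;n}x^{(j;n)}=x^{(j;n)}s_{i;n}$ if $j\ne i,i+1$; $s_{i;n}x^{(i;n)}=x^{(i+1;n)}s_{i;n}$; (6) $e_{i;n}x^{(j;n)}=x^{(j;n)}e_{i;n}$ if $i\ne j$; $e_{i;n}x^{(i;n)}=e_{i;n}=x^{(i;n)}e_{i;n}$; (7) $\lambda_n\rho_n=\iota_n$; $\rho_n\lambda_n=e_{n+1;n+1}$; (8) $s_{i;n}\lambda_n=\lambda_ns_{i;n+1}$; $e_{i;n}\lambda_n=\lambda_ne_{i;n+1}$; $x^{(i;n)}\lambda_n=\lambda_nx^{(i;n+1)}$; (9) $\rho_ns_{i;n}=s_{i;n+1}\rho_n$; $\rho_ne_{i;n}=e_{i;n+1}\rho_n$; $\rho_nx^{(i;n)}=x^{(i;n+1)}\rho_n$. Let $\phi:\Gamma^*\to M\wr\mathcal I$ be the category morphism (identity on objects) determined by - $s_{i;n}\mapsto((1,\ldots,1),(i,i+1))$, an endomorphism of $n$, with $(i,i+1)$ the transposition swapping $i$ and $i+1$; - $e_{i;n}\mapsto((1,\ldots,1,0,1,\ldots,1),\mathrm{id}_{\{1,\ldots,n\}\setminus\{i\}})$, an endomorphism of $n$, with $0$ in position $i$; - $x^{(i;n)}\mapsto((1,\ldots,1,\overline x,1,\ldots,1),\mathrm{id}_{\{1,\ldots,n\}})$, an endomorphism of $n$, with $\overline x$ in position $i$; - $\lambda_n\mapsto((1,\ldots,1),\alpha)$,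 a morphism $n\to n+1$, where $\alpha:\{1,\ldots,n\}\to\{1,\ldots,n+1\}$ is the inclusion map; - $\rho_n\mapsto((1,\ldots,1,0),\beta)$, a morphism $n+1\to n$, where $\beta$ has domain $\{1,\ldots,n\}$ and $k\beta=k$ for $1\le k\le n$. Then the category $M\wr\mathcal I$ has category presentation $\langle\Gamma:\Omega\rangle$ via $\phi$.
   Context: All categories here are small with object set $\mathbb N=\{0,1,2,\ldots\}$, identified with their morphism sets; $\mathbf d(a),\mathbf r(a)$ denote the domain and range (codomain) of a morphism $a$, and morphisms are composed left to right ($ab=a\circ b$ is defined iff $\mathbf r(a)=\mathbf d(b)$). Write $\mathbf n=\{1,\ldots,n\}$ ($\mathbf 0=\varnothing$). The symmetric inverse category $\mathcal I$ has as morphisms $m\to n$ the set $\mathcal I_{m,n}$ of all injective partial maps $\mathbf m\to\mathbf n$ (the pair $(m,n)$ being regarded as part of the data of the morphism), under composition of partial maps from left to right. For $A\subseteq\mathbf n$, $\mathrm{id}_A$ is the identity map on $A$, regarded as an element of $\mathcal I_{n,n}$. $M_0=M\cup\{0\}$ is obtained from $M$ (with identity $1$) by adjoining a new symbol $0$ as a zero element (even if $M$ already has a zero). $M_0^n$ is the direct power. For $\mathbf a\in M_0^n$, $\mathrm{supp}(\mathbf a)=\{i\in\mathbf n:a_i\ne0\}$. For $\alpha\in\mathcal I_{m,n}$ and $\mathbf a\in M_0^n$, ${}^\alpha\mathbf a=(b_1,\ldots,b_m)\in M_0^m$ where $b_i=a_{i\alpha}$ if $i\in\mathrm{dom}(\alpha)$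 and $b_i=0$ otherwise. The wreath product category $M\wr\mathcal I$ has as morphisms $m\to n$ the pairs $(\mathbf a,\alpha)\in M_0^m\times\mathcal I_{m,n}$ with $\mathrm{supp}(\mathbf a)=\mathrm{dom}(\alpha)$, with composition $(\mathbf a,\alpha)\circ(\mathbf b,\beta)=(\mathbf a\cdot{}^\alpha\mathbf b,\alpha\beta)$ for $\alpha\in\mathcal I_{m,n}$, $\beta\in\mathcal I_{n,k}$. Presentations: a monoid $N$ has monoid presentation $\langle X:R\rangle$ via $\phi$ if $\phi:X^*\to N$ is a surjective monoid morphism from the free monoid $X^*$ whose kernel is the congruence generated by $R$. For a digraph $\Gamma$ on vertex set $\mathbb N$, $\Gamma^*$ is the free category of all paths in $\Gamma$ under concatenation, with empty path $\iota_n$ at $n$. A congruence on a category is an equivalence relation relating only morphisms with the same domain and the same range, compatible with left and right composition. For a set $\Omega$ of pairs $(u,v)$ of paths with $\mathbf d(u)=\mathbf d(v)$ and $\mathbf r(u)=\mathbf r(v)$ (written $u=v$), $\Omega^\sharp$ is the congruence on $\Gamma^*$ generated by $\Omega$. A category $\mathcal C$ with object set $\mathbb N$ has category presentation $\langle\Gamma:\Omega\rangle$ via $\phi$ if $\phi:\Gamma^*\to\mathcal C$ is a functor that is the identity on objects, is surjective on morphisms, and has kernel $\{(u,v):u\phi=v\phi\}$ equal to $\Omega^\sharp$. *)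

theory Defs
  imports
    "HOL-Algebra.Product_Groups"
    "HOL-Combinatorics.Transposition"
    "Graph_Theory.Arc_Walk"
begin

section \<open>Monoid presentations\<close>

definition free_monoid :: "'x set \<Rightarrow> 'x list monoid" where
  "free_monoid X = \<lparr>carrier = lists X, monoid.mult = (@), one = []\<rparr>"

definition monoid_congruence :: "('m, 'r) monoid_scheme \<Rightarrow> ('m \<times> 'm) set \<Rightarrow> bool" where
  "monoid_congruence N \<sigma> \<longleftrightarrow>
     equiv (carrier N) \<sigma> \<and>
     (\<forall>(a, b) \<in> \<sigma>. \<forall>c \<in> carrier N.
        (c \<otimes>\<^bsub>N\<^esub> a, c \<otimes>\<^bsub>N\<^esub> b) \<in> \<sigma> \<and> (a \<otimes>\<^bsub>N\<^esub> c, b \<otimes>\<^bsub>N\<^esub> c) \<in> \<sigma>)"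

definition monoid_congruence_generated ::
    "('m, 'r) monoid_scheme \<Rightarrow> ('m \<times> 'm) set \<Rightarrow> ('m \<times> 'm) set" where
  "monoid_congruence_generated N R = \<Inter>{\<sigma>. monoid_congruence N \<sigma> \<and> R \<subseteq> \<sigma>}"

definition has_monoid_presentation ::
    "('m, 'r) monoid_scheme \<Rightarrow> 'x set \<Rightarrow> ('x list \<times> 'x list) set \<Rightarrow> ('x list \<Rightarrow> 'm) \<Rightarrow> bool" where
  "has_monoid_presentation N X R \<phi> \<longleftrightarrow>
     monoid N \<and>
     R \<subseteq> lists X \<times> lists X \<and>
     \<phi> \<in> hom (free_monoid X) N \<and> \<phi> [] = \<one>\<^bsub>N\<^esub> \<and>
     \<phi> ` lists X = carrier N \<and>
     {(u, v). u \<in> lists X \<and> v \<in> lists X \<and> \<phi> u = \<phi> v} = monoid_congruence_generated (free_monoid X) R"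

section \<open>Categories with object set the natural numbers\<close>

text \<open>Composition is written from left to right: \<open>cmp C a b\<close> is meaningful if
  \<open>rng C a = src C b\<close>. Every natural number is an object.\<close>

record 'a nat_cat =
  mor :: "'a set"
  src :: "'a \<Rightarrow> nat"
  rng :: "'a \<Rightarrow> nat"
  ident :: "nat \<Rightarrow> 'a"
  cmp :: "'a \<Rightarrow> 'a \<Rightarrow> 'a"

locale nat_category =
  fixes C :: "'a nat_cat"
  assumes ident_mor: "ident C n \<in> mor C"
    and src_ident: "src C (ident C n) = n"
    and rng_ident: "rng C (ident C n) = n"
    and cmp_mor: "\<lbrakk>a \<in> mor C; b \<in> mor C; rng C a = src C b\<rbrakk> \<Longrightarrow> cmp C a b \<in> mor C"
    and src_cmp: "\<lbrakk>a \<in> mor C; b \<in> mor C; rng C a = src C b\<rbrakk> \<Longrightarrow> src C (cmp C a b) = src C a"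
    and rng_cmp: "\<lbrakk>a \<in> mor C; b \<in> mor C; rng C a = src C b\<rbrakk> \<Longrightarrow> rng C (cmp C a b) = rng C b"
    and cmp_ident_left: "a \<in> mor C \<Longrightarrow> cmp C (ident C (src C a)) a = a"
    and cmp_ident_right: "a \<in> mor C \<Longrightarrow> cmp C a (ident C (rng C a)) = a"
    and cmp_assoc:
      "\<lbrakk>a \<in> mor C; b \<in> mor C; c \<in> mor C; rng C a = src C b; rng C b = src C c\<rbrakk>
        \<Longrightarrow> cmp C (cmp C a b) c = cmp C a (cmp C b c)"

definition identity_on_objects_functor :: "'a nat_cat \<Rightarrow> 'b nat_cat \<Rightarrow> ('a \<Rightarrow> 'b) \<Rightarrow> bool" where
  "identity_on_objects_functor C D F \<longleftrightarrow>
     (\<forall>a \<in> mor C. F a \<in> mor D \<and> src D (F a) = src C a \<and> rng D (F a) = rng C a) \<and>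
     (\<forall>n. F (ident C n) = ident D n) \<and>
     (\<forall>a \<in> mor C. \<forall>b \<in> mor C. rng C a = src C b \<longrightarrow> F (cmp C a b) = cmp D (F a) (F b))"

definition parallel_pairs :: "'a nat_cat \<Rightarrow> ('a \<times> 'a) set" where
  "parallel_pairs C =
     {(a, b). a \<in> mor C \<and> b \<in> mor C \<and> src C a = src C b \<and> rng C a = rng C b}"

definition cat_congruence :: "'a nat_cat \<Rightarrow> ('a \<times> 'a) set \<Rightarrow> bool" where
  "cat_congruence C \<sigma> \<longleftrightarrow>
     equiv (mor C) \<sigma> \<and> \<sigma> \<subseteq> parallel_pairs C \<and>
     (\<forall>(a, b) \<in> \<sigma>. \<forall>c \<in> mor C.
        (rng C c = src C a \<longrightarrow> (cmp C c a, cmp C c b) \<in> \<sigma>) \<and>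
        (rng C a = src C c \<longrightarrow> (cmp C a c, cmp C b c) \<in> \<sigma>))"

definition cat_congruence_generated :: "'a nat_cat \<Rightarrow> ('a \<times> 'a) set \<Rightarrow> ('a \<times> 'a) set" where
  "cat_congruence_generated C \<Omega> = \<Inter>{\<sigma>. cat_congruence C \<sigma> \<and> \<Omega> \<subseteq> \<sigma>}"

section \<open>Free categories and category presentations\<close>

text \<open>A path is a triple of its initial vertex, its list of edges and its final vertex;
  thus \<open>(n, [], n)\<close> is the empty path at \<open>n\<close>.\<close>

type_synonym 'e path = "nat \<times> 'e list \<times> nat"

definition free_category :: "(nat, 'e) pre_digraph \<Rightarrow> 'e path nat_cat" where
  "free_category \<Gamma> =
     \<lparr>mor = {(m, p, n). pre_digraph.awalk \<Gamma> m p n},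
      src = (\<lambda>(m, p, n). m),
      rng = (\<lambda>(m, p, n). n),
      ident = (\<lambda>n. (n, [], n)),
      cmp = (\<lambda>(m, p, n) (n', q, k). (m, p @ q, k))\<rparr>"

definition free_category_extension :: "'a nat_cat \<Rightarrow> ('e \<Rightarrow> 'a) \<Rightarrow> 'e path \<Rightarrow> 'a" where
  "free_category_extension C g = (\<lambda>(m, p, n). foldr (\<lambda>e a. cmp C (g e) a) p (ident C n))"

definition has_category_presentation ::
    "'a nat_cat \<Rightarrow> (nat, 'e) pre_digraph \<Rightarrow> ('e path \<times> 'e path) set \<Rightarrow> ('e path \<Rightarrow> 'a) \<Rightarrow> bool" where
  "has_category_presentation C \<Gamma> \<Omega> \<phi> \<longleftrightarrow>
     nat_category C \<and>
     wf_digraph \<Gamma> \<and> verts \<Gamma> = UNIV \<and>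
     \<Omega> \<subseteq> parallel_pairs (free_category \<Gamma>) \<and>
     identity_on_objects_functor (free_category \<Gamma>) C \<phi> \<and>
     \<phi> ` mor (free_category \<Gamma>) = mor C \<and>
     {(u, v). u \<in> mor (free_category \<Gamma>) \<and> v \<in> mor (free_category \<Gamma>) \<and> \<phi> u = \<phi> v}
       = cat_congruence_generated (free_category \<Gamma>) \<Omega>"

section \<open>The wreath product category\<close>

text \<open>An element \<open>a\<close> of \<open>M\<close> is represented in \<open>adjoin_zero M\<close> by \<open>Some a\<close>;
  the new zero is \<open>None\<close>.\<close>

definition adjoin_zero :: "('m, 'r) monoid_scheme \<Rightarrow> 'm option monoid" where
  "adjoin_zero M =
     \<lparr>carrier = insert None (Some ` carrier M),
      monoid.mult = (\<lambda>a b. case (a, b) of (Some x, Some y) \<Rightarrow> Some (x \<otimes>\<^bsub>M\<^esub> y) | _ \<Rightarrow> None),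
      one = Some \<one>\<^bsub>M\<^esub>\<rparr>"

text \<open>The direct power of \<open>adjoin_zero M\<close>; the library constant \<open>product_group\<close> makes sense
  for arbitrary monoids.\<close>

definition zero_power :: "('m, 'r) monoid_scheme \<Rightarrow> nat \<Rightarrow> (nat \<Rightarrow> 'm option) monoid" where
  "zero_power M n = product_group {1..n} (\<lambda>_. adjoin_zero M)"

definition supp :: "nat \<Rightarrow> (nat \<Rightarrow> 'm option) \<Rightarrow> nat set" where
  "supp n a = {i \<in> {1..n}. a i \<noteq> None}"

definition partial_injections :: "nat \<Rightarrow> nat \<Rightarrow> (nat \<rightharpoonup> nat) set" where
  "partial_injections m n = {\<alpha>. dom \<alpha> \<subseteq> {1..m} \<and> ran \<alpha> \<subseteq> {1..n} \<and> inj_on \<alpha> (dom \<alpha>)}"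

definition partial_id :: "nat set \<Rightarrow> (nat \<rightharpoonup> nat)" where
  "partial_id A = Some |` A"

text \<open>The tuple \<open>\<^sup>\<alpha>a\<close>, for \<open>\<alpha>\<close> a partial map with domain contained in \<open>{1..m}\<close>.\<close>

definition pull_back :: "nat \<Rightarrow> (nat \<rightharpoonup> nat) \<Rightarrow> (nat \<Rightarrow> 'm option) \<Rightarrow> (nat \<Rightarrow> 'm option)" where
  "pull_back m \<alpha> a = (\<lambda>i\<in>{1..m}. case \<alpha> i of Some j \<Rightarrow> a j | None \<Rightarrow> None)"

text \<open>A morphism \<open>(a, \<alpha>)\<close> from \<open>m\<close> to \<open>n\<close> is the triple \<open>(m, (a, \<alpha>), n)\<close>. The operator
  \<open>\<circ>\<^sub>m\<close> composes partial maps from right to left.\<close>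

type_synonym 'm wreath_mor = "nat \<times> ((nat \<Rightarrow> 'm option) \<times> (nat \<rightharpoonup> nat)) \<times> nat"

definition wreath_category :: "('m, 'r) monoid_scheme \<Rightarrow> 'm wreath_mor nat_cat" where
  "wreath_category M =
     \<lparr>mor = {(m, (a, \<alpha>), n).
               a \<in> carrier (zero_power M m) \<and> \<alpha> \<in> partial_injections m n \<and> supp m a = dom \<alpha>},
      src = (\<lambda>(m, _, n). m),
      rng = (\<lambda>(m, _, n). n),
      ident = (\<lambda>n. (n, (\<one>\<^bsub>zero_power M n\<^esub>, partial_id {1..n}), n)),
      cmp = (\<lambda>(m, (a, \<alpha>), n) (n', (b, \<beta>), k).
               (m, (a \<otimes>\<^bsub>zero_power M m\<^esub> pull_back m \<alpha> b, \<beta> \<circ>\<^sub>m \<alpha>), k))\<rparr>"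

section \<open>The digraph and the relations\<close>

text \<open>\<open>Sgen i n\<close>, \<open>Egen i n\<close> and \<open>Xgen x i n\<close> are the loops at \<open>n\<close> written
  \<open>s\<close>, \<open>e\<close> with subscript \<open>i;n\<close> and \<open>x\<close> with superscript \<open>(i;n)\<close>;
  \<open>Lam n\<close> and \<open>Rho n\<close> are the edges \<open>n \<rightarrow> n+1\<close> and \<open>n+1 \<rightarrow> n\<close>.\<close>

datatype 'x edge =
    Sgen nat nat
  | Egen nat nat
  | Xgen 'x nat nat
  | Lam nat
  | Rho nat

fun edge_tail :: "'x edge \<Rightarrow> nat" where
  "edge_tail (Sgen i n) = n"
| "edge_tail (Egen i n) = n"
| "edge_tail (Xgen x i n) = n"
| "edge_tail (Lam n) = n"
| "edge_tail (Rho n) = n + 1"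

fun edge_head :: "'x edge \<Rightarrow> nat" where
  "edge_head (Sgen i n) = n"
| "edge_head (Egen i n) = n"
| "edge_head (Xgen x i n) = n"
| "edge_head (Lam n) = n + 1"
| "edge_head (Rho n) = n"

definition wreath_digraph :: "'x set \<Rightarrow> (nat, 'x edge) pre_digraph" where
  "wreath_digraph X =
     \<lparr>verts = UNIV,
      arcs = {Sgen i n | i n. 1 \<le> i \<and> i < n} \<union> {Egen i n | i n. 1 \<le> i \<and> i \<le> n} \<union>
             {Xgen x i n | x i n. x \<in> X \<and> 1 \<le> i \<and> i \<le> n} \<union> range Lam \<union> range Rho,
      tail = edge_tail,
      head = edge_head\<rparr>"

definition word_at :: "'x list \<Rightarrow> nat \<Rightarrow> nat \<Rightarrow> 'x edge list" where
  "word_at u i n = map (\<lambda>x. Xgen x i n) u"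

inductive_set wreath_relations :: "'x set \<Rightarrow> ('x list \<times> 'x list) set \<Rightarrow> ('x edge path \<times> 'x edge path) set"
  for X :: "'x set" and R :: "('x list \<times> 'x list) set" where
  ss: "1 \<le> i \<Longrightarrow> i < n \<Longrightarrow>
    ((n, [Sgen i n, Sgen i n], n), (n, [], n)) \<in> wreath_relations X R"
| ee: "1 \<le> i \<Longrightarrow> i \<le> n \<Longrightarrow>
    ((n, [Egen i n, Egen i n], n), (n, [Egen i n], n)) \<in> wreath_relations X R"
| e_comm: "1 \<le> i \<Longrightarrow> i \<le> n \<Longrightarrow> 1 \<le> j \<Longrightarrow> j \<le> n \<Longrightarrow>
    ((n, [Egen i n, Egen j n], n), (n, [Egen j n, Egen i n], n)) \<in> wreath_relations X R"
| se_comm: "1 \<le> i \<Longrightarrow> i < n \<Longrightarrow> 1 \<le> j \<Longrightarrow> j \<le> n \<Longrightarrow> j \<noteq> i \<Longrightarrow> j \<noteq> i + 1 \<Longrightarrow>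
    ((n, [Sgen i n, Egen j n], n), (n, [Egen j n, Sgen i n], n)) \<in> wreath_relations X R"
| se: "1 \<le> i \<Longrightarrow> i < n \<Longrightarrow>
    ((n, [Sgen i n, Egen i n], n), (n, [Egen (i + 1) n, Sgen i n], n)) \<in> wreath_relations X R"
| ees: "1 \<le> i \<Longrightarrow> i < n \<Longrightarrow>
    ((n, [Egen i n, Egen (i + 1) n, Sgen i n], n), (n, [Egen i n, Egen (i + 1) n], n)) \<in> wreath_relations X R"
| s_comm: "1 \<le> i \<Longrightarrow> i < n \<Longrightarrow> 1 \<le> j \<Longrightarrow> j < n \<Longrightarrow> \<bar>int i - int j\<bar> > 1 \<Longrightarrow>
    ((n, [Sgen i n, Sgen j n], n), (n, [Sgen j n, Sgen i n], n)) \<in> wreath_relations X R"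
| s_braid: "1 \<le> i \<Longrightarrow> i < n \<Longrightarrow> 1 \<le> j \<Longrightarrow> j < n \<Longrightarrow> \<bar>int i - int j\<bar> = 1 \<Longrightarrow>
    ((n, [Sgen i n, Sgen j n, Sgen i n], n), (n, [Sgen j n, Sgen i n, Sgen j n], n)) \<in> wreath_relations X R"
| rel: "(u, v) \<in> R \<Longrightarrow> 1 \<le> i \<Longrightarrow> i \<le> n \<Longrightarrow>
    ((n, word_at u i n, n), (n, word_at v i n, n)) \<in> wreath_relations X R"
| x_comm: "x \<in> X \<Longrightarrow> y \<in> X \<Longrightarrow> 1 \<le> i \<Longrightarrow> i \<le> n \<Longrightarrow> 1 \<le> j \<Longrightarrow> j \<le> n \<Longrightarrow> i \<noteq> j \<Longrightarrow>
    ((n, [Xgen x i n, Xgen y j n], n), (n, [Xgen y j n, Xgen x i n], n)) \<in> wreath_relations X R"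
| sx_comm: "x \<in> X \<Longrightarrow> 1 \<le> i \<Longrightarrow> i < n \<Longrightarrow> 1 \<le> j \<Longrightarrow> j \<le> n \<Longrightarrow> j \<noteq> i \<Longrightarrow> j \<noteq> i + 1 \<Longrightarrow>
    ((n, [Sgen i n, Xgen x j n], n), (n, [Xgen x j n, Sgen i n], n)) \<in> wreath_relations X R"
| sx: "x \<in> X \<Longrightarrow> 1 \<le> i \<Longrightarrow> i < n \<Longrightarrow>
    ((n, [Sgen i n, Xgen x i n], n), (n, [Xgen x (i + 1) n, Sgen i n], n)) \<in> wreath_relations X R"
| ex_comm: "x \<in> X \<Longrightarrow> 1 \<le> i \<Longrightarrow> i \<le> n \<Longrightarrow> 1 \<le> j \<Longrightarrow> j \<le> n \<Longrightarrow> i \<noteq> j \<Longrightarrow>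
    ((n, [Egen i n, Xgen x j n], n), (n, [Xgen x j n, Egen i n], n)) \<in> wreath_relations X R"
| ex: "x \<in> X \<Longrightarrow> 1 \<le> i \<Longrightarrow> i \<le> n \<Longrightarrow>
    ((n, [Egen i n, Xgen x i n], n), (n, [Egen i n], n)) \<in> wreath_relations X R"
| xe: "x \<in> X \<Longrightarrow> 1 \<le> i \<Longrightarrow> i \<le> n \<Longrightarrow>
    ((n, [Egen i n], n), (n, [Xgen x i n, Egen i n], n)) \<in> wreath_relations X R"
| lam_rho: "((n, [Lam n, Rho n], n), (n, [], n)) \<in> wreath_relations X R"
| rho_lam: "((n + 1, [Rho n, Lam n], n + 1), (n + 1, [Egen (n + 1) (n + 1)], n + 1)) \<in> wreath_relations X R"
| s_lam: "1 \<le> i \<Longrightarrow> i < n \<Longrightarrow>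
    ((n, [Sgen i n, Lam n], n + 1), (n, [Lam n, Sgen i (n + 1)], n + 1)) \<in> wreath_relations X R"
| e_lam: "1 \<le> i \<Longrightarrow> i \<le> n \<Longrightarrow>
    ((n, [Egen i n, Lam n], n + 1), (n, [Lam n, Egen i (n + 1)], n + 1)) \<in> wreath_relations X R"
| x_lam: "x \<in> X \<Longrightarrow> 1 \<le> i \<Longrightarrow> i \<le> n \<Longrightarrow>
    ((n, [Xgen x i n, Lam n], n + 1), (n, [Lam n, Xgen x i (n + 1)], n + 1)) \<in> wreath_relations X R"
| rho_s: "1 \<le> i \<Longrightarrow> i < n \<Longrightarrow>
    ((n + 1, [Rho n, Sgen i n], n), (n + 1, [Sgen i (n + 1), Rho n], n)) \<in> wreath_relations X R"
| rho_e: "1 \<le> i \<Longrightarrow> i \<le> n \<Longrightarrow>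
    ((n + 1, [Rho n, Egen i n], n), (n + 1, [Egen i (n + 1), Rho n], n)) \<in> wreath_relations X R"
| rho_x: "x \<in> X \<Longrightarrow> 1 \<le> i \<Longrightarrow> i \<le> n \<Longrightarrow>
    ((n + 1, [Rho n, Xgen x i n], n), (n + 1, [Xgen x i (n + 1), Rho n], n)) \<in> wreath_relations X R"

fun edge_image :: "('m, 'r) monoid_scheme \<Rightarrow> ('x \<Rightarrow> 'm) \<Rightarrow> 'x edge \<Rightarrow> 'm wreath_mor" where
  "edge_image M g (Sgen i n) =
     (n, (\<one>\<^bsub>zero_power M n\<^esub>, (\<lambda>k. Some (transpose i (i + 1) k)) |` {1..n}), n)"
| "edge_image M g (Egen i n) =
     (n, ((\<one>\<^bsub>zero_power M n\<^esub>)(i := None), partial_id ({1..n} - {i})), n)"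
| "edge_image M g (Xgen x i n) =
     (n, ((\<one>\<^bsub>zero_power M n\<^esub>)(i := Some (g x)), partial_id {1..n}), n)"
| "edge_image M g (Lam n) =
     (n, (\<one>\<^bsub>zero_power M n\<^esub>, partial_id {1..n}), n + 1)"
| "edge_image M g (Rho n) =
     (n + 1, ((\<one>\<^bsub>zero_power M (n + 1)\<^esub>)(n + 1 := None), partial_id {1..n}), n)"

definition wreath_presentation_map ::
    "('m, 'r) monoid_scheme \<Rightarrow> ('x list \<Rightarrow> 'm) \<Rightarrow> 'x edge path \<Rightarrow> 'm wreath_mor" where
  "wreath_presentation_map M \<phi>M =
     free_category_extension (wreath_category M) (edge_image M (\<lambda>x. \<phi>M [x]))"

end

theory Submission
  imports Defs
begin

text \<open>
  A morphism \<open>m \<rightarrow> n\<close> of the wreath product is a matrix with \<open>m\<close> rows: row \<open>i\<close> is either empty or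
  says to which point \<open>j\<close> the point \<open>i\<close> is sent and with which label in \<open>M\<close>, and no column is used
  twice. Labels are written as words over \<open>X\<close>, so a morphism becomes a list of rows. Left
  multiplication by the image of a generator is then a simple list operation (\<open>act\<close>): \<open>s\<close> swaps two
  adjacent rows, \<open>e\<close> empties a row, \<open>x\<close> prepends a letter to the word of a row, \<open>\<lambda>\<close> deletes the last
  row and \<open>\<rho>\<close> appends an empty one. Hence the image of a path is obtained by letting its edges act, from
  the last to the first, on the rows of an identity (\<open>path_mor_eq_rows_mor\<close>), and checking the
  relations means checking identities between list operations (\<open>act_relation\<close>). This gives soundness.

  For completeness every list of rows gets a normal form \<open>nf\<close>, a path defined by recursion on the first
  row. If the first row is empty, the morphism forgets the first point and goes on with the other rows;
  if it is \<open>(j, w)\<close>, the morphism is the label \<open>w\<close> at the first point, followed by \<open>1 \<oplus> f\<close>, where \<open>f\<close>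
  is the rest with column \<open>j\<close> deleted, followed by the cycle that moves \<open>1\<close> to \<open>j\<close>. The
  operation \<open>1 \<oplus> _\<close> is the mere relabelling \<open>up\<close> of edges, because a new first point leaves \<open>\<lambda>\<close> and
  \<open>\<rho>\<close>, which add and remove last points, unchanged up to their index. Adding the point at the other end
  would turn \<open>\<lambda>\<close> into a product of two generators. In particular relations are taken
  to relations (\<open>up_relation\<close>).

  The heart of the proof is \<open>nf_act\<close>: modulo the relations, a generator times the normal form of a
  list of rows is the normal form of the list on which the generator has acted. Every generator is either
  of the form \<open>up g\<close>, and then the recursion for \<open>nf\<close> reduces the claim to fewer rows, or one of
  \<open>s\<^sub>1\<close>, \<open>e\<^sub>1\<close>, \<open>x\<close> at position \<open>1\<close>, \<open>\<lambda>\<^sub>0\<close>, \<open>\<rho>\<^sub>0\<close>. The case \<open>s\<^sub>1\<close> is \<open>nf_swap\<close>, a computation with two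
  cycles. The case \<open>e\<^sub>1\<close> rests on \<open>nf_skip\<close>, which re-inserts the column that was in use by the emptied
  row. As the normal form of an identity is the empty path, every path is equivalent to the normal
  form of its own image (\<open>path_eq_nf\<close>), and two paths with the same image are equivalent.
  Conversely \<open>act_nf\<close> shows that each list of rows is the image of its normal form, which gives
  surjectivity.

  Equivalence of paths is handled through set-valued representations (\<open>wreath_model\<close>): each edge acts as
  a function between sets indexed by the objects, in such a way that the relations hold. Equations
  between paths then become equations between iterated function applications. Composing a representation
  with \<open>up\<close> yields another one, so inductions run over all representations at once. The classes of an
  arbitrary congruence that contains the relations form such a representation
  (\<open>path_congruence.model\<close>).
\<close>

section \<open>Paths, rows and normal forms\<close>

abbreviation is_path :: "'x set \<Rightarrow> nat \<Rightarrow> 'x edge list \<Rightarrow> nat \<Rightarrow> bool" where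
  "is_path X \<equiv> pre_digraph.awalk (wreath_digraph X)"

lemma arcs_wreath_digraph [simp]:
  "Sgen i n \<in> arcs (wreath_digraph X) \<longleftrightarrow> 1 \<le> i \<and> i < n"
  "Egen i n \<in> arcs (wreath_digraph X) \<longleftrightarrow> 1 \<le> i \<and> i \<le> n"
  "Xgen x i n \<in> arcs (wreath_digraph X) \<longleftrightarrow> x \<in> X \<and> 1 \<le> i \<and> i \<le> n"
  "Lam n \<in> arcs (wreath_digraph X)"
  "Rho n \<in> arcs (wreath_digraph X)"
  by (auto simp: wreath_digraph_def)

lemma wreath_digraph_sel [simp]:
  "verts (wreath_digraph X) = UNIV" "tail (wreath_digraph X) = edge_tail"
  "head (wreath_digraph X) = edge_head"
  by (simp_all add: wreath_digraph_def)

lemma is_path_Nil [simp]: "is_path X m [] n \<longleftrightarrow> m = n"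
  by (simp add: pre_digraph.awalk_def pre_digraph.cas.simps)

lemma is_path_Cons [simp]:
  "is_path X m (g # p) n \<longleftrightarrow>
    g \<in> arcs (wreath_digraph X) \<and> edge_tail g = m \<and> is_path X (edge_head g) p n"
  by (auto simp: pre_digraph.awalk_def pre_digraph.cas.simps)

lemma is_path_append [simp]:
  "is_path X m (p @ q) n \<longleftrightarrow> (\<exists>k. is_path X m p k \<and> is_path X k q n)"
  by (induction p arbitrary: m) auto

text \<open>The edge \<open>up g\<close> represents \<open>1 \<oplus> g\<close>, the morphism that fixes a new first point and acts as
  \<open>g\<close> on the points shifted by one.\<close>

fun up :: "'x edge \<Rightarrow> 'x edge" where
  "up (Sgen i n) = Sgen (Suc i) (Suc n)"
| "up (Egen i n) = Egen (Suc i) (Suc n)"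
| "up (Xgen x i n) = Xgen x (Suc i) (Suc n)"
| "up (Lam n) = Lam (Suc n)"
| "up (Rho n) = Rho (Suc n)"

lemma up_arc [simp]: "g \<in> arcs (wreath_digraph X) \<Longrightarrow> up g \<in> arcs (wreath_digraph X)"
  by (cases g) auto

lemma tail_up [simp]: "edge_tail (up g) = Suc (edge_tail g)"
  and head_up [simp]: "edge_head (up g) = Suc (edge_head g)"
  by (cases g; simp)+

lemma is_path_up [simp]: "is_path X m p n \<Longrightarrow> is_path X (Suc m) (map up p) (Suc n)"
  by (induction p arbitrary: m) auto

lemma map_up_word_at [simp]: "map up (word_at w i n) = word_at w (Suc i) (Suc n)"
  by (simp add: word_at_def)

text \<open>Each relation is stated for all admissible indices, and \<open>up\<close> only shifts indices.\<close>

lemma up_relation: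
  assumes "((m, u, n), (m', v, n')) \<in> wreath_relations X R"
  shows "((Suc m, map up u, Suc n), (Suc m', map up v, Suc n')) \<in> wreath_relations X R"
  using assms
  by (cases rule: wreath_relations.cases)
     (simp_all add: wreath_relations.intros[simplified])

text \<open>The cycle with \<open>1 \<mapsto> k\<close> and \<open>i \<mapsto> i - 1\<close> for \<open>2 \<le> i \<le> k\<close>.\<close>

definition cyc :: "nat \<Rightarrow> nat \<Rightarrow> 'x edge list" where
  "cyc k n = map (\<lambda>i. Sgen i n) [1..<k]"

text \<open>The partial map \<open>m + 1 \<rightarrow> m\<close> that is undefined at \<open>1\<close> and sends \<open>i + 1\<close> to \<open>i\<close>.\<close>

definition drop_first :: "nat \<Rightarrow> 'x edge list" where
  "drop_first m = cyc (Suc m) (Suc m) @ [Rho m]"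

text \<open>The increasing injection \<open>n \<rightarrow> n + 1\<close> whose image misses \<open>j\<close>.\<close>

definition skip :: "nat \<Rightarrow> nat \<Rightarrow> 'x edge list" where
  "skip j n = Lam n # map (\<lambda>i. Sgen i (Suc n)) (rev [j..<Suc n])"

definition empty_map :: "nat \<Rightarrow> 'x edge list" where
  "empty_map n = map Lam [0..<n]"

text \<open>How the columns other than \<open>j\<close> are renumbered when column \<open>j\<close> is deleted.\<close>

definition squash :: "nat \<Rightarrow> nat \<Rightarrow> nat" where
  "squash j c = (if c \<le> j then c else c - 1)"

text \<open>The row \<open>Some (j, w)\<close> of a point says that it is sent to \<open>j\<close> with the label that is represented by
  the word \<open>w\<close>; the row \<open>None\<close> belongs to a point outside the domain.\<close>

type_synonym 'x row = "(nat \<times> 'x list) option"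

definition map_col :: "(nat \<Rightarrow> nat) \<Rightarrow> 'x row list \<Rightarrow> 'x row list" where
  "map_col f = map (map_option (map_prod f id))"

lemma map_col_simps [simp]:
  "map_col f [] = []"
  "map_col f (None # st) = None # map_col f st"
  "map_col f (Some (j, w) # st) = Some (f j, w) # map_col f st"
  "length (map_col f st) = length st"
  by (simp_all add: map_col_def)

text \<open>The cycle \<open>cyc j n\<close> takes the first column to position \<open>j\<close> and the columns of the shifted rest to
  the other positions in increasing order; this undoes \<open>squash j\<close>.\<close>

fun nf :: "nat \<Rightarrow> 'x row list \<Rightarrow> 'x edge list"
where
  "nf n [] = empty_map n"
| "nf n (None # st) = drop_first (length st) @ nf n st"
| "nf n (Some (j, w) # st) =
     word_at w 1 (Suc (length st)) @ map up (nf (n - 1) (map_col (squash j) st)) @ cyc j n"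

section \<open>Representations and the calculus of cycles, drops and skips\<close>

text \<open>A functor to sets, contravariant with respect to the direction of the edges: \<open>G g\<close> maps the set at
  the head of \<open>g\<close> to the set at its tail, so that a path acts as \<open>foldr G p\<close>, which corresponds to
  composing with the path on the left. The type \<open>'a\<close> is common to all objects, and the relations are
  required only on elements of the right set.\<close>

locale wreath_model =
  fixes X :: "'x set" and R :: "('x list \<times> 'x list) set"
    and G :: "'x edge \<Rightarrow> 'a \<Rightarrow> 'a" and Ob :: "nat \<Rightarrow> 'a set"
  assumes G_in: "\<lbrakk>g \<in> arcs (wreath_digraph X); a \<in> Ob (edge_head g)\<rbrakk> \<Longrightarrow> G g a \<in> Ob (edge_tail g)"
    and rel: "\<lbrakk>((m, u, n), (m', v, n')) \<in> wreath_relations X R; a \<in> Ob n\<rbrakk> \<Longrightarrow> foldr G u a = foldr G v a"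

lemma foldr_map_up: "foldr G (map up p) a = foldr (\<lambda>g. G (up g)) p a"
  by (induction p) auto

text \<open>This makes induction over the rows possible: the tail of a normal form occurs under \<open>up\<close>, where the
  induction hypothesis is applied to the representation composed with \<open>up\<close>.\<close>

lemma wreath_model_up:
  assumes "wreath_model X R G Ob"
  shows "wreath_model X R (\<lambda>g. G (up g)) (\<lambda>n. Ob (Suc n))"
proof -
  interpret wreath_model X R G Ob by fact
  show ?thesis
  proof
    fix g a assume "g \<in> arcs (wreath_digraph X)" "a \<in> Ob (Suc (edge_head g))"
    then show "G (up g) a \<in> Ob (Suc (edge_tail g))"
      using G_in[of "up g" a] by simp
  next
    fix m u n m' v n' a
    assume "((m, u, n), (m', v, n')) \<in> wreath_relations X R" "a \<in> Ob (Suc n)"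
    then show "foldr (\<lambda>g. G (up g)) u a = foldr (\<lambda>g. G (up g)) v a"
      unfolding foldr_map_up[symmetric] by (intro rel[OF up_relation])
  qed
qed

lemma up_skip [simp]: "map up (skip j n) = skip (Suc j) (Suc n)"
  by (simp add: skip_def rev_map[symmetric] map_Suc_upt[symmetric] del: upt_Suc map_Suc_upt)

lemma is_path_cyc [simp]: "k \<le> n \<Longrightarrow> is_path X m (cyc k n) m' \<longleftrightarrow> (if k \<le> 1 then m = m' else m = n \<and> m' = n)"
proof (induction k arbitrary: m')
  case (Suc k)
  then show ?case by (cases "k = 0"; cases "k = 1") (auto simp: cyc_def)
qed (auto simp: cyc_def)

lemma cyc_Suc: "1 \<le> k \<Longrightarrow> cyc (Suc k) n = cyc k n @ [Sgen k n]"
  by (simp add: cyc_def)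

lemma cyc_0 [simp]: "cyc 0 n = []" "cyc (Suc 0) n = []"
  by (simp_all add: cyc_def)

lemma is_path_drop_first [simp]: "is_path X (Suc m) (drop_first m) m"
  by (cases m) (auto simp: drop_first_def)

lemma is_path_swaps: "\<forall>i\<in>set is. 1 \<le> i \<and> i < n \<Longrightarrow> is_path X n (map (\<lambda>i. Sgen i n) is) n"
  by (induction "is") auto

lemma is_path_skip [simp]: "1 \<le> j \<Longrightarrow> is_path X n (skip j n) (Suc n)"
  by (auto simp: skip_def intro!: is_path_swaps)

lemma is_path_empty_map [simp]: "is_path X 0 (empty_map n) n"
  by (induction n) (auto simp: empty_map_def)

lemma is_path_word_at: "set w \<subseteq> X \<Longrightarrow> 1 \<le> i \<Longrightarrow> i \<le> n \<Longrightarrow> is_path X n (word_at w i n) n"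
  by (induction w) (auto simp: word_at_def)

context wreath_model
begin

lemma path_in: "\<lbrakk>is_path X m p n; a \<in> Ob n\<rbrakk> \<Longrightarrow> foldr G p a \<in> Ob m"
  by (induction p arbitrary: m) (auto intro: G_in)

lemma in_Ob [simp]:
  "\<lbrakk>1 \<le> i; i < n; a \<in> Ob n\<rbrakk> \<Longrightarrow> G (Sgen i n) a \<in> Ob n"
  "\<lbrakk>1 \<le> i; i \<le> n; a \<in> Ob n\<rbrakk> \<Longrightarrow> G (Egen i n) a \<in> Ob n"
  "\<lbrakk>x \<in> X; 1 \<le> i; i \<le> n; a \<in> Ob n\<rbrakk> \<Longrightarrow> G (Xgen x i n) a \<in> Ob n"
  "a \<in> Ob (Suc n) \<Longrightarrow> G (Lam n) a \<in> Ob n"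
  "a \<in> Ob n \<Longrightarrow> G (Rho n) a \<in> Ob (Suc n)"
  using G_in[of "Sgen i n"] G_in[of "Egen i n"] G_in[of "Xgen x i n"] G_in[of "Lam n"] G_in[of "Rho n"]
  by auto

lemma s_s:
  "\<lbrakk>1 \<le> i; i < n; a \<in> Ob n\<rbrakk> \<Longrightarrow> G (Sgen i n) (G (Sgen i n) a) = a"
  using rel[OF wreath_relations.ss] by force

lemma e_e_comm:
  "\<lbrakk>1 \<le> i; i \<le> n; 1 \<le> j; j \<le> n; a \<in> Ob n\<rbrakk> \<Longrightarrow>
     G (Egen i n) (G (Egen j n) a) = G (Egen j n) (G (Egen i n) a)"
  using rel[OF wreath_relations.e_comm] by force

lemma s_e_comm:
  "\<lbrakk>1 \<le> i; i < n; 1 \<le> j; j \<le> n; j \<noteq> i; j \<noteq> Suc i; a \<in> Ob n\<rbrakk> \<Longrightarrow>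
     G (Sgen i n) (G (Egen j n) a) = G (Egen j n) (G (Sgen i n) a)"
  using rel[OF wreath_relations.se_comm] by force

lemma s_e:
  "\<lbrakk>1 \<le> i; i < n; a \<in> Ob n\<rbrakk> \<Longrightarrow>
     G (Sgen i n) (G (Egen i n) a) = G (Egen (Suc i) n) (G (Sgen i n) a)"
  using rel[OF wreath_relations.se] by force

lemma e_e_s:
  "\<lbrakk>1 \<le> i; i < n; a \<in> Ob n\<rbrakk> \<Longrightarrow>
     G (Egen i n) (G (Egen (Suc i) n) (G (Sgen i n) a)) = G (Egen i n) (G (Egen (Suc i) n) a)"
  using rel[OF wreath_relations.ees] by force

lemma s_s_comm:
  "\<lbrakk>1 \<le> i; Suc i < j; j < n; a \<in> Ob n\<rbrakk> \<Longrightarrow>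
     G (Sgen i n) (G (Sgen j n) a) = G (Sgen j n) (G (Sgen i n) a)"
  using rel[OF wreath_relations.s_comm] by force

lemma s_braid:
  "\<lbrakk>1 \<le> i; Suc i < n; a \<in> Ob n\<rbrakk> \<Longrightarrow>
     G (Sgen i n) (G (Sgen (Suc i) n) (G (Sgen i n) a)) = G (Sgen (Suc i) n) (G (Sgen i n) (G (Sgen (Suc i) n) a))"
  using rel[OF wreath_relations.s_braid, of i n "Suc i" a] by force

lemma x_x_comm:
  "\<lbrakk>x \<in> X; y \<in> X; 1 \<le> i; i \<le> n; 1 \<le> j; j \<le> n; i \<noteq> j; a \<in> Ob n\<rbrakk> \<Longrightarrow>
     G (Xgen x i n) (G (Xgen y j n) a) = G (Xgen y j n) (G (Xgen x i n) a)"
  using rel[OF wreath_relations.x_comm] by force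

lemma s_x_comm:
  "\<lbrakk>x \<in> X; 1 \<le> i; i < n; 1 \<le> j; j \<le> n; j \<noteq> i; j \<noteq> Suc i; a \<in> Ob n\<rbrakk> \<Longrightarrow>
     G (Sgen i n) (G (Xgen x j n) a) = G (Xgen x j n) (G (Sgen i n) a)"
  using rel[OF wreath_relations.sx_comm] by force

lemma s_x:
  "\<lbrakk>x \<in> X; 1 \<le> i; i < n; a \<in> Ob n\<rbrakk> \<Longrightarrow>
     G (Sgen i n) (G (Xgen x i n) a) = G (Xgen x (Suc i) n) (G (Sgen i n) a)"
  using rel[OF wreath_relations.sx] by force

lemma e_x_comm:
  "\<lbrakk>x \<in> X; 1 \<le> i; i \<le> n; 1 \<le> j; j \<le> n; i \<noteq> j; a \<in> Ob n\<rbrakk> \<Longrightarrow>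
     G (Egen i n) (G (Xgen x j n) a) = G (Xgen x j n) (G (Egen i n) a)"
  using rel[OF wreath_relations.ex_comm] by force

lemma e_x:
  "\<lbrakk>x \<in> X; 1 \<le> i; i \<le> n; a \<in> Ob n\<rbrakk> \<Longrightarrow> G (Egen i n) (G (Xgen x i n) a) = G (Egen i n) a"
  using rel[OF wreath_relations.ex] by force

lemma x_e:
  "\<lbrakk>x \<in> X; 1 \<le> i; i \<le> n; a \<in> Ob n\<rbrakk> \<Longrightarrow> G (Xgen x i n) (G (Egen i n) a) = G (Egen i n) a"
  using rel[OF wreath_relations.xe] by force

lemma lam_rho:
  "a \<in> Ob n \<Longrightarrow> G (Lam n) (G (Rho n) a) = a"
  using rel[OF wreath_relations.lam_rho] by force

lemma rho_lam:
  "a \<in> Ob (Suc n) \<Longrightarrow> G (Rho n) (G (Lam n) a) = G (Egen (Suc n) (Suc n)) a"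
  using rel[OF wreath_relations.rho_lam] by force

lemma s_lam:
  "\<lbrakk>1 \<le> i; i < n; a \<in> Ob (Suc n)\<rbrakk> \<Longrightarrow>
     G (Sgen i n) (G (Lam n) a) = G (Lam n) (G (Sgen i (Suc n)) a)"
  using rel[OF wreath_relations.s_lam] by force

lemma e_lam:
  "\<lbrakk>1 \<le> i; i \<le> n; a \<in> Ob (Suc n)\<rbrakk> \<Longrightarrow>
     G (Egen i n) (G (Lam n) a) = G (Lam n) (G (Egen i (Suc n)) a)"
  using rel[OF wreath_relations.e_lam] by force

lemma x_lam:
  "\<lbrakk>x \<in> X; 1 \<le> i; i \<le> n; a \<in> Ob (Suc n)\<rbrakk> \<Longrightarrow>
     G (Xgen x i n) (G (Lam n) a) = G (Lam n) (G (Xgen x i (Suc n)) a)"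
  using rel[OF wreath_relations.x_lam] by force

lemma s_rho:
  "\<lbrakk>1 \<le> i; i < n; a \<in> Ob n\<rbrakk> \<Longrightarrow>
     G (Sgen i (Suc n)) (G (Rho n) a) = G (Rho n) (G (Sgen i n) a)"
  using rel[OF wreath_relations.rho_s] by force

lemma e_rho:
  "\<lbrakk>1 \<le> i; i \<le> n; a \<in> Ob n\<rbrakk> \<Longrightarrow>
     G (Egen i (Suc n)) (G (Rho n) a) = G (Rho n) (G (Egen i n) a)"
  using rel[OF wreath_relations.rho_e] by force

lemma x_rho:
  "\<lbrakk>x \<in> X; 1 \<le> i; i \<le> n; a \<in> Ob n\<rbrakk> \<Longrightarrow>
     G (Xgen x i (Suc n)) (G (Rho n) a) = G (Rho n) (G (Xgen x i n) a)"
  using rel[OF wreath_relations.rho_x] by force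

end

text \<open>Naturality with respect to edges extends to paths. The sets \<open>B\<close> record where the commutation is known;
  the second part of the hypothesis keeps the elements inside these sets along the path.\<close>

lemma foldr_natural:
  assumes "is_path X m p n" "a \<in> B n"
    and "\<And>g b. g \<in> arcs (wreath_digraph X) \<Longrightarrow> b \<in> B (edge_head g) \<Longrightarrow>
           F g (T (edge_head g) b) = T (edge_tail g) (F' g b) \<and> F' g b \<in> B (edge_tail g)"
  shows "foldr F p (T n a) = T m (foldr F' p a)"
proof -
  have "foldr F p (T n a) = T m (foldr F' p a) \<and> foldr F' p a \<in> B m"
    using assms(1) by (induction p arbitrary: m) (use assms(2,3) in \<open>auto\<close>)
  then show ?thesis ..
qed

lemma cyc_Cons: "1 \<le> k \<Longrightarrow> cyc (Suc k) (Suc n) = Sgen 1 (Suc n) # map up (cyc k n)"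
  by (induction k) (auto simp: cyc_def)

lemma skip_Suc: "1 \<le> j \<Longrightarrow> j \<le> n \<Longrightarrow> skip j n = skip (Suc j) n @ [Sgen j (Suc n)]"
  by (simp add: skip_def upt_conv_Cons)

lemma skip_last: "skip (Suc n) n = [Lam n]"
  by (simp add: skip_def)

lemma empty_map_Suc: "empty_map (Suc n) = empty_map n @ [Lam n]"
  by (simp add: empty_map_def)

context wreath_model
begin

lemma s_far: "\<lbrakk>1 \<le> i; i < n; 1 \<le> j; j < n; Suc i < j \<or> Suc j < i; a \<in> Ob n\<rbrakk> \<Longrightarrow>
     G (Sgen i n) (G (Sgen j n) a) = G (Sgen j n) (G (Sgen i n) a)"
  using s_s_comm[of i j n a] s_s_comm[of j i n a] by auto

lemma cyc_in [simp]: "\<lbrakk>k \<le> n; a \<in> Ob n\<rbrakk> \<Longrightarrow> foldr G (cyc k n) a \<in> Ob n"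
  by (rule path_in[of n _ n]) auto

lemma drop_in [simp]: "a \<in> Ob n \<Longrightarrow> foldr G (drop_first n) a \<in> Ob (Suc n)"
  by (rule path_in[of _ _ n]) auto

lemma skip_in [simp]: "\<lbrakk>1 \<le> j; a \<in> Ob (Suc n)\<rbrakk> \<Longrightarrow> foldr G (skip j n) a \<in> Ob n"
  by (rule path_in[of _ _ "Suc n"]) auto

lemma word_in [simp]: "\<lbrakk>set w \<subseteq> X; 1 \<le> i; i \<le> n; a \<in> Ob n\<rbrakk> \<Longrightarrow> foldr G (word_at w i n) a \<in> Ob n"
  by (rule path_in[of _ _ n]) (auto intro: is_path_word_at)

subsection \<open>Cycles\<close>

text \<open>The degrees \<open>m\<close> and \<open>n\<close>
  may differ, so that \<open>T\<close> can also be \<open>\<lambda>\<close>, \<open>\<rho>\<close> or a skip.\<close>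

lemma cyc_natural:
  assumes "k \<le> n" "a \<in> Ob n"
    and "\<And>i b. \<lbrakk>1 \<le> i; i < k; b \<in> Ob n\<rbrakk> \<Longrightarrow> G (Sgen i m) (T b) = T (G (Sgen i n) b)"
  shows "foldr G (cyc k m) (T a) = T (foldr G (cyc k n) a)"
  using assms
proof (induction k arbitrary: a)
  case (Suc k)
  show ?case
  proof (cases "k = 0")
    case False
    then have "foldr G (cyc (Suc k) m) (T a) = foldr G (cyc k m) (T (G (Sgen k n) a))"
      using Suc.prems by (simp add: cyc_Suc)
    also have "\<dots> = T (foldr G (cyc k n) (G (Sgen k n) a))"
      using Suc.prems False by (intro Suc.IH) auto
    finally show ?thesis using False by (simp add: cyc_Suc)
  qed simp
qed simp

text \<open>The swap passes the distant factors of the cycle; the braid relation is used where it meets the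
  two adjacent factors with indices \<open>i\<close> and \<open>i + 1\<close>.\<close>

lemma s_cyc: "\<lbrakk>1 \<le> i; Suc i < k; k \<le> n; a \<in> Ob n\<rbrakk> \<Longrightarrow>
  G (Sgen (Suc i) n) (foldr G (cyc k n) a) = foldr G (cyc k n) (G (Sgen i n) a)"
proof (induction k arbitrary: a)
  case (Suc k)
  show ?case
  proof (cases "Suc i < k")
    case True
    then show ?thesis using Suc by (simp add: cyc_Suc s_s_comm[of i k])
  next
    case False
    then have k: "k = Suc i" using Suc.prems by auto
    have "G (Sgen (Suc i) n) (foldr G (cyc (Suc k) n) a) =
        G (Sgen (Suc i) n) (foldr G (cyc i n) (G (Sgen i n) (G (Sgen (Suc i) n) a)))"
      using Suc.prems by (simp add: cyc_Suc k)
    also have "\<dots> = foldr G (cyc i n) (G (Sgen (Suc i) n) (G (Sgen i n) (G (Sgen (Suc i) n) a)))"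
      using Suc.prems by (intro cyc_natural[symmetric] s_far) (auto simp: k)
    also have "\<dots> = foldr G (cyc i n) (G (Sgen i n) (G (Sgen (Suc i) n) (G (Sgen i n) a)))"
      using Suc.prems by (simp add: s_braid k)
    finally show ?thesis using Suc.prems by (simp add: cyc_Suc k)
  qed
qed simp

lemma up_cyc_cyc: "\<lbrakk>l < k; k \<le> Suc n; a \<in> Ob (Suc n)\<rbrakk> \<Longrightarrow>
  foldr G (map up (cyc l n)) (foldr G (cyc k (Suc n)) a) =
  foldr G (cyc k (Suc n)) (foldr G (cyc l (Suc n)) a)"
proof (induction l arbitrary: a)
  case (Suc l)
  then show ?case
    by (cases "l = 0") (simp_all add: cyc_Suc s_cyc)
qed simp

text \<open>Both sides send \<open>1\<close> to \<open>l\<close> and \<open>2\<close> to \<open>k + 1\<close> and are increasing on the other points. After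
  splitting off \<open>s\<^sub>1\<close> from both cycles on the left, the remaining part of the first one is moved
  across the second one, and the two factors \<open>s\<^sub>1\<close> cancel.\<close>

lemma cyc_cyc:
  assumes "1 \<le> l" "l \<le> k" "k \<le> n" "a \<in> Ob (Suc n)"
  shows "foldr G (cyc (Suc l) (Suc n)) (foldr G (cyc (Suc k) (Suc n)) a) =
    foldr G (map up (cyc k n)) (foldr G (cyc l (Suc n)) a)"
proof -
  have "foldr G (cyc (Suc l) (Suc n)) (foldr G (cyc (Suc k) (Suc n)) a) =
     G (Sgen 1 (Suc n)) (foldr G (cyc (Suc k) (Suc n)) (foldr G (cyc l (Suc n)) a))"
    using assms up_cyc_cyc[of l "Suc k" n a] by (simp add: cyc_Cons[of l] del: foldr_map)
  also have "\<dots> = G (Sgen 1 (Suc n)) (G (Sgen 1 (Suc n)) (foldr G (map up (cyc k n)) (foldr G (cyc l (Suc n)) a)))"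
    using assms by (simp add: cyc_Cons[of k] del: foldr_map)
  also have "\<dots> = foldr G (map up (cyc k n)) (foldr G (cyc l (Suc n)) a)"
    using assms by (intro s_s path_in[of "Suc n" _ "Suc n"]) auto
  finally show ?thesis .
qed

lemma cyc_rev: "\<lbrakk>k \<le> n; a \<in> Ob n\<rbrakk> \<Longrightarrow>
  foldr G (rev (cyc k n)) a \<in> Ob n \<and> foldr G (cyc k n) (foldr G (rev (cyc k n)) a) = a"
proof (induction k)
  case (Suc k)
  then show ?case by (cases "k = 0") (auto simp: cyc_Suc s_s)
qed simp

subsection \<open>Families of generators attached to a row\<close>

text \<open>The relations between swaps and \<open>e\<close> have the same form as those between swaps and \<open>x\<close>: conjugation by
  \<open>s\<^sub>i\<close> exchanges the members at \<open>i\<close> and \<open>i + 1\<close> and fixes the others. This predicate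
  allows both to be moved across cycles by the same argument.\<close>

definition row_family :: "nat \<Rightarrow> (nat \<Rightarrow> 'a \<Rightarrow> 'a) \<Rightarrow> bool" where
  "row_family n T \<longleftrightarrow> (\<forall>j a. 1 \<le> j \<longrightarrow> j \<le> n \<longrightarrow> a \<in> Ob n \<longrightarrow> T j a \<in> Ob n \<and>
     (\<forall>i. 1 \<le> i \<longrightarrow> i < n \<longrightarrow>
        (j \<noteq> i \<longrightarrow> j \<noteq> Suc i \<longrightarrow> G (Sgen i n) (T j a) = T j (G (Sgen i n) a)) \<and>
        (j = i \<longrightarrow> G (Sgen i n) (T i a) = T (Suc i) (G (Sgen i n) a))))"

lemma row_family_e: "row_family n (\<lambda>j. G (Egen j n))"
  by (auto simp: row_family_def s_e_comm s_e)

lemma row_family_x: "x \<in> X \<Longrightarrow> row_family n (\<lambda>j. G (Xgen x j n))"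
  by (auto simp: row_family_def s_x_comm s_x)

lemma row_family_swap:
  assumes "row_family n T" "1 \<le> i" "i < n" "a \<in> Ob n"
  shows "G (Sgen i n) (T (Suc i) a) = T i (G (Sgen i n) a)"
proof -
  have "T (Suc i) a = G (Sgen i n) (T i (G (Sgen i n) a))"
    using assms by (simp add: row_family_def s_s)
  then have "G (Sgen i n) (T (Suc i) a) = G (Sgen i n) (G (Sgen i n) (T i (G (Sgen i n) a)))"
    by (simp only:)
  also have "\<dots> = T i (G (Sgen i n) a)"
    using assms by (intro s_s) (auto simp: row_family_def)
  finally show ?thesis .
qed

lemma row_family_cyc:
  assumes T: "row_family n T"
  shows "\<lbrakk>1 \<le> i; i < k; k \<le> n; a \<in> Ob n\<rbrakk> \<Longrightarrow> T (Suc i) (foldr G (cyc k n) a) = foldr G (cyc k n) (T i a)"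
proof (induction k arbitrary: a)
  case (Suc k)
  show ?case
  proof (cases "i < k")
    case True
    then show ?thesis using Suc T by (simp add: cyc_Suc row_family_def)
  next
    case False
    then have k: "k = i" using Suc.prems by auto
    have "T (Suc i) (foldr G (cyc (Suc k) n) a) = T (Suc i) (foldr G (cyc i n) (G (Sgen i n) a))"
      using Suc.prems by (simp add: cyc_Suc k)
    also have "\<dots> = foldr G (cyc i n) (T (Suc i) (G (Sgen i n) a))"
      using Suc.prems T by (intro cyc_natural[symmetric]) (auto simp: k row_family_def)
    also have "\<dots> = foldr G (cyc (Suc k) n) (T i a)"
      using Suc.prems T by (simp add: cyc_Suc k row_family_def)
    finally show ?thesis .
  qed
qed simp

lemma row_family_cyc_first:
  assumes T: "row_family n T"
  shows "\<lbrakk>1 \<le> k; k \<le> n; a \<in> Ob n\<rbrakk> \<Longrightarrow> T 1 (foldr G (cyc k n) a) = foldr G (cyc k n) (T k a)"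
proof (induction k arbitrary: a)
  case (Suc k)
  then show ?case
    using T by (cases "k = 0") (auto simp: cyc_Suc row_family_swap)
qed simp

subsection \<open>Dropping and skipping the first point\<close>

text \<open>This absorption law and the two following ones come from \<open>\<rho> \<lambda> \<rho> = \<rho>\<close>, from \<open>\<lambda> \<rho> \<lambda> = \<lambda>\<close>, and
  from \<open>x e = e\<close> at the last point.\<close>

lemma e_rho_last: "a \<in> Ob n \<Longrightarrow> G (Egen (Suc n) (Suc n)) (G (Rho n) a) = G (Rho n) a"
  using rho_lam[of "G (Rho n) a" n] by (simp add: lam_rho)

lemma lam_e_last: "a \<in> Ob (Suc n) \<Longrightarrow> G (Lam n) (G (Egen (Suc n) (Suc n)) a) = G (Lam n) a"
  using rho_lam[of a n] lam_rho[of "G (Lam n) a" n] by simp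

lemma x_rho_last: "x \<in> X \<Longrightarrow> a \<in> Ob n \<Longrightarrow> G (Xgen x (Suc n) (Suc n)) (G (Rho n) a) = G (Rho n) a"
  using x_e[of x "Suc n" "Suc n" "G (Rho n) a"] by (simp add: e_rho_last)

lemma s_e_e: "\<lbrakk>1 \<le> i; i < n; a \<in> Ob n\<rbrakk> \<Longrightarrow>
  G (Sgen i n) (G (Egen i n) (G (Egen (Suc i) n) a)) = G (Egen i n) (G (Egen (Suc i) n) a)"
  using row_family_swap[OF row_family_e, of i n a]
  by (simp add: s_e e_e_comm[of "Suc i" n i] e_e_s)

text \<open>The map \<open>\<rho> \<rho>\<close> forgets the last two points. It therefore absorbs both idempotents at these points, and
  their product absorbs the swap of the two points.\<close>

lemma rho_rho:
  assumes "a \<in> Ob n"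
  shows "G (Sgen (Suc n) (Suc (Suc n))) (G (Rho (Suc n)) (G (Rho n) a)) = G (Rho (Suc n)) (G (Rho n) a)"
proof -
  let ?b = "G (Rho (Suc n)) (G (Rho n) a)"
  have "?b = G (Egen (Suc n) (Suc (Suc n))) (G (Egen (Suc (Suc n)) (Suc (Suc n))) ?b)"
    using assms by (simp add: e_rho_last e_rho)
  then show ?thesis using assms s_e_e[of "Suc n" "Suc (Suc n)" ?b] by simp
qed

text \<open>Insert the idempotent at the last point next to both \<open>\<lambda>\<close> and \<open>\<rho>\<close>. Moving the right one across the
  swap yields the product of both idempotents, which absorbs the swap.\<close>

lemma lam_s_rho:
  assumes "a \<in> Ob (Suc n)"
  shows "G (Lam (Suc n)) (G (Sgen (Suc n) (Suc (Suc n))) (G (Rho (Suc n)) a)) = G (Egen (Suc n) (Suc n)) a"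
proof -
  let ?m = "Suc (Suc n)"
  let ?b = "G (Rho (Suc n)) a"
  have b: "?b \<in> Ob ?m" using assms by simp
  have "G (Lam (Suc n)) (G (Sgen (Suc n) ?m) ?b) =
      G (Lam (Suc n)) (G (Egen ?m ?m) (G (Sgen (Suc n) ?m) (G (Egen ?m ?m) ?b)))"
    using b assms by (simp add: lam_e_last e_rho_last)
  also have "\<dots> = G (Lam (Suc n)) (G (Egen ?m ?m) (G (Egen (Suc n) ?m) (G (Sgen (Suc n) ?m) ?b)))"
    using b by (simp add: row_family_swap[OF row_family_e])
  also have "\<dots> = G (Lam (Suc n)) (G (Egen (Suc n) ?m) (G (Egen ?m ?m) ?b))"
    using b by (simp add: e_e_comm[of ?m ?m "Suc n"] e_e_s)
  also have "\<dots> = G (Egen (Suc n) (Suc n)) a"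
    using assms by (simp add: e_rho_last e_rho lam_rho)
  finally show ?thesis .
qed

lemma drop_row:
  assumes "a \<in> Ob n"
  shows "G (Egen 1 (Suc n)) (foldr G (drop_first n) a) = foldr G (drop_first n) a"
    and "x \<in> X \<Longrightarrow> G (Xgen x 1 (Suc n)) (foldr G (drop_first n) a) = foldr G (drop_first n) a"
  using assms row_family_cyc_first[OF row_family_e, of "Suc n" "Suc n" "G (Rho n) a"]
    row_family_cyc_first[OF row_family_x, of x "Suc n" "Suc n" "G (Rho n) a"]
  by (auto simp: drop_first_def e_rho_last x_rho_last)

text \<open>Dropping the first point is natural: with \<open>\<delta>\<close> for \<open>drop_first\<close>, this is
  \<open>(1 \<oplus> g) \<delta> = \<delta> g\<close>. The cases \<open>\<lambda>\<close> and \<open>\<rho>\<close> are the ones where the length of the cycle inside \<open>\<delta>\<close>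
  changes; \<open>lam_s_rho\<close> and \<open>rho_rho\<close> compensate for this.\<close>

lemma drop_edge:
  assumes "g \<in> arcs (wreath_digraph X)" "a \<in> Ob (edge_head g)"
  shows "G (up g) (foldr G (drop_first (edge_head g)) a) = foldr G (drop_first (edge_tail g)) (G g a)"
proof (cases g)
  case (Sgen i n)
  then show ?thesis using assms by (auto simp: drop_first_def s_cyc s_rho)
next
  case (Egen i n)
  then show ?thesis using assms row_family_cyc[OF row_family_e, of i "Suc n" "Suc n" "G (Rho n) a"]
    by (auto simp: drop_first_def e_rho)
next
  case (Xgen x i n)
  then show ?thesis using assms row_family_cyc[OF row_family_x, of x i "Suc n" "Suc n" "G (Rho n) a"]
    by (auto simp: drop_first_def x_rho)
next
  case (Lam n)
  have "G (Lam (Suc n)) (foldr G (cyc (Suc n) (Suc (Suc n))) b) =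
        foldr G (cyc (Suc n) (Suc n)) (G (Lam (Suc n)) b)" if "b \<in> Ob (Suc (Suc n))" for b
    using that by (intro cyc_natural[symmetric]) (auto simp: s_lam)
  then show ?thesis using Lam assms
    by (auto simp: drop_first_def cyc_Suc[of "Suc n"] lam_s_rho rho_lam)
next
  case (Rho n)
  have "G (Rho (Suc n)) (foldr G (cyc (Suc n) (Suc n)) b) =
        foldr G (cyc (Suc n) (Suc (Suc n))) (G (Rho (Suc n)) b)" if "b \<in> Ob (Suc n)" for b
    using that by (intro cyc_natural[symmetric]) (auto simp: s_rho)
  then show ?thesis using Rho assms
    by (auto simp: drop_first_def cyc_Suc[of "Suc n"] rho_rho)
qed

lemma skip_cyc: "\<lbrakk>1 \<le> j; j \<le> Suc n; a \<in> Ob (Suc n)\<rbrakk> \<Longrightarrow>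
  foldr G (skip 1 n) (foldr G (cyc j (Suc n)) a) = foldr G (skip j n) a"
proof (induction j arbitrary: a)
  case (Suc j)
  then show ?case by (cases "j = 0") (auto simp: cyc_Suc skip_Suc[of j] s_s)
qed simp

lemma skip_drop: "a \<in> Ob n \<Longrightarrow> foldr G (skip 1 n) (foldr G (drop_first n) a) = a"
  by (simp add: drop_first_def skip_cyc[simplified] skip_last lam_rho)

lemma drop_skip:
  assumes "a \<in> Ob (Suc n)"
  shows "foldr G (drop_first n) (foldr G (skip 1 n) a) = G (Egen 1 (Suc n)) a"
proof -
  define b where "b = foldr G (rev (cyc (Suc n) (Suc n))) a"
  have b: "b \<in> Ob (Suc n)" "a = foldr G (cyc (Suc n) (Suc n)) b"
    using cyc_rev[of "Suc n" "Suc n" a] assms by (auto simp: b_def)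
  have "foldr G (skip 1 n) a = G (Lam n) b"
    using b by (simp add: skip_cyc[simplified] skip_last)
  then show ?thesis
    using b row_family_cyc_first[OF row_family_e, of "Suc n" "Suc n" b]
    by (simp add: drop_first_def rho_lam)
qed

subsection \<open>Commutation with shifted generators\<close>

lemma up_in: "\<lbrakk>g \<in> arcs (wreath_digraph X); a \<in> Ob (Suc (edge_head g))\<rbrakk> \<Longrightarrow> G (up g) a \<in> Ob (Suc (edge_tail g))"
  using G_in[of "up g" a] by simp

lemma up_e: "\<lbrakk>g \<in> arcs (wreath_digraph X); a \<in> Ob (Suc (edge_head g))\<rbrakk> \<Longrightarrow>
  G (up g) (G (Egen 1 (Suc (edge_head g))) a) = G (Egen 1 (Suc (edge_tail g))) (G (up g) a)"
  by (cases g) (auto simp: s_e_comm e_e_comm[of _ _ "Suc 0"] e_x_comm e_lam e_rho)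

lemma up_x: "\<lbrakk>g \<in> arcs (wreath_digraph X); a \<in> Ob (Suc (edge_head g)); x \<in> X\<rbrakk> \<Longrightarrow>
  G (up g) (G (Xgen x 1 (Suc (edge_head g))) a) = G (Xgen x 1 (Suc (edge_tail g))) (G (up g) a)"
  by (cases g) (auto simp: s_x_comm x_x_comm[of _ x _ _ "Suc 0"] e_x_comm x_lam x_rho)

lemma up_up_s: "\<lbrakk>g \<in> arcs (wreath_digraph X); a \<in> Ob (Suc (Suc (edge_head g)))\<rbrakk> \<Longrightarrow>
  G (up (up g)) (G (Sgen 1 (Suc (Suc (edge_head g)))) a) =
  G (Sgen 1 (Suc (Suc (edge_tail g)))) (G (up (up g)) a)"
  by (cases g) (auto simp: s_e_comm s_s_comm[of "Suc 0"] s_x_comm s_lam s_rho)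

lemma up_word: "\<lbrakk>g \<in> arcs (wreath_digraph X); set w \<subseteq> X; a \<in> Ob (Suc (edge_head g))\<rbrakk> \<Longrightarrow>
  G (up g) (foldr G (word_at w 1 (Suc (edge_head g))) a) =
  foldr G (word_at w 1 (Suc (edge_tail g))) (G (up g) a)"
proof (induction w)
  case (Cons x w)
  then have "foldr G (word_at w 1 (Suc (edge_head g))) a \<in> Ob (Suc (edge_head g))" by simp
  with Cons show ?case using up_x[of g _ x] by (simp add: word_at_def)
qed (simp add: word_at_def)

text \<open>Write \<open>\<delta>\<close> for \<open>drop_first\<close> and \<open>\<eta>\<close> for \<open>skip 1\<close>. Then \<open>\<eta> \<delta> = 1\<close> and \<open>\<delta> \<eta> = e\<^sub>1\<close>, so the
  naturality of \<open>\<eta>\<close> follows from that of \<open>\<delta>\<close>: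
  \<open>g \<eta> = \<eta> \<delta> g \<eta> = \<eta> (1 \<oplus> g) \<delta> \<eta> = \<eta> (1 \<oplus> g) e\<^sub>1 = \<eta> e\<^sub>1 (1 \<oplus> g) = \<eta> \<delta> \<eta> (1 \<oplus> g) = \<eta> (1 \<oplus> g)\<close>.\<close>

lemma skip_edge:
  assumes "g \<in> arcs (wreath_digraph X)" "a \<in> Ob (Suc (edge_head g))"
  shows "G g (foldr G (skip 1 (edge_head g)) a) = foldr G (skip 1 (edge_tail g)) (G (up g) a)"
proof -
  let ?d = "\<lambda>n. foldr G (drop_first n)" and ?s = "\<lambda>n. foldr G (skip 1 n)"
  let ?h = "edge_head g" and ?t = "edge_tail g"
  have up_a: "G (up g) a \<in> Ob (Suc ?t)" using assms by (rule up_in)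
  have sa: "?s ?h a \<in> Ob ?h" using assms by simp
  have "G g (?s ?h a) = ?s ?t (?d ?t (G g (?s ?h a)))"
    using assms sa skip_drop[of "G g (?s ?h a)" ?t] by (simp add: G_in)
  also have "\<dots> = ?s ?t (G (up g) (?d ?h (?s ?h a)))"
    using assms sa by (simp add: drop_edge)
  also have "\<dots> = ?s ?t (G (Egen 1 (Suc ?t)) (G (up g) a))"
    using assms drop_skip[of a ?h] up_e[of g a] by simp
  also have "\<dots> = ?s ?t (?d ?t (?s ?t (G (up g) a)))"
    using up_a drop_skip[of "G (up g) a" ?t] by simp
  also have "\<dots> = ?s ?t (G (up g) a)"
    using up_a skip_drop[of "?s ?t (G (up g) a)" ?t] by simp
  finally show ?thesis .
qed

lemma drop_path: "\<lbrakk>is_path X m p n; a \<in> Ob n\<rbrakk> \<Longrightarrow>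
  foldr G (map up p) (foldr G (drop_first n) a) = foldr G (drop_first m) (foldr G p a)"
  unfolding foldr_map_up
  by (rule foldr_natural[where T = "\<lambda>n. foldr G (drop_first n)" and B = Ob and F' = G])
    (auto simp: drop_edge intro: G_in)

lemma skip_path: "\<lbrakk>is_path X m p n; a \<in> Ob (Suc n)\<rbrakk> \<Longrightarrow>
  foldr G p (foldr G (skip 1 n) a) = foldr G (skip 1 m) (foldr G (map up p) a)"
  unfolding foldr_map_up
  by (rule foldr_natural[where T = "\<lambda>n. foldr G (skip 1 n)" and B = "\<lambda>n. Ob (Suc n)" and F = G])
    (use skip_edge up_in in auto)

lemma s_path: "\<lbrakk>is_path X m p n; a \<in> Ob (Suc (Suc n))\<rbrakk> \<Longrightarrow>
  foldr G (map up (map up p)) (G (Sgen 1 (Suc (Suc n))) a) =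
  G (Sgen 1 (Suc (Suc m))) (foldr G (map up (map up p)) a)"
  unfolding foldr_map_up
  by (rule foldr_natural[where T = "\<lambda>n. G (Sgen 1 (Suc (Suc n)))" and B = "\<lambda>n. Ob (Suc (Suc n))"])
    (use up_up_s G_in[of "up (up _)"] in auto)

lemma word_path: "\<lbrakk>is_path X m p n; set w \<subseteq> X; a \<in> Ob (Suc n)\<rbrakk> \<Longrightarrow>
  foldr G (map up p) (foldr G (word_at w 1 (Suc n)) a) =
  foldr G (word_at w 1 (Suc m)) (foldr G (map up p) a)"
  unfolding foldr_map_up
  by (rule foldr_natural[where T = "\<lambda>n. foldr G (word_at w 1 (Suc n))" and B = "\<lambda>n. Ob (Suc n)"])
    (use up_word up_in in auto)

subsection \<open>Commutation of cycles with skips\<close>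

lemma s_skip:
  assumes "1 \<le> i" "Suc i < j" "j \<le> Suc n" "a \<in> Ob (Suc n)"
  shows "G (Sgen i n) (foldr G (skip j n) a) = foldr G (skip j n) (G (Sgen i (Suc n)) a)"
  using assms(3,2,4)
proof (induction j arbitrary: a rule: inc_induct)
  case base
  then show ?case using assms(1) by (simp add: skip_last s_lam)
next
  case (step j)
  then show ?case using assms(1) by (simp add: skip_Suc[of j] s_s_comm[of i j])
qed

lemma cyc_skip_less:
  assumes "k < j" "j \<le> Suc n" "a \<in> Ob (Suc n)"
  shows "foldr G (cyc k n) (foldr G (skip j n) a) = foldr G (skip j n) (foldr G (cyc k (Suc n)) a)"
  using assms by (intro cyc_natural) (auto simp: s_skip)

text \<open>Since \<open>skip j\<close> is \<open>skip 1\<close> followed by \<open>cyc j\<close>, naturality of \<open>skip 1\<close> turns this into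
  \<open>cyc_cyc\<close>.\<close>

lemma cyc_skip_ge:
  assumes "1 \<le> j" "j \<le> k" "k \<le> n" "a \<in> Ob (Suc n)"
  shows "foldr G (cyc k n) (foldr G (skip j n) a) =
    foldr G (skip (Suc j) n) (foldr G (cyc (Suc k) (Suc n)) a)"
proof -
  have "foldr G (cyc k n) (foldr G (skip j n) a) =
        foldr G (cyc k n) (foldr G (skip 1 n) (foldr G (cyc j (Suc n)) a))"
    using assms skip_cyc[of j n a] by simp
  also have "\<dots> = foldr G (skip 1 n) (foldr G (map up (cyc k n)) (foldr G (cyc j (Suc n)) a))"
    using assms by (intro skip_path) auto
  also have "\<dots> = foldr G (skip 1 n) (foldr G (cyc (Suc j) (Suc n)) (foldr G (cyc (Suc k) (Suc n)) a))"
    using assms cyc_cyc[of j k n a] by (simp del: foldr_map)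
  also have "\<dots> = foldr G (skip (Suc j) n) (foldr G (cyc (Suc k) (Suc n)) a)"
    using assms by (intro skip_cyc) auto
  finally show ?thesis .
qed

subsection \<open>Maps with empty domain\<close>

text \<open>The last two points are outside the image of \<open>\<lambda> \<lambda>\<close>, so both of their idempotents can be inserted, and
  their product absorbs the swap.\<close>

lemma lam_lam_s:
  assumes "a \<in> Ob (Suc (Suc n))"
  shows "G (Lam n) (G (Lam (Suc n)) (G (Sgen (Suc n) (Suc (Suc n))) a)) = G (Lam n) (G (Lam (Suc n)) a)"
proof -
  let ?m = "Suc (Suc n)"
  have *: "G (Lam n) (G (Lam (Suc n)) b) =
      G (Lam n) (G (Lam (Suc n)) (G (Egen (Suc n) ?m) (G (Egen ?m ?m) b)))" if "b \<in> Ob ?m" for b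
    using that by (simp add: e_e_comm[of "Suc n" ?m ?m] lam_e_last e_lam[symmetric])
  show ?thesis using assms *[of a] *[of "G (Sgen (Suc n) ?m) a"] by (simp add: e_e_s)
qed

lemma empty_s: "\<lbrakk>1 \<le> i; i < n; a \<in> Ob n\<rbrakk> \<Longrightarrow>
  foldr G (empty_map n) (G (Sgen i n) a) = foldr G (empty_map n) a"
proof (induction n arbitrary: a)
  case (Suc n)
  show ?case
  proof (cases "i < n")
    case True
    then show ?thesis using Suc by (simp add: empty_map_Suc s_lam[symmetric])
  next
    case False
    then have "i = n" using Suc.prems by simp
    then obtain n' where n: "n = Suc n'" "i = Suc n'" using Suc.prems by (cases n) auto
    show ?thesis using Suc.prems unfolding n by (simp add: empty_map_Suc lam_lam_s)
  qed
qed simp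

lemma empty_swaps: "\<lbrakk>\<forall>i\<in>set is. 1 \<le> i \<and> i < n; a \<in> Ob n\<rbrakk> \<Longrightarrow>
  foldr G (empty_map n) (foldr G (map (\<lambda>i. Sgen i n) is) a) = foldr G (empty_map n) a"
proof (induction "is")
  case (Cons i "is")
  then have "foldr G (map (\<lambda>i. Sgen i n) is) a \<in> Ob n"
    by (intro path_in[of n _ n]) (auto intro: is_path_swaps)
  with Cons show ?case using empty_s by (simp del: foldr_map)
qed simp

lemma empty_cyc: "\<lbrakk>k \<le> n; a \<in> Ob n\<rbrakk> \<Longrightarrow>
  foldr G (empty_map n) (foldr G (cyc k n) a) = foldr G (empty_map n) a"
  unfolding cyc_def by (rule empty_swaps) auto

lemma empty_skip: "\<lbrakk>1 \<le> j; j \<le> Suc n; a \<in> Ob (Suc n)\<rbrakk> \<Longrightarrow>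
  foldr G (empty_map n) (foldr G (skip j n) a) = foldr G (empty_map (Suc n)) a"
  using empty_swaps[of "rev [j..<Suc n]" "Suc n" a]
  by (simp add: skip_def empty_map_Suc del: upt_Suc foldr_map rev_map)

lemma lam_word: "\<lbrakk>set w \<subseteq> X; a \<in> Ob 1\<rbrakk> \<Longrightarrow> G (Lam 0) (foldr G (word_at w 1 1) a) = G (Lam 0) a"
proof (induction w)
  case (Cons x w)
  let ?b = "foldr G (word_at w 1 1) a"
  have b: "?b \<in> Ob 1" "x \<in> X" using Cons.prems by auto
  have "G (Lam 0) (G (Xgen x 1 1) ?b) = G (Lam 0) (G (Egen 1 1) (G (Xgen x 1 1) ?b))"
    using b lam_e_last[of "G (Xgen x 1 1) ?b" 0] by simp
  also have "\<dots> = G (Lam 0) ?b"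
    using b lam_e_last[of ?b 0] by (simp add: e_x)
  finally show ?case using Cons by (simp add: word_at_def)
qed (simp add: word_at_def)

end

section \<open>The action of generators on lists of rows\<close>

text \<open>Left multiplication by generators in terms of rows. Points are counted from \<open>1\<close> and list positions
  from \<open>0\<close>, so row \<open>i\<close> is \<open>st ! (i - 1)\<close>.\<close>

fun act :: "'x edge \<Rightarrow> 'x row list \<Rightarrow> 'x row list" where
  "act (Sgen i n) st = st[i - 1 := st ! i, i := st ! (i - 1)]"
| "act (Egen i n) st = st[i - 1 := None]"
| "act (Xgen x i n) st = st[i - 1 := map_option (map_prod id (Cons x)) (st ! (i - 1))]"
| "act (Lam n) st = butlast st"
| "act (Rho n) st = st @ [None]"

text \<open>The lists of rows that describe partial injections into \<open>{1..n}\<close> with labels over \<open>X\<close>.\<close>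

definition valid :: "'x set \<Rightarrow> nat \<Rightarrow> 'x row list \<Rightarrow> bool" where
  "valid X n st \<longleftrightarrow>
     (\<forall>k < length st. \<forall>j w. st ! k = Some (j, w) \<longrightarrow> 1 \<le> j \<and> j \<le> n \<and> set w \<subseteq> X) \<and>
     (\<forall>k < length st. \<forall>l < length st. \<forall>j v w. st ! k = Some (j, v) \<longrightarrow> st ! l = Some (j, w) \<longrightarrow> k = l)"

lemma valid_Nil [simp]: "valid X n []"
  by (simp add: valid_def)

lemma valid_None [simp]: "valid X n (None # st) \<longleftrightarrow> valid X n st"
  by (simp add: valid_def All_less_Suc2)

lemma valid_Some [simp]: "valid X n (Some (j, w) # st) \<longleftrightarrow>
  1 \<le> j \<and> j \<le> n \<and> set w \<subseteq> X \<and> (\<forall>v. Some (j, v) \<notin> set st) \<and> valid X n st"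
  by (auto simp: valid_def All_less_Suc2 in_set_conv_nth)

lemma squash_notin:
  assumes "\<forall>w. Some (j, w) \<notin> set st" "\<forall>w. Some (k, w) \<notin> set st" "j \<noteq> k"
  shows "\<forall>w. Some (squash k j, w) \<notin> set (map_col (squash k) st)"
proof -
  have "squash k c \<noteq> squash k j" if "c \<noteq> j" "c \<noteq> k" for c
    using that assms(3) by (auto simp: squash_def)
  then show ?thesis using assms unfolding map_col_def
    by (auto simp: map_option_case split: option.splits) (metis not_None_eq surj_pair)
qed

lemma valid_squash:
  assumes "valid X (Suc n) st" "\<forall>w. Some (j, w) \<notin> set st" "1 \<le> j" "j \<le> Suc n"
  shows "valid X n (map_col (squash j) st)"
  using assms
proof (induction st)
  case (Cons r st)
  show ?case
  proof (cases r)
    case (Some p)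
    then obtain c w where r: "r = Some (c, w)" by (cases p) auto
    have "c \<noteq> j" using Cons.prems by (auto simp: r)
    then have "\<forall>w. Some (squash j c, w) \<notin> set (map_col (squash j) st)"
      using Cons.prems by (intro squash_notin) (auto simp: r)
    moreover have "1 \<le> squash j c" "squash j c \<le> n"
      using Cons.prems \<open>c \<noteq> j\<close> by (auto simp: r squash_def)
    ultimately show ?thesis using Cons by (simp add: r)
  qed (use Cons in simp)
qed simp

lemma length_act [simp]:
  "length st = edge_head g \<Longrightarrow> length (act g st) = edge_tail g"
  by (cases g) auto

text \<open>Validity survives whenever the rows of the new list come from different rows of the old one, keep their
  columns and have words over \<open>X\<close>.\<close>

lemma valid_transfer:
  assumes "valid X n st" "inj f"
    and rows: "\<And>k j w. \<lbrakk>k < length st'; st' ! k = Some (j, w)\<rbrakk> \<Longrightarrow>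
      f k < length st \<and> (\<exists>v. st ! f k = Some (j, v) \<and> (set v \<subseteq> X \<longrightarrow> set w \<subseteq> X))"
  shows "valid X n st'"
  unfolding valid_def
proof (intro conjI allI impI)
  fix k j w assume "k < length st'" "st' ! k = Some (j, w)"
  with rows obtain v where "f k < length st" "st ! f k = Some (j, v)" "set v \<subseteq> X \<longrightarrow> set w \<subseteq> X"
    by blast
  with assms(1) show "1 \<le> j" "j \<le> n" "set w \<subseteq> X" unfolding valid_def by blast+
next
  fix k l j v w
  assume "k < length st'" "l < length st'" "st' ! k = Some (j, v)" "st' ! l = Some (j, w)"
  then have "f k = f l" using rows assms(1) unfolding valid_def by meson
  then show "k = l" using assms(2) by (simp add: inj_eq)
qed

lemma valid_act:
  assumes "valid X n st" "g \<in> arcs (wreath_digraph X)" "length st = edge_head g"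
  shows "valid X n (act g st)"
proof (cases g)
  case (Sgen i m)
  have "inj (transpose (i - 1) i)" by (rule bij_is_inj) simp
  then show ?thesis
    by (rule valid_transfer[OF assms(1)])
      (use Sgen assms in \<open>auto simp: nth_list_update transpose_def split: if_splits\<close>)
next
  case (Egen i m)
  show ?thesis
    by (rule valid_transfer[OF assms(1) inj_on_id])
      (use Egen assms in \<open>auto simp: nth_list_update split: if_splits\<close>)
next
  case (Xgen x i m)
  show ?thesis
    by (rule valid_transfer[OF assms(1) inj_on_id])
      (use Xgen assms in \<open>auto simp: nth_list_update split: if_splits\<close>)
next
  case (Lam m)
  show ?thesis
    by (rule valid_transfer[OF assms(1) inj_on_id]) (use Lam in \<open>auto simp: nth_butlast\<close>)
next
  case (Rho m)
  show ?thesis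
    by (rule valid_transfer[OF assms(1) inj_on_id])
      (use Rho in \<open>auto simp: nth_append less_Suc_eq split: if_splits\<close>)
qed

lemma act_up:
  assumes "g \<in> arcs (wreath_digraph X)" "length st = edge_head g"
  shows "act (up g) (r # st) = r # act g st"
  using assms by (cases g) (auto simp: gr0_conv_Suc Suc_le_eq)

lemma act_map_col:
  assumes "g \<in> arcs (wreath_digraph X)" "length st = edge_head g"
  shows "act g (map_col f st) = map_col f (act g st)"
  using assms
  by (cases g)
    (auto simp: map_col_def map_update map_butlast option.map_comp prod.map_comp o_def)

lemma edge_cases:
  assumes "g \<in> arcs (wreath_digraph X)"
  obtains (up) g' where "g' \<in> arcs (wreath_digraph X)" "g = up g'"
  | (s) n where "g = Sgen 1 (Suc (Suc n))"
  | (e) n where "g = Egen 1 (Suc n)"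
  | (x) x n where "g = Xgen x 1 (Suc n)" "x \<in> X"
  | (lam) "g = Lam 0"
  | (rho) "g = Rho 0"
proof (cases g)
  case (Sgen i n)
  show thesis
  proof (cases "i = 1")
    case True
    then show thesis using Sgen assms s[of "n - 2"] by (simp add: numeral_2_eq_2 Suc_diff_Suc)
  next
    case False
    then show thesis using Sgen assms by (intro up[of "Sgen (i - 1) (n - 1)"]) auto
  qed
next
  case (Egen i n)
  show thesis
  proof (cases "i = 1")
    case True
    then show thesis using Egen assms e[of "n - 1"] by simp
  next
    case False
    then show thesis using Egen assms by (intro up[of "Egen (i - 1) (n - 1)"]) auto
  qed
next
  case (Xgen y i n)
  show thesis
  proof (cases "i = 1")
    case True
    then show thesis using Xgen assms x[of y "n - 1"] by simp
  next
    case False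
    then show thesis using Xgen assms by (intro up[of "Xgen y (i - 1) (n - 1)"]) auto
  qed
next
  case (Lam n)
  then show thesis using lam up[of "Lam (n - 1)"] by (cases n) auto
next
  case (Rho n)
  then show thesis using rho up[of "Rho (n - 1)"] by (cases n) auto
qed

lemma map_col_map_col: "map_col f (map_col h st) = map_col (f \<circ> h) st"
  by (simp add: map_col_def option.map_comp map_prod.comp)

lemma map_col_cong:
  "(\<And>c w. Some (c, w) \<in> set st \<Longrightarrow> f c = h c) \<Longrightarrow> map_col f st = map_col h st"
  by (auto simp: map_col_def intro!: option.map_cong0)

lemma squash_squash:
  assumes "l < k" "\<forall>w. Some (l, w) \<notin> set st" "\<forall>w. Some (k, w) \<notin> set st"
  shows "map_col (squash (k - 1)) (map_col (squash l) st) = map_col (squash l) (map_col (squash k) st)"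
  unfolding map_col_map_col
  by (rule map_col_cong) (use assms in \<open>auto simp: squash_def\<close>)

section \<open>Normal forms absorb generators\<close>

lemma is_path_nf: "valid X n st \<Longrightarrow> is_path X (length st) (nf n st) n"
proof (induction n st rule: nf.induct)
  case (2 n st)
  then show ?case using is_path_drop_first[of X "length st"] by (auto intro!: exI[of _ "length st"])
next
  case (3 n j w st)
  then obtain n' where n: "n = Suc n'" by (cases n) auto
  have "is_path X (length st) (nf n' (map_col (squash j) st)) n'"
    using 3 valid_squash[of X n' st j] by (simp add: n)
  then have "is_path X (Suc (length st)) (map up (nf n' (map_col (squash j) st))) (Suc n')"
    by (rule is_path_up)
  then show ?case
    using 3(2) is_path_word_at[of w X 1 "Suc (length st)"] by (auto simp: n)
qed auto

text \<open>If column \<open>j\<close> is unused, the normal form in degree \<open>n + 1\<close> factors through the injection that misses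
  \<open>j\<close>. For a nonempty first row, the skip is moved across the cycle with \<open>cyc_skip_less\<close> or
  \<open>cyc_skip_ge\<close>; what comes out is again a shifted skip, to which the induction hypothesis
  applies in the shifted representation.\<close>

lemma nf_skip:
  assumes "wreath_model X R G Ob" "valid X (Suc n) st" "\<forall>w. Some (j, w) \<notin> set st"
    "1 \<le> j" "j \<le> Suc n" "a \<in> Ob (Suc n)"
  shows "foldr G (nf n (map_col (squash j) st)) (foldr G (skip j n) a) = foldr G (nf (Suc n) st) a"
  using assms
proof (induction "length st" arbitrary: st n j a G Ob)
  case 0
  then interpret wreath_model X R G Ob by simp
  show ?case using 0 by (simp add: empty_skip)
next
  case (Suc m)
  interpret wreath_model X R G Ob by fact
  interpret up: wreath_model X R "\<lambda>g. G (up g)" "\<lambda>n. Ob (Suc n)"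
    by (rule wreath_model_up) fact
  obtain r st' where st: "st = r # st'" "m = length st'" using Suc.hyps(2) by (cases st) auto
  show ?case
  proof (cases r)
    case None
    then show ?thesis using Suc.prems Suc.hyps(1)[of st' G Ob n j a] by (simp add: st)
  next
    case (Some kw)
    then obtain k w where r: "r = Some (k, w)" by (cases kw) auto
    have k: "1 \<le> k" "k \<le> Suc n" "k \<noteq> j" and notin: "\<forall>w. Some (k, w) \<notin> set st'" "\<forall>w. Some (j, w) \<notin> set st'"
      and w: "set w \<subseteq> X" and valid: "valid X (Suc n) st'"
      using Suc.prems by (auto simp: st r)
    then obtain n' where n: "n = Suc n'" using Suc.prems by (cases n) auto
    let ?b = "foldr G (cyc k (Suc n)) a"
    have b: "?b \<in> Ob (Suc n)" using k Suc.prems by simp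
    \<comment> \<open>Once column \<open>k\<close> is deleted, column \<open>j\<close> has the number \<open>squash k j\<close>.\<close>
    have IH: "foldr G (map up (nf n' (map_col (squash (squash k j)) (map_col (squash k) st'))))
          (foldr G (map up (skip (squash k j) n')) ?b)
        = foldr G (map up (nf n (map_col (squash k) st'))) ?b"
      unfolding foldr_map_up n
      using b k Suc.prems valid_squash[OF valid notin(1)] squash_notin[OF notin(2,1)]
      by (intro Suc.hyps(1)) (auto simp: n st squash_def intro: up.wreath_model_axioms)
    show ?thesis
    proof (cases "k < j")
      case True
      have "foldr G (cyc k n) (foldr G (skip j n) a) = foldr G (map up (skip (squash k j) n')) ?b"
        using True k Suc.prems by (simp add: cyc_skip_less squash_def n)
      moreover have "map_col (squash (squash k j)) (map_col (squash k) st') = map_col (squash k) (map_col (squash j) st')"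
        using True notin squash_squash[of k j st'] by (simp add: squash_def[of k j])
      ultimately show ?thesis using IH True by (simp add: st r squash_def[of j k] n del: foldr_map)
    next
      case False
      then have jk: "j < k" using k by simp
      then have "foldr G (cyc (k - 1) n) (foldr G (skip j n) a) = foldr G (map up (skip (squash k j) n')) ?b"
        using k Suc.prems cyc_skip_ge[of j "k - 1" n a] by (simp add: squash_def n del: foldr_map)
      moreover have "map_col (squash (squash k j)) (map_col (squash k) st') = map_col (squash (k - 1)) (map_col (squash j) st')"
        using jk notin squash_squash[of j k st'] by (simp add: squash_def[of k j])
      ultimately show ?thesis using IH jk by (simp add: st r squash_def[of j k] n del: foldr_map)
    qed
  qed
qed

context wreath_model
begin

lemma s_drop: "a \<in> Ob (Suc n) \<Longrightarrow>
  G (Sgen 1 (Suc (Suc n))) (foldr G (drop_first (Suc n)) a) = foldr G (map up (drop_first n)) a"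
  using path_in[of "Suc (Suc n)" "map up (drop_first n)" "Suc n" a]
  by (simp add: drop_first_def cyc_Cons s_s del: foldr_map)

lemma s_word: "\<lbrakk>set w \<subseteq> X; 1 < m; a \<in> Ob m\<rbrakk> \<Longrightarrow>
  G (Sgen 1 m) (foldr G (word_at w 1 m) a) = foldr G (word_at w 2 m) (G (Sgen 1 m) a)"
proof (induction w)
  case (Cons x w)
  then have "foldr G (word_at w 1 m) a \<in> Ob m" by simp
  with Cons show ?case using s_x[of x 1 m "foldr G (word_at w 1 m) a"]
    by (simp add: word_at_def numeral_2_eq_2)
qed (simp add: word_at_def)

lemma s_word_back:
  assumes "set w \<subseteq> X" "1 < m" "a \<in> Ob m"
  shows "G (Sgen 1 m) (foldr G (word_at w 2 m) a) = foldr G (word_at w 1 m) (G (Sgen 1 m) a)"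
proof -
  have "foldr G (word_at w 2 m) a = G (Sgen 1 m) (foldr G (word_at w 1 m) (G (Sgen 1 m) a))"
    using assms s_word[of w m "G (Sgen 1 m) a"] by (simp add: s_s)
  moreover have "foldr G (word_at w 1 m) (G (Sgen 1 m) a) \<in> Ob m"
    using assms by simp
  ultimately show ?thesis using assms by (simp only: s_s)
qed

end

text \<open>It is enough to consider \<open>l < k\<close>, as \<open>s\<^sub>1\<close> is an involution. The swap exchanges the positions
  of the two labels, passes through the twice shifted rest, and finally acts on the product of the two
  cycles, where \<open>cyc_cyc\<close> applies.\<close>

lemma nf_swap_Some:
  assumes "wreath_model X R G Ob" "valid X n (Some (k, y) # Some (l, z) # st)" "l < k" "a \<in> Ob n"
  shows "G (Sgen 1 (Suc (Suc (length st)))) (foldr G (nf n (Some (k, y) # Some (l, z) # st)) a) =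
     foldr G (nf n (Some (l, z) # Some (k, y) # st)) a"
proof -
  interpret wreath_model X R G Ob by fact
  interpret up: wreath_model X R "\<lambda>g. G (up g)" "\<lambda>n. Ob (Suc n)"
    by (rule wreath_model_up) fact
  have props: "1 \<le> l" "k \<le> n" "set y \<subseteq> X" "set z \<subseteq> X"
    "\<forall>w. Some (k, w) \<notin> set st" "\<forall>w. Some (l, w) \<notin> set st" "valid X n st"
    using assms by auto
  then obtain n' where n: "n = Suc (Suc n')" using assms(3) by (cases n; cases "n - 1") auto
  let ?m = "Suc (Suc (length st))"
  let ?st = "map_col (squash l) (map_col (squash k) st)"
  let ?N = "map up (map up (nf n' ?st))"
  have vk: "valid X (Suc n') (map_col (squash k) st)"
    using props valid_squash[of X "Suc n'" st k] assms(3) by (simp add: n)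
  have "valid X n' ?st"
    using props valid_squash[OF vk, of l] squash_notin[of l st k] assms(3) by (simp add: n squash_def[of k l])
  then have path: "is_path X (length st) (nf n' ?st) n'"
    using is_path_nf by fastforce
  have pathN: "is_path X ?m ?N n" using path[THEN is_path_up, THEN is_path_up] by (simp only: n)
  have N_in: "foldr G ?N b \<in> Ob ?m" if "b \<in> Ob n" for b
    using path_in[OF pathN that] .
  let ?b = "foldr G (map up (cyc l (Suc n'))) (foldr G (cyc k n) a)"
  let ?c = "foldr G ?N ?b"
  have b: "?b \<in> Ob n"
    using props assms(3,4) by (intro path_in[of n _ n]) (auto simp: n)
  then have c: "?c \<in> Ob ?m" by (rule N_in)
  have two: "map up (word_at w 1 (Suc (length st))) = word_at w 2 ?m" for w :: "'a list"
    by (simp add: numeral_2_eq_2)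
  have word2_in: "foldr G (word_at w 2 ?m) d \<in> Ob ?m" if "set w \<subseteq> X" "d \<in> Ob ?m" for w d
    using that by simp
  have words: "foldr G (word_at y 2 ?m) (foldr G (word_at z 1 ?m) d) =
      foldr G (word_at z 1 ?m) (foldr G (word_at y 2 ?m) d)" if "d \<in> Ob ?m" for d
    using that props word_path[of "Suc (length st)" "word_at y 1 (Suc (length st))" "Suc (length st)" z d]
    by (simp add: is_path_word_at two[simplified] del: foldr_map)
  have "G (Sgen 1 n) ?b = foldr G (cyc (Suc l) n) (foldr G (cyc k n) a)"
    using props by (simp add: n cyc_Cons del: foldr_map)
  also have "\<dots> = foldr G (map up (cyc (k - 1) (Suc n'))) (foldr G (cyc l n) a)"
    using props assms(3,4) cyc_cyc[of l "k - 1" "Suc n'" a] by (simp add: n del: foldr_map)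
  finally have s_b: "G (Sgen 1 ?m) ?c = foldr G ?N (foldr G (map up (cyc (k - 1) (Suc n'))) (foldr G (cyc l n) a))"
    using s_path[OF path, of ?b] b by (simp add: n del: foldr_map map_map)
  have "foldr G (nf n (Some (k, y) # Some (l, z) # st)) a =
      foldr G (word_at y 1 ?m) (foldr G (word_at z 2 ?m) ?c)"
    using assms(3) by (simp add: n squash_def[of k l] numeral_2_eq_2 del: foldr_map map_map)
  then have "G (Sgen 1 ?m) (foldr G (nf n (Some (k, y) # Some (l, z) # st)) a) =
      foldr G (word_at z 1 ?m) (foldr G (word_at y 2 ?m) (G (Sgen 1 ?m) ?c))"
    using c props word2_in[of z ?c] words[of "G (Sgen 1 ?m) ?c"]
    by (simp add: s_word[simplified] s_word_back[simplified] del: foldr_map map_map)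
  also have "\<dots> = foldr G (nf n (Some (l, z) # Some (k, y) # st)) a"
    using assms(3) squash_squash[of l k st] props unfolding s_b
    by (simp add: n squash_def[of l k] numeral_2_eq_2 del: foldr_map map_map)
  finally show ?thesis .
qed

lemma nf_swap:
  assumes "wreath_model X R G Ob" "valid X n (r1 # r2 # st)" "a \<in> Ob n"
  shows "G (Sgen 1 (Suc (Suc (length st)))) (foldr G (nf n (r1 # r2 # st)) a) = foldr G (nf n (r2 # r1 # st)) a"
proof -
  interpret wreath_model X R G Ob by fact
  let ?m = "Suc (Suc (length st))"
  let ?P = "\<lambda>r1 r2. G (Sgen 1 ?m) (foldr G (nf n (r1 # r2 # st)) a) = foldr G (nf n (r2 # r1 # st)) a"
  have valid': "valid X n (r2 # r1 # st)"
    using assms(2) by (cases r1; cases r2) auto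
  \<comment> \<open>\<open>s\<^sub>1\<close> is an involution, so it suffices to treat one order of the two rows.\<close>
  have sym: "?P r1 r2" if "?P r2 r1"
    unfolding that[symmetric] using is_path_nf[OF valid'] assms(3)
    by (intro s_s) (auto intro: path_in[of _ _ n])
  have None_Some: "?P None (Some (k, y))" if valid: "valid X n (Some (k, y) # st)" for k y
  proof -
    obtain n' where n: "n = Suc n'" using valid by (cases n) auto
    let ?N = "nf n' (map_col (squash k) st)"
    let ?b = "foldr G (map up ?N) (foldr G (cyc k n) a)"
    have "is_path X (length st) ?N n'"
      using valid is_path_nf[OF valid_squash[of X n' st k]] by (simp add: n)
    then have b: "?b \<in> Ob (Suc (length st))"
      using valid assms(3) by (intro path_in[OF is_path_up, of _ _ n']) (auto simp: n)
    have y: "set y \<subseteq> X" using valid by simp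
    have "foldr G (nf n (None # Some (k, y) # st)) a =
        foldr G (drop_first (Suc (length st))) (foldr G (word_at y 1 (Suc (length st))) ?b)"
      by (simp add: n del: foldr_map)
    also have "\<dots> = foldr G (map up (word_at y 1 (Suc (length st)))) (foldr G (drop_first (Suc (length st))) ?b)"
      using b y by (intro drop_path[symmetric]) (auto intro: is_path_word_at)
    finally have "G (Sgen 1 ?m) (foldr G (nf n (None # Some (k, y) # st)) a) =
      G (Sgen 1 ?m) (foldr G (map up (word_at y 1 (Suc (length st)))) (foldr G (drop_first (Suc (length st))) ?b))"
      by simp
    also have "\<dots> = foldr G (word_at y 1 ?m) (G (Sgen 1 ?m) (foldr G (drop_first (Suc (length st))) ?b))"
      using b y s_word_back[of y ?m "foldr G (drop_first (Suc (length st))) ?b"]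
      by (simp add: numeral_2_eq_2 del: foldr_map)
    also have "G (Sgen 1 ?m) (foldr G (drop_first (Suc (length st))) ?b) = foldr G (map up (drop_first (length st))) ?b"
      using b by (rule s_drop)
    also have "foldr G (word_at y 1 ?m) \<dots> = foldr G (nf n (Some (k, y) # None # st)) a"
      by (simp add: n del: foldr_map)
    finally show ?thesis .
  qed
  show ?thesis
  proof (cases r1)
    case None
    show ?thesis
    proof (cases r2)
      case r2: None
      let ?b = "foldr G (nf n st) a"
      have b: "?b \<in> Ob (length st)"
        using assms path_in[OF is_path_nf[of X n st]] by (simp add: None r2)
      have "G (Sgen 1 ?m) (foldr G (drop_first (Suc (length st))) (foldr G (drop_first (length st)) ?b)) =
        foldr G (map up (drop_first (length st))) (foldr G (drop_first (length st)) ?b)"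
        using b by (intro s_drop) simp
      also have "\<dots> = foldr G (drop_first (Suc (length st))) (foldr G (drop_first (length st)) ?b)"
        using b by (intro drop_path) auto
      finally show ?thesis by (simp add: None r2)
    next
      case (Some p)
      then show ?thesis using None_Some[of "fst p" "snd p"] assms(2) None by (cases p) simp
    qed
  next
    case r1: (Some p)
    show ?thesis
    proof (cases r2)
      case None
      then show ?thesis using sym None_Some[of "fst p" "snd p"] assms(2) r1 by (cases p) simp
    next
      case r2: (Some q)
      obtain k y l z where pq: "p = (k, y)" "q = (l, z)" by (cases p; cases q)
      have "k \<noteq> l" using assms(2) by (auto simp: r1 r2 pq)
      then consider "l < k" | "k < l" by linarith
      then show ?thesis
      proof cases
        case 1
        then show ?thesis using nf_swap_Some[OF assms(1), of n k y l z st a] assms by (simp add: r1 r2 pq)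
      next
        case 2
        then show ?thesis using nf_swap_Some[OF assms(1), of n l z k y st a] assms valid'
          by (intro sym) (simp add: r1 r2 pq)
      qed
    qed
  qed
qed

text \<open>In the induction the representation is arbitrary. If \<open>g = up g'\<close> and the first row is not empty, the
  induction hypothesis is applied to \<open>g'\<close> and the representation composed with \<open>up\<close>. If \<open>g = e\<^sub>1\<close> and the
  first row is not empty, the idempotent absorbs the label and factors as \<open>drop_first\<close> followed by \<open>skip 1\<close>; the
  skip moves through the rest, merges with the cycle \<open>cyc j\<close> into \<open>skip j\<close>, and \<open>nf_skip\<close> restores
  the deleted column.\<close>

lemma nf_act:
  assumes "wreath_model X R G Ob" "valid X n st" "g \<in> arcs (wreath_digraph X)"
    "length st = edge_head g" "a \<in> Ob n"
  shows "G g (foldr G (nf n st) a) = foldr G (nf n (act g st)) a"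
  using assms
proof (induction "length st" arbitrary: st n g a G Ob)
  case 0
  then have "st = []" "edge_head g = 0" by auto
  then have "g = Rho 0" using 0 by (cases g) auto
  then show ?case using \<open>st = []\<close> by (simp add: drop_first_def)
next
  case (Suc m)
  interpret wreath_model X R G Ob by fact
  obtain r st' where st: "st = r # st'" and m: "m = length st'" using Suc.hyps(2) by (cases st) auto
  note len = Suc.prems(4)
  show ?case using Suc.prems(3)
  proof (cases rule: edge_cases)
    case (up g')
    have len': "length st' = edge_head g'" using len by (simp add: up st)
    note act = act_up[OF up(1) len', of r]
    show ?thesis
    proof (cases r)
      case None
      let ?b = "foldr G (nf n st') a"
      have "?b \<in> Ob (length st')"
        using Suc.prems path_in[OF is_path_nf[of X n st']] by (simp add: st None)
      moreover have "G g' ?b = foldr G (nf n (act g' st')) a"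
        using Suc.prems up len' by (intro Suc.hyps(1)) (auto simp: st None m intro: wreath_model_axioms)
      ultimately show ?thesis
        using drop_edge[of g' ?b] up len' act by (simp add: st None)
    next
      case (Some p)
      then obtain j w where r: "r = Some (j, w)" by (cases p) auto
      obtain n' where n: "n = Suc n'" using Suc.prems by (cases n) (auto simp: st r)
      let ?st = "map_col (squash j) st'"
      let ?b = "foldr G (cyc j n) a"
      have valid: "valid X n' ?st"
        using Suc.prems by (intro valid_squash) (auto simp: st r n)
      have b: "?b \<in> Ob (Suc n')" using Suc.prems by (simp add: st r n)
      have c: "foldr G (map up (nf n' ?st)) ?b \<in> Ob (Suc (edge_head g'))"
        using is_path_nf[OF valid] b by (intro path_in[OF is_path_up]) (auto simp: len')
      have IH: "G (up g') (foldr G (map up (nf n' ?st)) ?b) = foldr G (map up (nf n' (act g' ?st))) ?b"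
        unfolding foldr_map_up using b valid up len' Suc.prems(1)
        by (intro Suc.hyps(1)[where Ob = "\<lambda>n. Ob (Suc n)" and G = "\<lambda>g. G (up g)"])
          (auto simp: m intro: wreath_model_up)
      have "G g (foldr G (nf n st) a) =
          G (up g') (foldr G (word_at w 1 (Suc (edge_head g'))) (foldr G (map up (nf n' ?st)) ?b))"
        by (simp add: up st r n len' del: foldr_map)
      also have "\<dots> = foldr G (word_at w 1 (Suc (edge_tail g'))) (foldr G (map up (nf n' (act g' ?st))) ?b)"
        unfolding IH[symmetric] using Suc.prems up c by (intro up_word) (auto simp: st r)
      also have "\<dots> = foldr G (nf n (act g st)) a"
        using len' up act by (simp add: st r n act_map_col del: foldr_map)
      finally show ?thesis .
    qed
  next
    case (s l)
    then obtain r2 st'' where st': "st' = r2 # st''" "l = length st''" using len st by (cases st') auto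
    show ?thesis
      using nf_swap[OF Suc.prems(1), of n r r2 st'' a] Suc.prems by (simp add: s st st')
  next
    case (e l)
    then have l: "l = length st'" using len st by simp
    show ?thesis
    proof (cases r)
      case None
      then show ?thesis
        using Suc.prems path_in[OF is_path_nf[of X n st'], of a] drop_row(1)[of "foldr G (nf n st') a" l]
        by (simp add: st e l)
    next
      case (Some p)
      then obtain j w where r: "r = Some (j, w)" by (cases p) auto
      obtain n' where n: "n = Suc n'" using Suc.prems by (cases n) (auto simp: st r)
      let ?N = "nf n' (map_col (squash j) st')"
      let ?b = "foldr G (cyc j n) a"
      have j: "1 \<le> j" "j \<le> Suc n'" and w: "set w \<subseteq> X" and notin: "\<forall>w. Some (j, w) \<notin> set st'"
        and valid: "valid X (Suc n') st'"
        using Suc.prems by (auto simp: st r n)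
      have path: "is_path X l ?N n'"
        using is_path_nf[OF valid_squash[OF valid notin j]] by (simp add: l)
      have b: "?b \<in> Ob (Suc n')" using Suc.prems j by (simp add: n)
      have c: "foldr G (map up ?N) ?b \<in> Ob (Suc l)"
        using path b by (intro path_in[OF is_path_up])
      have e_word: "G (Egen 1 (Suc l)) (foldr G (word_at w 1 (Suc l)) c) = G (Egen 1 (Suc l)) c"
        if "c \<in> Ob (Suc l)" for c
        using w that
      proof (induction w)
        case (Cons x w)
        then have "foldr G (word_at w 1 (Suc l)) c \<in> Ob (Suc l)" by simp
        then show ?case using Cons e_x[of x 1 "Suc l"] by (simp add: word_at_def)
      qed (simp add: word_at_def)
      have "G g (foldr G (nf n st) a) = G (Egen 1 (Suc l)) (foldr G (map up ?N) ?b)"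
        using e_word[OF c] by (simp add: e st r l n del: foldr_map)
      also have "\<dots> = foldr G (drop_first l) (foldr G (skip 1 l) (foldr G (map up ?N) ?b))"
        using drop_skip[OF c] by simp
      also have "\<dots> = foldr G (drop_first l) (foldr G ?N (foldr G (skip 1 n') ?b))"
        using skip_path[OF path b] by simp
      also have "\<dots> = foldr G (drop_first l) (foldr G ?N (foldr G (skip j n') a))"
        using skip_cyc[of j n' a] j Suc.prems by (simp add: n)
      also have "\<dots> = foldr G (drop_first l) (foldr G (nf n st') a)"
        using nf_skip[OF Suc.prems(1) valid notin j, of a] Suc.prems by (simp add: n)
      also have "\<dots> = foldr G (nf n (act g st)) a"
        by (simp add: e st r l)
      finally show ?thesis .
    qed
  next
    case (x y l)
    then have l: "l = length st'" using len st by simp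
    show ?thesis
    proof (cases r)
      case None
      then show ?thesis
        using Suc.prems x path_in[OF is_path_nf[of X n st'], of a] drop_row(2)[of "foldr G (nf n st') a" l y]
        by (simp add: st l)
    next
      case (Some p)
      then show ?thesis by (cases p) (simp add: st x l word_at_def)
    qed
  next
    case lam
    then have st': "st' = []" using len st by simp
    show ?thesis
    proof (cases r)
      case None
      then show ?thesis
        using Suc.prems path_in[OF is_path_nf[of X n "[]"], of a]
        by (simp add: st st' lam drop_first_def lam_rho)
    next
      case (Some p)
      then obtain j w where r: "r = Some (j, w)" by (cases p) auto
      obtain n' where n: "n = Suc n'" using Suc.prems by (cases n) (auto simp: st r)
      have j: "1 \<le> j" "j \<le> n" and w: "set w \<subseteq> X" using Suc.prems by (auto simp: st r)
      let ?b = "foldr G (cyc j n) a"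
      have b: "?b \<in> Ob n" using j Suc.prems by simp
      have up_empty: "empty_map n = Lam 0 # map up (empty_map n')"
        by (simp add: n empty_map_def upt_conv_Cons map_Suc_upt[symmetric] o_def del: upt_Suc map_Suc_upt)
      have "foldr G (map up (empty_map n')) ?b \<in> Ob 1"
        using path_in[OF is_path_up[OF is_path_empty_map], of ?b n'] b by (simp add: n)
      then have "G g (foldr G (nf n st) a) = G (Lam 0) (foldr G (map up (empty_map n')) ?b)"
        using lam_word[OF w] by (simp add: st st' r lam n del: foldr_map)
      also have "\<dots> = foldr G (empty_map n) ?b" by (simp add: up_empty del: foldr_map)
      also have "\<dots> = foldr G (nf n (act g st)) a"
        using empty_cyc[of j n a] j Suc.prems by (simp add: st st' lam)
      finally show ?thesis .
    qed
  next
    case rho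
    then show ?thesis using len st by simp
  qed
qed

definition id_rows :: "nat \<Rightarrow> 'x row list" where
  "id_rows n = map (\<lambda>j. Some (j, [])) [1..<Suc n]"

lemma length_id_rows [simp]: "length (id_rows n) = n"
  by (simp add: id_rows_def)

lemma valid_id_rows: "valid X n (id_rows n)"
  by (auto simp: valid_def id_rows_def nth_append simp del: upt_Suc)

lemma id_rows_Suc: "id_rows (Suc n) = Some (1, []) # map_col Suc (id_rows n)"
  by (simp add: id_rows_def map_col_def upt_conv_Cons map_Suc_upt[symmetric] o_def del: upt_Suc map_Suc_upt)

lemma nf_id_rows: "nf n (id_rows n) = ([] :: 'x edge list)"
proof (induction n)
  case 0
  then show ?case by (simp add: id_rows_def empty_map_def)
next
  case (Suc n)
  have "map_col (squash 1) (map_col Suc (id_rows n)) = map_col id (id_rows n :: 'x row list)"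
    unfolding map_col_map_col by (rule map_col_cong) (auto simp: squash_def id_rows_def)
  also have "\<dots> = id_rows n"
    by (simp add: map_col_def option.map_id0 prod.map_id0)
  finally show ?case using Suc by (simp add: id_rows_Suc word_at_def)
qed

lemma act_path:
  assumes "is_path X m p k" "length st = k" "valid X n st"
  shows "length (foldr act p st) = m" "valid X n (foldr act p st)"
proof -
  have "length (foldr act p st) = m \<and> valid X n (foldr act p st)"
    using assms(1) by (induction p arbitrary: m) (auto simp: assms(2,3) valid_act)
  then show "length (foldr act p st) = m" "valid X n (foldr act p st)" by auto
qed

lemmas act_path_id = act_path[OF _ length_id_rows valid_id_rows]

text \<open>Multiply the edges of the path one after another to the normal form of the identity, which is
  empty.\<close>

lemma path_eq_nf:
  assumes "wreath_model X R G Ob" "is_path X m p n" "a \<in> Ob n"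
  shows "foldr G p a = foldr G (nf n (foldr act p (id_rows n))) a"
  using assms(2)
proof (induction p arbitrary: m)
  case Nil
  then show ?case by (simp add: nf_id_rows)
next
  case (Cons g p)
  then have "is_path X (edge_head g) p n" "g \<in> arcs (wreath_digraph X)" by auto
  with Cons.IH act_path_id[of X _ p n] nf_act[OF assms(1), of n _ g a] assms(3)
  show ?case by simp
qed

subsection \<open>Replacing words by equal words\<close>

text \<open>The pairs of words that act in the same way at position \<open>i\<close> form a congruence on the free monoid, and
  it contains \<open>R\<close>.\<close>

lemma word_cong:
  assumes "wreath_model X R G Ob" "R \<subseteq> lists X \<times> lists X"
    "(u, v) \<in> monoid_congruence_generated (free_monoid X) R" "1 \<le> i" "i \<le> n" "a \<in> Ob n"
  shows "foldr G (word_at u i n) a = foldr G (word_at v i n) a"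
proof -
  interpret wreath_model X R G Ob by fact
  define \<sigma> where "\<sigma> = {(u, v). u \<in> lists X \<and> v \<in> lists X \<and>
    (\<forall>a \<in> Ob n. foldr G (word_at u i n) a = foldr G (word_at v i n) a)}"
  have append: "word_at (u @ v) i n = word_at u i n @ word_at v i n" for u v :: "'a list"
    by (simp add: word_at_def)
  have "equiv (lists X) \<sigma>"
    by (rule equivI) (auto simp: \<sigma>_def intro!: refl_onI symI transI)
  moreover have "foldr G (word_at c i n) a \<in> Ob n" if "c \<in> lists X" "a \<in> Ob n" for a c
    using that assms(4,5) by (intro word_in) auto
  ultimately have "monoid_congruence (free_monoid X) \<sigma>"
    by (auto simp: monoid_congruence_def free_monoid_def \<sigma>_def append)
  moreover have "R \<subseteq> \<sigma>"
    using assms(2) rel[OF wreath_relations.rel[OF _ assms(4,5)]] by (fastforce simp: \<sigma>_def)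
  ultimately have "(u, v) \<in> \<sigma>"
    using assms(3) by (auto simp: monoid_congruence_generated_def)
  then show ?thesis using assms(6) by (simp add: \<sigma>_def)
qed

definition same_rows :: "('x list \<times> 'x list) set \<Rightarrow> 'x row list \<Rightarrow> 'x row list \<Rightarrow> bool" where
  "same_rows \<sigma> = list_all2 (rel_option (rel_prod (=) (\<lambda>u v. (u, v) \<in> \<sigma>)))"

lemma nf_cong:
  assumes "wreath_model X R G Ob" "R \<subseteq> lists X \<times> lists X"
    "same_rows (monoid_congruence_generated (free_monoid X) R) st st'"
    "valid X n st" "a \<in> Ob n"
  shows "foldr G (nf n st) a = foldr G (nf n st') a"
  using assms
proof (induction "length st" arbitrary: st st' n a G Ob)
  case 0
  then show ?case by (simp add: same_rows_def)
next
  case (Suc m)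
  interpret wreath_model X R G Ob by fact
  let ?S = "monoid_congruence_generated (free_monoid X) R"
  obtain r t where st: "st = r # t" using Suc.hyps(2) by (cases st) auto
  then obtain r' t' where st': "st' = r' # t'" and r: "rel_option (rel_prod (=) (\<lambda>u v. (u, v) \<in> ?S)) r r'"
    and t: "same_rows ?S t t'"
    using Suc.prems by (auto simp: same_rows_def list_all2_Cons1)
  have len: "length t = length t'" using t by (auto simp: same_rows_def dest: list_all2_lengthD)
  show ?case
  proof (cases r)
    case None
    then have "r' = None" using r by simp
    then show ?thesis
      using None Suc.hyps(1)[of t G Ob t' n a] Suc.hyps(2) Suc.prems t len by (simp add: st st')
  next
    case (Some p)
    then obtain j w w' where r: "r = Some (j, w)" "r' = Some (j, w')" "(w, w') \<in> ?S"
      using r by (cases p) (auto simp: option_rel_Some1 rel_prod_sel)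
    obtain n' where n: "n = Suc n'" using Suc.prems by (cases n) (auto simp: st r)
    let ?N = "\<lambda>t. map up (nf n' (map_col (squash j) t))"
    let ?b = "foldr G (cyc j n) a"
    have valid: "valid X n' (map_col (squash j) t)"
      using Suc.prems by (intro valid_squash) (auto simp: st r n)
    have b: "?b \<in> Ob (Suc n')" using Suc.prems by (simp add: st r n)
    have "same_rows ?S (map_col (squash j) t) (map_col (squash j) t')"
      using t unfolding same_rows_def map_col_def list.rel_map
      by (rule list_all2_mono) (auto simp: option.rel_map prod.rel_map elim!: option.rel_mono_strong prod.rel_mono_strong)
    then have "foldr G (?N t) ?b = foldr G (?N t') ?b"
      unfolding foldr_map_up using b valid Suc.hyps(2) Suc.prems
      by (intro Suc.hyps(1)[where Ob = "\<lambda>n. Ob (Suc n)" and G = "\<lambda>g. G (up g)"])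
        (auto simp: st intro: wreath_model_up)
    moreover have "foldr G (?N t) ?b \<in> Ob (Suc (length t))"
      using is_path_nf[OF valid] b by (intro path_in[OF is_path_up]) auto
    ultimately show ?thesis
      using word_cong[OF Suc.prems(1,2) r(3), of 1 "Suc (length t)"]
      by (simp add: st st' r n len del: foldr_map)
  qed
qed

section \<open>The wreath product category\<close>

lemma mult_adjoin_zero [simp]:
  "None \<otimes>\<^bsub>adjoin_zero M\<^esub> b = None" "a \<otimes>\<^bsub>adjoin_zero M\<^esub> None = None"
  "Some x \<otimes>\<^bsub>adjoin_zero M\<^esub> Some y = Some (x \<otimes>\<^bsub>M\<^esub> y)"
  "\<one>\<^bsub>adjoin_zero M\<^esub> = Some \<one>\<^bsub>M\<^esub>"
  by (auto simp: adjoin_zero_def split: option.splits)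

lemma carrier_adjoin_zero [simp]:
  "None \<in> carrier (adjoin_zero M)" "Some x \<in> carrier (adjoin_zero M) \<longleftrightarrow> x \<in> carrier M"
  by (auto simp: adjoin_zero_def)

lemma mult_zero_power: "a \<otimes>\<^bsub>zero_power M m\<^esub> b = (\<lambda>i\<in>{1..m}. a i \<otimes>\<^bsub>adjoin_zero M\<^esub> b i)"
  and one_zero_power: "\<one>\<^bsub>zero_power M m\<^esub> = (\<lambda>i\<in>{1..m}. Some \<one>\<^bsub>M\<^esub>)"
  and carrier_zero_power: "carrier (zero_power M m) = (\<Pi>\<^sub>E i\<in>{1..m}. carrier (adjoin_zero M))"
  by (simp_all add: zero_power_def product_group_def)

lemma wreath_category_sel:
  "(m, (a, \<alpha>), n) \<in> mor (wreath_category M) \<longleftrightarrow>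
     a \<in> carrier (zero_power M m) \<and> \<alpha> \<in> partial_injections m n \<and> supp m a = dom \<alpha>"
  "src (wreath_category M) (m, f, n) = m"
  "rng (wreath_category M) (m, f, n) = n"
  "ident (wreath_category M) n = (n, (\<one>\<^bsub>zero_power M n\<^esub>, partial_id {1..n}), n)"
  "cmp (wreath_category M) (m, (a, \<alpha>), n) (n', (b, \<beta>), k) =
     (m, (a \<otimes>\<^bsub>zero_power M m\<^esub> pull_back m \<alpha> b, \<beta> \<circ>\<^sub>m \<alpha>), k)"
  by (simp_all add: wreath_category_def)


lemma supp_eq_dom_iff:
  "supp m a = dom \<alpha> \<and> dom \<alpha> \<subseteq> {1..m} \<longleftrightarrow>
     (\<forall>i. i \<notin> {1..m} \<longrightarrow> \<alpha> i = None) \<and> (\<forall>i\<in>{1..m}. \<alpha> i = None \<longleftrightarrow> a i = None)"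
  unfolding supp_def dom_def set_eq_iff subset_iff mem_Collect_eq by metis

text \<open>A pointwise description of morphisms. The condition on supports becomes the statement that each entry
  of the tuple vanishes exactly where the partial map is undefined.\<close>

lemma wreath_mor_iff:
  "(m, (a, \<alpha>), n) \<in> mor (wreath_category M) \<longleftrightarrow>
     a \<in> extensional {1..m} \<and>
     (\<forall>i. i \<notin> {1..m} \<longrightarrow> \<alpha> i = None) \<and>
     (\<forall>i\<in>{1..m}. \<alpha> i = None \<longleftrightarrow> a i = None) \<and>
     (\<forall>i\<in>{1..m}. \<forall>j. \<alpha> i = Some j \<longrightarrow> 1 \<le> j \<and> j \<le> n) \<and>
     (\<forall>i\<in>{1..m}. \<forall>x. a i = Some x \<longrightarrow> x \<in> carrier M) \<and>
     (\<forall>i j k. \<alpha> i = Some k \<longrightarrow> \<alpha> j = Some k \<longrightarrow> i = j)"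
proof -
  have carrier: "a \<in> carrier (zero_power M m) \<longleftrightarrow>
      a \<in> extensional {1..m} \<and> (\<forall>i\<in>{1..m}. \<forall>x. a i = Some x \<longrightarrow> x \<in> carrier M)"
  proof -
    have "y \<in> carrier (adjoin_zero M) \<longleftrightarrow> (\<forall>x. y = Some x \<longrightarrow> x \<in> carrier M)" for y
      by (cases y) auto
    then show ?thesis by (auto simp: carrier_zero_power PiE_iff)
  qed
  have inj: "inj_on \<alpha> (dom \<alpha>) \<longleftrightarrow> (\<forall>i j k. \<alpha> i = Some k \<longrightarrow> \<alpha> j = Some k \<longrightarrow> i = j)"
  proof (intro iffI allI impI)
    fix i j k assume "inj_on \<alpha> (dom \<alpha>)" "\<alpha> i = Some k" "\<alpha> j = Some k"
    then show "i = j" by (intro inj_onD[of \<alpha> "dom \<alpha>"]) auto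
  next
    assume *: "\<forall>i j k. \<alpha> i = Some k \<longrightarrow> \<alpha> j = Some k \<longrightarrow> i = j"
    show "inj_on \<alpha> (dom \<alpha>)"
    proof (rule inj_onI)
      fix i j assume "i \<in> dom \<alpha>" "\<alpha> i = \<alpha> j"
      then obtain k where "\<alpha> i = Some k" "\<alpha> j = Some k" by (metis domD)
      then show "i = j" using * by blast
    qed
  qed
  have ran: "dom \<alpha> \<subseteq> {1..m} \<longrightarrow>
      (ran \<alpha> \<subseteq> {1..n} \<longleftrightarrow> (\<forall>i\<in>{1..m}. \<forall>j. \<alpha> i = Some j \<longrightarrow> 1 \<le> j \<and> j \<le> n))"
  proof (intro impI iffI ballI allI)
    fix i j assume "ran \<alpha> \<subseteq> {1..n}" "\<alpha> i = Some j"
    then show "1 \<le> j \<and> j \<le> n" using ranI[of \<alpha> i j] by auto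
  next
    assume dom: "dom \<alpha> \<subseteq> {1..m}" and *: "\<forall>i\<in>{1..m}. \<forall>j. \<alpha> i = Some j \<longrightarrow> 1 \<le> j \<and> j \<le> n"
    show "ran \<alpha> \<subseteq> {1..n}"
    proof
      fix j assume "j \<in> ran \<alpha>"
      then obtain i where i: "\<alpha> i = Some j" by (auto simp: ran_def)
      then have "i \<in> {1..m}" using dom by (meson domI subsetD)
      with * i have "1 \<le> j \<and> j \<le> n" by blast
      then show "j \<in> {1..n}" by simp
    qed
  qed
  have "(m, (a, \<alpha>), n) \<in> mor (wreath_category M) \<longleftrightarrow> a \<in> carrier (zero_power M m) \<and>
      ran \<alpha> \<subseteq> {1..n} \<and> inj_on \<alpha> (dom \<alpha>) \<and> (supp m a = dom \<alpha> \<and> dom \<alpha> \<subseteq> {1..m})"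
    by (auto simp: wreath_category_sel(1) partial_injections_def)
  then show ?thesis
    unfolding supp_eq_dom_iff carrier inj
    using ran supp_eq_dom_iff[of m a \<alpha>] by argo
qed

lemma wreath_morD:
  assumes "(m, (a, \<alpha>), n) \<in> mor (wreath_category M)"
  shows "a \<in> extensional {1..m}"
    and "i \<notin> {1..m} \<Longrightarrow> \<alpha> i = None"
    and "\<alpha> i = Some k \<Longrightarrow> \<alpha> j = Some k \<Longrightarrow> i = j"
  using assms unfolding wreath_mor_iff by blast+

lemma wreath_mor_row:
  assumes "(m, (a, \<alpha>), n) \<in> mor (wreath_category M)" "i \<in> {1..m}"
  obtains (None) "\<alpha> i = None" "a i = None"
  | (Some) j x where "\<alpha> i = Some j" "j \<in> {1..n}" "a i = Some x" "x \<in> carrier M"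
proof -
  have iff: "\<alpha> i = None \<longleftrightarrow> a i = None"
    and \<alpha>: "\<alpha> i = Some j \<Longrightarrow> 1 \<le> j \<and> j \<le> n"
    and a: "a i = Some x \<Longrightarrow> x \<in> carrier M" for j x
    using assms unfolding wreath_mor_iff by blast+
  show thesis
  proof (cases "\<alpha> i")
    case None
    then show thesis using iff that(1) by blast
  next
    case (Some j)
    then obtain x where "a i = Some x" using iff by auto
    then show thesis using Some \<alpha> a that(2) by auto
  qed
qed

lemma wreath_mor_cases:
  assumes "f \<in> mor (wreath_category M)"
  obtains m a \<alpha> n where "f = (m, (a, \<alpha>), n)" "(m, (a, \<alpha>), n) \<in> mor (wreath_category M)"
  using assms by (metis prod.exhaust)

lemma wreath_nat_category:
  assumes "monoid M"
  shows "nat_category (wreath_category M)"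
proof -
  interpret monoid M by fact
  let ?W = "wreath_category M"
  show ?thesis
  proof
    fix n
    show "ident ?W n \<in> mor ?W"
      unfolding wreath_category_sel(4) wreath_mor_iff
      by (auto simp: one_zero_power partial_id_def restrict_map_def split: if_splits)
    show "src ?W (ident ?W n) = n" "rng ?W (ident ?W n) = n"
      by (simp_all add: wreath_category_sel)
  next
    fix f g assume f: "f \<in> mor ?W" and g: "g \<in> mor ?W" and "rng ?W f = src ?W g"
    then obtain m a \<alpha> n b \<beta> k where fg: "f = (m, (a, \<alpha>), n)" "g = (n, (b, \<beta>), k)"
      by (metis wreath_mor_cases wreath_category_sel(2,3))
    show "src ?W (cmp ?W f g) = src ?W f" "rng ?W (cmp ?W f g) = rng ?W g"
      by (simp_all add: fg wreath_category_sel)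
    have prod: "(\<beta> \<circ>\<^sub>m \<alpha>) i = None \<and> a i \<otimes>\<^bsub>adjoin_zero M\<^esub> pull_back m \<alpha> b i = None \<or>
      (\<exists>j l x y. \<alpha> i = Some j \<and> \<beta> j = Some l \<and> 1 \<le> l \<and> l \<le> k \<and> x \<in> carrier M \<and> y \<in> carrier M \<and>
         a i \<otimes>\<^bsub>adjoin_zero M\<^esub> pull_back m \<alpha> b i = Some (x \<otimes>\<^bsub>M\<^esub> y))" if "i \<in> {1..m}" for i
      using f[unfolded fg] that
    proof (cases rule: wreath_mor_row)
      case None
      then show ?thesis using that by (simp add: pull_back_def)
    next
      case (Some j x)
      from g[unfolded fg] Some(2) show ?thesis
        by (cases rule: wreath_mor_row) (use Some that in \<open>auto simp: pull_back_def\<close>)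
    qed
    show "cmp ?W f g \<in> mor ?W"
      unfolding fg wreath_category_sel(5) wreath_mor_iff
    proof (intro conjI ballI allI impI)
      show "a \<otimes>\<^bsub>zero_power M m\<^esub> pull_back m \<alpha> b \<in> extensional {1..m}"
        by (simp add: mult_zero_power)
      show "(\<beta> \<circ>\<^sub>m \<alpha>) i = None" if "i \<notin> {1..m}" for i
        using wreath_morD(2)[OF f[unfolded fg] that] by (simp add: map_comp_def)
      show "(\<beta> \<circ>\<^sub>m \<alpha>) i = None \<longleftrightarrow> (a \<otimes>\<^bsub>zero_power M m\<^esub> pull_back m \<alpha> b) i = None" if "i \<in> {1..m}" for i
        using prod[OF that] that by (auto simp: mult_zero_power)
      show "1 \<le> j" "j \<le> k" if "i \<in> {1..m}" "(\<beta> \<circ>\<^sub>m \<alpha>) i = Some j" for i j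
        using prod[OF that(1)] that(2) by auto
      show "x \<in> carrier M" if "i \<in> {1..m}" "(a \<otimes>\<^bsub>zero_power M m\<^esub> pull_back m \<alpha> b) i = Some x" for i x
        using prod[OF that(1)] that by (auto simp: mult_zero_power)
      show "i = j" if "(\<beta> \<circ>\<^sub>m \<alpha>) i = Some k" "(\<beta> \<circ>\<^sub>m \<alpha>) j = Some k" for i j k
      proof -
        obtain p q where "\<alpha> i = Some p" "\<beta> p = Some k" "\<alpha> j = Some q" "\<beta> q = Some k"
          using \<open>(\<beta> \<circ>\<^sub>m \<alpha>) i = Some k\<close> \<open>(\<beta> \<circ>\<^sub>m \<alpha>) j = Some k\<close>
          by (auto simp: map_comp_def split: option.splits)
        then show ?thesis using wreath_morD(3)[OF f[unfolded fg]] wreath_morD(3)[OF g[unfolded fg]] by metis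
      qed
    qed
  next
    fix f assume "f \<in> mor ?W"
    then obtain m a \<alpha> n where f: "f = (m, (a, \<alpha>), n)" "(m, (a, \<alpha>), n) \<in> mor ?W"
      by (rule wreath_mor_cases)
    have "\<one>\<^bsub>zero_power M m\<^esub> \<otimes>\<^bsub>zero_power M m\<^esub> pull_back m (partial_id {1..m}) a = a"
    proof (rule extensionalityI[of _ "{1..m}"])
      fix i assume i: "i \<in> {1..m}"
      with f(2) show "(\<one>\<^bsub>zero_power M m\<^esub> \<otimes>\<^bsub>zero_power M m\<^esub> pull_back m (partial_id {1..m}) a) i = a i"
        by (cases rule: wreath_mor_row)
          (use i in \<open>auto simp: mult_zero_power one_zero_power pull_back_def partial_id_def\<close>)
    qed (use wreath_morD(1)[OF f(2)] in \<open>auto simp: mult_zero_power\<close>)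
    moreover have "\<alpha> \<circ>\<^sub>m partial_id {1..m} = \<alpha>"
      using wreath_morD(2)[OF f(2)] by (auto simp: map_comp_def partial_id_def restrict_map_def)
    ultimately show "cmp ?W (ident ?W (src ?W f)) f = f"
      by (simp add: f(1) wreath_category_sel)
    have "a \<otimes>\<^bsub>zero_power M m\<^esub> pull_back m \<alpha> (\<one>\<^bsub>zero_power M n\<^esub>) = a"
    proof (rule extensionalityI[of _ "{1..m}"])
      fix i assume i: "i \<in> {1..m}"
      with f(2) show "(a \<otimes>\<^bsub>zero_power M m\<^esub> pull_back m \<alpha> (\<one>\<^bsub>zero_power M n\<^esub>)) i = a i"
        by (cases rule: wreath_mor_row)
          (use i in \<open>auto simp: mult_zero_power one_zero_power pull_back_def\<close>)
    qed (use wreath_morD(1)[OF f(2)] in \<open>auto simp: mult_zero_power\<close>)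
    moreover have "partial_id {1..n} \<circ>\<^sub>m \<alpha> = \<alpha>"
    proof
      fix i
      show "(partial_id {1..n} \<circ>\<^sub>m \<alpha>) i = \<alpha> i"
      proof (cases "i \<in> {1..m}")
        case True
        with f(2) show ?thesis
          by (cases rule: wreath_mor_row) (auto simp: map_comp_def partial_id_def)
      qed (use wreath_morD(2)[OF f(2)] in \<open>simp add: map_comp_def\<close>)
    qed
    ultimately show "cmp ?W f (ident ?W (rng ?W f)) = f"
      by (simp add: f(1) wreath_category_sel)
  next
    fix f g h
    assume f: "f \<in> mor ?W" and g: "g \<in> mor ?W" and h: "h \<in> mor ?W"
      and ends: "rng ?W f = src ?W g" "rng ?W g = src ?W h"
    obtain m a \<alpha> n where f: "f = (m, (a, \<alpha>), n)" "(m, (a, \<alpha>), n) \<in> mor ?W"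
      using f by (rule wreath_mor_cases)
    obtain n' b \<beta> k where g: "g = (n', (b, \<beta>), k)" "(n', (b, \<beta>), k) \<in> mor ?W"
      using g by (rule wreath_mor_cases)
    obtain k' c \<gamma> l where h: "h = (k', (c, \<gamma>), l)" "(k', (c, \<gamma>), l) \<in> mor ?W"
      using h by (rule wreath_mor_cases)
    have [simp]: "n' = n" "k' = k" using ends by (auto simp: f g h wreath_category_sel)
    have "(a \<otimes>\<^bsub>zero_power M m\<^esub> pull_back m \<alpha> b) \<otimes>\<^bsub>zero_power M m\<^esub> pull_back m (\<beta> \<circ>\<^sub>m \<alpha>) c =
        a \<otimes>\<^bsub>zero_power M m\<^esub> pull_back m \<alpha> (b \<otimes>\<^bsub>zero_power M n\<^esub> pull_back n \<beta> c)"
    proof (rule extensionalityI[of _ "{1..m}"])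
      fix i assume i: "i \<in> {1..m}"
      show "((a \<otimes>\<^bsub>zero_power M m\<^esub> pull_back m \<alpha> b) \<otimes>\<^bsub>zero_power M m\<^esub> pull_back m (\<beta> \<circ>\<^sub>m \<alpha>) c) i =
        (a \<otimes>\<^bsub>zero_power M m\<^esub> pull_back m \<alpha> (b \<otimes>\<^bsub>zero_power M n\<^esub> pull_back n \<beta> c)) i"
        using f(2) i
      proof (cases rule: wreath_mor_row)
        case None
        then show ?thesis using i by (simp add: mult_zero_power pull_back_def)
      next
        case f': (Some j x)
        from g(2)[simplified] f'(2) show ?thesis
        proof (cases rule: wreath_mor_row)
          case None
          then show ?thesis using i f' by (simp add: mult_zero_power pull_back_def)
        next
          case g': (Some q y)
          from h(2)[simplified] g'(2) show ?thesis
            by (cases rule: wreath_mor_row)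
              (use i f' g' in \<open>auto simp: mult_zero_power pull_back_def m_assoc\<close>)
        qed
      qed
    qed (auto simp: mult_zero_power)
    moreover have "\<gamma> \<circ>\<^sub>m (\<beta> \<circ>\<^sub>m \<alpha>) = (\<gamma> \<circ>\<^sub>m \<beta>) \<circ>\<^sub>m \<alpha>"
      by (auto simp: map_comp_def split: option.splits)
    ultimately show "cmp ?W (cmp ?W f g) h = cmp ?W f (cmp ?W g h)"
      by (simp add: f(1) g(1) h(1) wreath_category_sel)
  qed
qed

section \<open>Lists of rows as morphisms\<close>

lemma prepend_Nil [simp]: "map_option (map_prod id ((@) [])) r = r"
  by (cases r) auto

text \<open>The wreath product morphism with the given rows, where words are evaluated in \<open>M\<close>.\<close>

definition rows_mor :: "('x list \<Rightarrow> 'm) \<Rightarrow> nat \<Rightarrow> 'x row list \<Rightarrow> 'm wreath_mor" where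
  "rows_mor \<phi> n st = (length st,
     (\<lambda>i\<in>{1..length st}. map_option (\<lambda>(j, w). \<phi> w) (st ! (i - 1)),
      \<lambda>i. if i \<in> {1..length st} then map_option fst (st ! (i - 1)) else None), n)"

locale monoid_presentation = monoid M for M :: "('m, 'r) monoid_scheme" (structure) +
  fixes X :: "'x set" and R :: "('x list \<times> 'x list) set" and \<phi> :: "'x list \<Rightarrow> 'm"
  assumes presentation: "has_monoid_presentation M X R \<phi>"
begin

lemma R_lists: "R \<subseteq> lists X \<times> lists X"
  using presentation by (simp add: has_monoid_presentation_def)

lemma phi_Nil [simp]: "\<phi> [] = \<one>"
  using presentation by (simp add: has_monoid_presentation_def)

lemma phi_in [simp]: "set w \<subseteq> X \<Longrightarrow> \<phi> w \<in> carrier M"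
  using presentation unfolding has_monoid_presentation_def by blast

lemma phi_append: "\<lbrakk>set u \<subseteq> X; set w \<subseteq> X\<rbrakk> \<Longrightarrow> \<phi> (u @ w) = \<phi> u \<otimes> \<phi> w"
  using presentation hom_mult[of \<phi> "free_monoid X" M u w]
  by (simp add: has_monoid_presentation_def free_monoid_def in_lists_conv_set subset_iff)

lemma phi_onto: "y \<in> carrier M \<Longrightarrow> \<exists>w. set w \<subseteq> X \<and> \<phi> w = y"
proof -
  assume "y \<in> carrier M"
  moreover have "\<phi> ` lists X = carrier M"
    using presentation by (simp add: has_monoid_presentation_def)
  ultimately show ?thesis by (metis imageE in_lists_conv_set subsetI)
qed

lemma phi_eq_iff: "\<lbrakk>set u \<subseteq> X; set v \<subseteq> X\<rbrakk> \<Longrightarrow>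
  (u, v) \<in> monoid_congruence_generated (free_monoid X) R \<longleftrightarrow> \<phi> u = \<phi> v"
  using presentation by (auto simp: has_monoid_presentation_def set_eq_iff lists_eq_set)

lemma valid_row:
  assumes "valid X n st" "i \<in> {1..length st}" "st ! (i - 1) = Some (j, w)"
  shows "1 \<le> j" "j \<le> n" "set w \<subseteq> X"
proof -
  have "i - 1 < length st" using assms(2) by auto
  then show "1 \<le> j" "j \<le> n" "set w \<subseteq> X" using assms(1,3) unfolding valid_def by blast+
qed

lemma rows_mor_in_mor:
  assumes "valid X n st"
  shows "rows_mor \<phi> n st \<in> mor (wreath_category M)"
  unfolding rows_mor_def wreath_mor_iff
proof (intro conjI ballI allI impI)
  fix i j
  assume i: "i \<in> {1..length st}"
    and "(if i \<in> {1..length st} then map_option fst (st ! (i - 1)) else None) = Some j"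
  then obtain w where "st ! (i - 1) = Some (j, w)" by auto
  then show "1 \<le> j" "j \<le> n" using valid_row[OF assms i] by blast+
next
  fix i x
  assume i: "i \<in> {1..length st}"
    and "(\<lambda>i\<in>{1..length st}. map_option (\<lambda>(j, w). \<phi> w) (st ! (i - 1))) i = Some x"
  then obtain j w where "st ! (i - 1) = Some (j, w)" "x = \<phi> w" by auto
  then show "x \<in> carrier M" using valid_row[OF assms i] phi_in by simp
next
  fix i j k
  assume i: "(if i \<in> {1..length st} then map_option fst (st ! (i - 1)) else None) = Some k"
    and j: "(if j \<in> {1..length st} then map_option fst (st ! (j - 1)) else None) = Some k"
  obtain v w where "st ! (i - 1) = Some (k, v)" "st ! (j - 1) = Some (k, w)"
    "i \<in> {1..length st}" "j \<in> {1..length st}"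
    using i j by (auto split: if_splits)
  moreover from this have "i - 1 < length st" "j - 1 < length st" by auto
  ultimately have "i - 1 = j - 1" using assms unfolding valid_def by blast
  then show "i = j" using \<open>i \<in> {1..length st}\<close> \<open>j \<in> {1..length st}\<close> by auto
qed auto

lemma rows_mor_id_rows: "rows_mor \<phi> n (id_rows n) = ident (wreath_category M) n"
proof -
  have "(id_rows n ! (i - 1) :: 'x row) = Some (i, [])" if "i \<in> {1..n}" for i
    using that by (auto simp: id_rows_def simp del: upt_Suc)
  then show ?thesis
    by (auto simp: rows_mor_def wreath_category_sel one_zero_power partial_id_def restrict_map_def
        intro!: restrict_ext)
qed

lemma edge_image_mor:
  assumes "g \<in> arcs (wreath_digraph X)"
  shows "edge_image M (\<lambda>x. \<phi> [x]) g \<in> mor (wreath_category M)"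
proof (cases g)
  case (Sgen i n)
  have "transpose i (Suc i) k \<in> {1..n}" if "k \<in> {1..n}" for k
    using that assms Sgen by (auto simp: transpose_def)
  then show ?thesis
    by (auto simp: Sgen wreath_mor_iff one_zero_power restrict_map_def split: if_splits
      dest: transpose_eq_imp_eq)
next
  case (Egen i n)
  then show ?thesis using assms
    by (auto simp: wreath_mor_iff one_zero_power restrict_map_def partial_id_def extensional_def split: if_splits)
next
  case (Xgen x i n)
  then show ?thesis using assms
    by (auto simp: wreath_mor_iff one_zero_power restrict_map_def partial_id_def extensional_def split: if_splits)
next
  case (Lam n)
  then show ?thesis
    by (auto simp: wreath_mor_iff one_zero_power restrict_map_def partial_id_def split: if_splits)
next
  case (Rho n)
  then show ?thesis
    by (auto simp: wreath_mor_iff one_zero_power restrict_map_def partial_id_def extensional_def split: if_splits)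
qed

text \<open>A uniform description of the generators, through which \<open>rows_mor_act\<close> is proved for
  all of them at once: row \<open>i\<close> of the product is empty or arises from row \<open>j\<close> of \<open>st\<close> by prepending a
  word \<open>u\<close>.\<close>

lemma edge_image_rows:
  assumes "g \<in> arcs (wreath_digraph X)" "length st = edge_head g"
  obtains a \<beta> where "edge_image M (\<lambda>x. \<phi> [x]) g = (edge_tail g, (a, \<beta>), edge_head g)"
    and "\<And>i. i \<notin> {1..edge_tail g} \<Longrightarrow> \<beta> i = None"
    and "\<And>i. i \<in> {1..edge_tail g} \<Longrightarrow>
      (\<beta> i = None \<and> act g st ! (i - 1) = None) \<or>
      (\<exists>j u. \<beta> i = Some j \<and> j \<in> {1..edge_head g} \<and> a i = Some (\<phi> u) \<and> set u \<subseteq> X \<and>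
        act g st ! (i - 1) = map_option (map_prod id ((@) u)) (st ! (j - 1)))"
proof (cases g)
  case (Sgen i n)
  let ?a = "\<one>\<^bsub>zero_power M n\<^esub>" and ?\<beta> = "(\<lambda>k. Some (transpose i (i + 1) k)) |` {1..n}"
  have "(?\<beta> k = None \<and> act g st ! (k - 1) = None) \<or>
      (\<exists>j u. ?\<beta> k = Some j \<and> j \<in> {1..n} \<and> ?a k = Some (\<phi> u) \<and> set u \<subseteq> X \<and>
        act g st ! (k - 1) = map_option (map_prod id ((@) u)) (st ! (j - 1)))"
    if "k \<in> {1..n}" for k
    using that assms
    by (intro disjI2 exI[of _ "transpose i (Suc i) k"] exI[of _ "[]"])
      (auto simp: Sgen one_zero_power partial_id_def transpose_def nth_list_update)
  then show thesis
    using assms by (intro that[of ?a ?\<beta>]) (simp_all only: Sgen, auto simp: partial_id_def)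
next
  case (Egen i n)
  let ?a = "(\<one>\<^bsub>zero_power M n\<^esub>)(i := None)" and ?\<beta> = "partial_id ({1..n} - {i})"
  have "(?\<beta> k = None \<and> act g st ! (k - 1) = None) \<or>
      (\<exists>j u. ?\<beta> k = Some j \<and> j \<in> {1..n} \<and> ?a k = Some (\<phi> u) \<and> set u \<subseteq> X \<and>
        act g st ! (k - 1) = map_option (map_prod id ((@) u)) (st ! (j - 1)))"
    if "k \<in> {1..n}" for k
  proof (cases "k = i")
    case True
    then show ?thesis using that assms by (auto simp: Egen partial_id_def nth_list_update)
  next
    case False
    then show ?thesis using that assms
      by (intro disjI2 exI[of _ k] exI[of _ "[]"])
      (auto simp: Egen one_zero_power partial_id_def nth_list_update)
  qed
  then show thesis
    using assms by (intro that[of ?a ?\<beta>]) (simp_all only: Egen, auto simp: partial_id_def)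
next
  case (Xgen x i n)
  let ?a = "(\<one>\<^bsub>zero_power M n\<^esub>)(i := Some (\<phi> [x]))" and ?\<beta> = "partial_id {1..n}"
  have "(?\<beta> k = None \<and> act g st ! (k - 1) = None) \<or>
      (\<exists>j u. ?\<beta> k = Some j \<and> j \<in> {1..n} \<and> ?a k = Some (\<phi> u) \<and> set u \<subseteq> X \<and>
        act g st ! (k - 1) = map_option (map_prod id ((@) u)) (st ! (j - 1)))"
    if "k \<in> {1..n}" for k
    using that assms
    by (intro disjI2 exI[of _ k] exI[of _ "if k = i then [x] else []"])
      (auto simp: Xgen one_zero_power partial_id_def nth_list_update fun_eq_iff intro!: option.map_cong)
  then show thesis
    using assms by (intro that[of ?a ?\<beta>]) (simp_all only: Xgen, auto simp: partial_id_def)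
next
  case (Lam n)
  let ?a = "\<one>\<^bsub>zero_power M n\<^esub>" and ?\<beta> = "partial_id {1..n}"
  have "(?\<beta> k = None \<and> act g st ! (k - 1) = None) \<or>
      (\<exists>j u. ?\<beta> k = Some j \<and> j \<in> {1..n + 1} \<and> ?a k = Some (\<phi> u) \<and> set u \<subseteq> X \<and>
        act g st ! (k - 1) = map_option (map_prod id ((@) u)) (st ! (j - 1)))"
    if "k \<in> {1..n}" for k
    using that assms
    by (intro disjI2 exI[of _ k] exI[of _ "[]"])
      (auto simp: Lam one_zero_power partial_id_def nth_butlast)
  then show thesis
    using assms by (intro that[of ?a ?\<beta>]) (simp_all only: Lam, auto simp: partial_id_def)
next
  case (Rho n)
  let ?a = "(\<one>\<^bsub>zero_power M (n + 1)\<^esub>)(n + 1 := None)" and ?\<beta> = "partial_id {1..n}"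
  have "(?\<beta> k = None \<and> act g st ! (k - 1) = None) \<or>
      (\<exists>j u. ?\<beta> k = Some j \<and> j \<in> {1..n} \<and> ?a k = Some (\<phi> u) \<and> set u \<subseteq> X \<and>
        act g st ! (k - 1) = map_option (map_prod id ((@) u)) (st ! (j - 1)))"
    if "k \<in> {1..n + 1}" for k
  proof (cases "k = n + 1")
    case True
    then show ?thesis using that assms by (auto simp: Rho partial_id_def nth_append)
  next
    case False
    then show ?thesis using that assms
      by (intro disjI2 exI[of _ k] exI[of _ "[]"])
      (auto simp: Rho one_zero_power partial_id_def nth_append)
  qed
  then show thesis
    using assms by (intro that[of ?a ?\<beta>]) (simp_all only: Rho, auto simp: partial_id_def)
qed

lemma rows_mor_act:
  assumes "valid X n st" "g \<in> arcs (wreath_digraph X)" "length st = edge_head g"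
  shows "rows_mor \<phi> n (act g st) = cmp (wreath_category M) (edge_image M (\<lambda>x. \<phi> [x]) g) (rows_mor \<phi> n st)"
proof -
  obtain a \<beta> where image: "edge_image M (\<lambda>x. \<phi> [x]) g = (edge_tail g, (a, \<beta>), edge_head g)"
    and out: "\<And>i. i \<notin> {1..edge_tail g} \<Longrightarrow> \<beta> i = None"
    and rows: "\<And>i. i \<in> {1..edge_tail g} \<Longrightarrow>
      (\<beta> i = None \<and> act g st ! (i - 1) = None) \<or>
      (\<exists>j u. \<beta> i = Some j \<and> j \<in> {1..edge_head g} \<and> a i = Some (\<phi> u) \<and> set u \<subseteq> X \<and>
        act g st ! (i - 1) = map_option (map_prod id ((@) u)) (st ! (j - 1)))"
    using edge_image_rows[OF assms(2,3)] by blast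
  let ?A = "\<lambda>i\<in>{1..length st}. map_option (\<lambda>(j, w). \<phi> w) (st ! (i - 1))"
  let ?\<alpha> = "\<lambda>i. if i \<in> {1..length st} then map_option fst (st ! (i - 1)) else None"
  have label: "map_option (\<lambda>(j, w). \<phi> w) (act g st ! (i - 1)) = a i \<otimes>\<^bsub>adjoin_zero M\<^esub> pull_back (edge_tail g) \<beta> ?A i"
    if i: "i \<in> {1..edge_tail g}" for i
    using rows[OF i]
  proof (elim disjE exE conjE)
    fix j u assume *: "\<beta> i = Some j" "j \<in> {1..edge_head g}" "a i = Some (\<phi> u)" "set u \<subseteq> X"
      "act g st ! (i - 1) = map_option (map_prod id ((@) u)) (st ! (j - 1))"
    show ?thesis
    proof (cases "st ! (j - 1)")
      case None
      then show ?thesis using * i assms(3) by (simp add: pull_back_def)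
    next
      case (Some kw)
      then obtain k w where kw: "st ! (j - 1) = Some (k, w)" by (cases kw) auto
      then have "set w \<subseteq> X" using valid_row[OF assms(1), of j k w] * assms(3) by simp
      then show ?thesis using * i assms(3) kw by (simp add: pull_back_def phi_append)
    qed
  qed (use i in \<open>simp add: pull_back_def\<close>)
  have "(\<lambda>i\<in>{1..edge_tail g}. map_option (\<lambda>(j, w). \<phi> w) (act g st ! (i - 1))) =
      a \<otimes>\<^bsub>zero_power M (edge_tail g)\<^esub> pull_back (edge_tail g) \<beta> ?A"
    unfolding mult_zero_power by (rule restrict_ext) (rule label)
  moreover have "(\<lambda>i. if i \<in> {1..edge_tail g} then map_option fst (act g st ! (i - 1)) else None) = ?\<alpha> \<circ>\<^sub>m \<beta>"
  proof
    fix i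
    show "(if i \<in> {1..edge_tail g} then map_option fst (act g st ! (i - 1)) else None) = (?\<alpha> \<circ>\<^sub>m \<beta>) i"
    proof (cases "i \<in> {1..edge_tail g}")
      case True
      from rows[OF this] show ?thesis
      proof (elim disjE exE conjE)
        fix j u assume *: "\<beta> i = Some j" "j \<in> {1..edge_head g}"
          "act g st ! (i - 1) = map_option (map_prod id ((@) u)) (st ! (j - 1))"
        then show ?thesis
          using True assms(3) by (cases "st ! (j - 1)") (auto simp: map_comp_def)
      qed (use True in \<open>simp add: map_comp_def\<close>)
    next
      case False
      then show ?thesis using out[OF False] by (simp add: map_comp_def del: atLeastAtMost_iff)
    qed
  qed
  ultimately show ?thesis
    using assms(3) by (simp add: rows_mor_def image wreath_category_sel del: atLeastAtMost_iff)
qed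

end

section \<open>Every list of rows is reached by its normal form\<close>

lemma foldr_act_map_col:
  assumes "is_path X m p n" "length st = n"
  shows "foldr act p (map_col f st) = map_col f (foldr act p st) \<and> length (foldr act p st) = m"
  using assms(1) by (induction p arbitrary: m) (auto simp: act_map_col assms(2))

lemma foldr_act_up:
  assumes "is_path X m p n" "length st = n"
  shows "foldr act (map up p) (r # st) = r # foldr act p st \<and> length (foldr act p st) = m"
  using assms(1) by (induction p arbitrary: m) (auto simp: act_up assms(2))

lemma act_cyc: "n = Suc (length xs + length ys) \<Longrightarrow>
  foldr act (cyc (Suc (length xs)) n) (xs @ r # ys) = r # xs @ ys"
proof (induction xs arbitrary: ys rule: rev_induct)
  case (snoc x xs)
  let ?l = "length xs"
  have "act (Sgen (Suc ?l) n) (xs @ x # r # ys) = xs @ r # x # ys"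
    by (simp add: nth_append list_update_append)
  then show ?case using snoc.IH[of "x # ys"] snoc.prems by (simp add: cyc_Suc)
qed simp

lemma act_drop_first: "length st = m \<Longrightarrow> foldr act (drop_first m) st = None # st"
  using act_cyc[of "Suc m" st "[]" None] by (simp add: drop_first_def)

lemma act_empty_map: "length st = n \<Longrightarrow> foldr act (empty_map n) st = []"
  by (induction n arbitrary: st) (auto simp: empty_map_Suc, simp add: empty_map_def)

lemma act_word: "foldr act (word_at w 1 m) (Some (j, v) # st) = Some (j, w @ v) # st"
  by (induction w) (simp_all add: word_at_def)

definition unsquash :: "nat \<Rightarrow> nat \<Rightarrow> nat" where
  "unsquash j c = (if c < j then c else Suc c)"

lemma unsquash_squash: "\<forall>w. Some (j, w) \<notin> set st \<Longrightarrow> map_col (unsquash j) (map_col (squash j) st) = st"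
proof -
  assume j: "\<forall>w. Some (j, w) \<notin> set st"
  have "map_col (unsquash j) (map_col (squash j) st) = map_col id st"
    unfolding map_col_map_col
  proof (rule map_col_cong)
    fix c w assume "Some (c, w) \<in> set st"
    then have "c \<noteq> j" using j by auto
    then show "(unsquash j \<circ> squash j) c = id c" by (auto simp: unsquash_def squash_def)
  qed
  then show ?thesis by (simp add: map_col_def option.map_id0 prod.map_id0)
qed

lemma act_cyc_id_rows:
  assumes "1 \<le> j" "j \<le> Suc n"
  shows "foldr act (cyc j (Suc n)) (id_rows (Suc n)) = Some (j, []) # map_col (unsquash j) (id_rows n)"
proof -
  define col where "col = (\<lambda>c. Some (c, []) :: 'a row)"
  let ?xs = "map col [1..<j]" and ?ys = "map col [Suc j..<Suc (Suc n)]"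
  have "[1..<Suc (Suc n)] = [1..<j] @ [j..<Suc (Suc n)]"
    using assms upt_add_eq_append[of 1 j "Suc (Suc n) - j"] by simp
  also have "[j..<Suc (Suc n)] = j # [Suc j..<Suc (Suc n)]"
    using assms by (simp add: upt_conv_Cons)
  finally have 1: "id_rows (Suc n) = ?xs @ col j # ?ys"
    by (simp add: id_rows_def col_def[symmetric])
  have "[1..<Suc n] = [1..<j] @ [j..<Suc n]"
    using assms upt_add_eq_append[of 1 j "Suc n - j"] by simp
  then have "map_col (unsquash j) (id_rows n) =
      map (col \<circ> unsquash j) [1..<j] @ map (col \<circ> unsquash j) [j..<Suc n]"
    by (simp add: id_rows_def map_col_def col_def o_def del: upt_Suc)
  also have "map (col \<circ> unsquash j) [1..<j] = ?xs"
    by (auto simp: unsquash_def)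
  also have "map (col \<circ> unsquash j) [j..<Suc n] = map (col \<circ> Suc) [j..<Suc n]"
    by (rule map_cong) (auto simp: unsquash_def)
  also have "\<dots> = ?ys"
    by (simp add: map_map[symmetric] map_Suc_upt del: map_map upt_Suc)
  finally have 2: "map_col (unsquash j) (id_rows n) = ?xs @ ?ys" .
  show ?thesis
    using act_cyc[of "Suc n" ?xs ?ys "col j"] assms unfolding 1 2 by (simp add: col_def del: upt_Suc)
qed

text \<open>A list of rows can be recovered from its normal form: acting with the cycle on the identity creates the
  first row and renumbers the columns, and the shifted rest does not touch the first row.\<close>

lemma act_nf: "valid X n st \<Longrightarrow> foldr act (nf n st) (id_rows n) = st"
proof (induction n st rule: nf.induct)
  case (1 n)
  then show ?case by (simp add: act_empty_map)
next
  case (2 n st)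
  then show ?case by (simp add: act_drop_first)
next
  case (3 n j w st)
  then obtain n' where n: "n = Suc n'" by (cases n) auto
  let ?st = "map_col (squash j) st"
  have valid: "valid X n' ?st" using 3 by (intro valid_squash) (auto simp: n)
  have path: "is_path X (length st) (nf n' ?st) n'" using is_path_nf[OF valid] by simp
  have "foldr act (nf n (Some (j, w) # st)) (id_rows n) =
      foldr act (word_at w 1 (Suc (length st)))
        (foldr act (map up (nf n' ?st)) (Some (j, []) # map_col (unsquash j) (id_rows n')))"
    using 3 by (simp add: n act_cyc_id_rows del: foldr_map)
  also have "foldr act (map up (nf n' ?st)) (Some (j, []) # map_col (unsquash j) (id_rows n')) =
      Some (j, []) # map_col (unsquash j) ?st"
    using foldr_act_up[OF path, of "map_col (unsquash j) (id_rows n')"] 3 valid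
      foldr_act_map_col[OF path, of "id_rows n'" "unsquash j"]
    by (simp add: n del: foldr_map)
  also have "map_col (unsquash j) ?st = st"
    using 3 by (intro unsquash_squash) auto
  finally show ?case by (simp add: act_word[simplified])
qed

section \<open>Soundness and completeness of the relations\<close>

lemma act_word_at: "\<lbrakk>1 \<le> i; i \<le> length st\<rbrakk> \<Longrightarrow>
  foldr act (word_at w i n) st = st[i - 1 := map_option (map_prod id ((@) w)) (st ! (i - 1))]"
proof (induction w)
  case (Cons x w)
  then have "i - 1 < length st" by simp
  moreover have "map_option (map_prod id ((#) x)) (map_option (map_prod id ((@) w)) r) =
      map_option (map_prod id ((@) (x # w))) r" for r :: "'a row"
    by (cases r) auto
  moreover have "foldr act (word_at w i n) st = st[i - 1 := map_option (map_prod id ((@) w)) (st ! (i - 1))]"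
    using Cons by blast
  moreover have "foldr act (word_at (x # w) i n) st = act (Xgen x i n) (foldr act (word_at w i n) st)"
    by (simp add: word_at_def)
  ultimately show ?case
    by (simp only: act.simps nth_list_update_eq list_update_overwrite)
qed (auto simp: word_at_def)

lemma act_swap: "i = Suc (length xs) \<Longrightarrow> act (Sgen i n) (xs @ r # q # ys) = xs @ q # r # ys"
  by (simp add: nth_append list_update_append)

lemma act_braid:
  assumes "1 \<le> i" "Suc i < length st"
  shows "foldr act [Sgen i n, Sgen (Suc i) n, Sgen i n] st = foldr act [Sgen (Suc i) n, Sgen i n, Sgen (Suc i) n] st"
proof -
  define xs where "xs = take (i - 1) st"
  define ys where "ys = drop (Suc (Suc i)) st"
  have i: "i = Suc (length xs)" using assms by (simp add: xs_def)
  have "st = xs @ st ! (i - 1) # drop i st"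
    using assms id_take_nth_drop[of "i - 1" st] by (simp add: xs_def)
  also have "drop i st = st ! i # st ! Suc i # ys"
    using assms by (simp add: ys_def Cons_nth_drop_Suc)
  finally obtain a b c where st: "st = xs @ a # b # c # ys" by blast
  have swap2: "act (Sgen (Suc i) n) (xs @ r # q # p # ys) = xs @ r # p # q # ys" for r q p
    using act_swap[of "Suc i" "xs @ [r]" n q p ys] i by simp
  show ?thesis
    by (simp add: st act_swap[OF i] swap2 del: act.simps)
qed

text \<open>Apart from the relations of \<open>M\<close>, the two sides of a relation have exactly the same effect
  on rows. The relations of \<open>M\<close> change the word of a row into one with the same value, which is visible
  only in terms of rows, not of morphisms.\<close>

lemma act_relation:
  assumes "((m, u, n), (m', v, n')) \<in> wreath_relations X R" "length st = n"
  shows "foldr act u st = foldr act v st \<or>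
    (\<exists>u' v' i. (u', v') \<in> R \<and> 1 \<le> i \<and> i \<le> n \<and> u = word_at u' i n \<and> v = word_at v' i n)"
  using assms(1)
proof (cases rule: wreath_relations.cases)
  case (s_braid i j)
  then have "j = Suc i \<or> i = Suc j" by linarith
  then have "foldr act u st = foldr act v st"
    using s_braid act_braid[of i st n] act_braid[of j st n] assms(2) by (auto simp del: act.simps)
  then show ?thesis ..
next
  case (rel u' v' i)
  then show ?thesis by blast
next
  case (s_comm i j)
  then obtain k l where kl: "i = Suc k" "j = Suc l" by (metis Suc_le_D One_nat_def)
  have "foldr act u st = foldr act v st"
    using s_comm assms(2)
    by (intro nth_equalityI) (auto simp: nth_list_update kl)
  then show ?thesis ..
next
  case (se_comm i j)
  then obtain k l where kl: "i = Suc k" "j = Suc l" by (metis Suc_le_D One_nat_def)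
  have "foldr act u st = foldr act v st"
    using se_comm assms(2)
    by (intro nth_equalityI) (auto simp: nth_list_update kl)
  then show ?thesis ..
next
  case (sx_comm x i j)
  then obtain k l where kl: "i = Suc k" "j = Suc l" by (metis Suc_le_D One_nat_def)
  have "foldr act u st = foldr act v st"
    using sx_comm assms(2)
    by (intro nth_equalityI) (auto simp: nth_list_update kl)
  then show ?thesis ..
next
  case (x_comm x y i j)
  then obtain k l where kl: "i = Suc k" "j = Suc l" by (metis Suc_le_D One_nat_def)
  have "foldr act u st = foldr act v st"
    using x_comm assms(2)
    by (intro nth_equalityI) (auto simp: nth_list_update kl)
  then show ?thesis ..
next
  case (ex_comm x i j)
  then obtain k l where kl: "i = Suc k" "j = Suc l" by (metis Suc_le_D One_nat_def)
  have "foldr act u st = foldr act v st"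
    using ex_comm assms(2)
    by (intro nth_equalityI) (auto simp: nth_list_update kl)
  then show ?thesis ..
next
  case (ss i)
  then obtain k where k: "i = Suc k" by (metis Suc_le_D One_nat_def)
  have "foldr act u st = foldr act v st"
    using ss assms(2)
    by (intro nth_equalityI) (auto simp: nth_list_update k)
  then show ?thesis ..
next
  case (se i)
  then obtain k where k: "i = Suc k" by (metis Suc_le_D One_nat_def)
  have "foldr act u st = foldr act v st"
    using se assms(2)
    by (intro nth_equalityI) (auto simp: nth_list_update k)
  then show ?thesis ..
next
  case (sx x i)
  then obtain k where k: "i = Suc k" by (metis Suc_le_D One_nat_def)
  have "foldr act u st = foldr act v st"
    using sx assms(2)
    by (intro nth_equalityI) (auto simp: nth_list_update k)
  then show ?thesis ..
next
  case (ees i)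
  then obtain k where k: "i = Suc k" by (metis Suc_le_D One_nat_def)
  have "foldr act u st = foldr act v st"
    using ees assms(2)
    by (intro nth_equalityI) (auto simp: nth_list_update k)
  then show ?thesis ..
next
  case (e_comm i j)
  then have "foldr act u st = foldr act v st"
    using assms(2) by (intro nth_equalityI) (auto simp: nth_list_update)
  then show ?thesis ..
next
  case (rho_lam k)
  then have "foldr act u st = foldr act v st"
    using assms(2) by (cases st rule: rev_cases) (auto simp: list_update_append)
  then show ?thesis ..
qed (use assms(2) in \<open>auto simp: nth_list_update nth_butlast nth_append butlast_list_update list_update_append\<close>)

lemma relation_paths:
  assumes "((m, u, n), (m', v, n')) \<in> wreath_relations X R" "R \<subseteq> lists X \<times> lists X"
  shows "m' = m" "n' = n" "is_path X m u n" "is_path X m v n"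
  using assms
  by (cases rule: wreath_relations.cases; auto intro!: is_path_word_at)+

context monoid_presentation
begin

lemma rows_mor_eq_rows_iff: "rows_mor \<phi> n st = rows_mor \<phi> n st' \<longleftrightarrow> length st' = length st \<and>
  (\<forall>k<length st. map_option (\<lambda>(j, w). \<phi> w) (st ! k) = map_option (\<lambda>(j, w). \<phi> w) (st' ! k) \<and>
    map_option fst (st ! k) = map_option fst (st' ! k))"
proof -
  let ?f = "map_option (\<lambda>(j, w). \<phi> w)"
  have all: "(\<forall>i\<in>{1..l}. P (i - 1)) \<longleftrightarrow> (\<forall>k<l. P k)" for P and l :: nat
  proof (intro iffI ballI allI impI)
    fix k assume "\<forall>i\<in>{1..l}. P (i - 1)" "k < l"
    then show "P k" by (auto dest!: bspec[of _ _ "Suc k"])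
  qed auto
  have A: "(\<lambda>i\<in>I. f i) = (\<lambda>i\<in>I. g i) \<longleftrightarrow> (\<forall>i\<in>I. f i = g i)" for I and f g :: "nat \<Rightarrow> 'm option"
    by (auto simp: fun_eq_iff restrict_def)
  have B: "(\<lambda>i. if i \<in> I then f i else None) = (\<lambda>i. if i \<in> I then g i else None) \<longleftrightarrow> (\<forall>i\<in>I. f i = g i)"
    for I and f g :: "nat \<Rightarrow> nat option"
    by (auto simp: fun_eq_iff)
  have "rows_mor \<phi> n st = rows_mor \<phi> n st' \<longleftrightarrow> length st' = length st \<and>
     (\<forall>i\<in>{1..length st}. ?f (st ! (i - 1)) = ?f (st' ! (i - 1)) \<and>
       map_option fst (st ! (i - 1)) = map_option fst (st' ! (i - 1)))"
  proof (cases "length st' = length st")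
    case True
    show ?thesis unfolding rows_mor_def prod.inject True A B by blast
  qed (simp add: rows_mor_def)
  then show ?thesis
    unfolding all[of "length st" "\<lambda>k. ?f (st ! k) = ?f (st' ! k) \<and> map_option fst (st ! k) = map_option fst (st' ! k)"] .
qed

text \<open>Two lists of rows describe the same morphism if and only if they have the same columns and congruent
  words, because the kernel of \<open>\<phi>\<close> is the congruence generated by \<open>R\<close>.\<close>

lemma rows_mor_eq_iff:
  assumes "valid X n st" "valid X n st'"
  shows "rows_mor \<phi> n st = rows_mor \<phi> n st' \<longleftrightarrow>
    same_rows (monoid_congruence_generated (free_monoid X) R) st st'"
proof -
  let ?f = "map_option (\<lambda>(j, w). \<phi> w)"
  let ?S = "monoid_congruence_generated (free_monoid X) R"
  have row: "rel_option (rel_prod (=) (\<lambda>u v. (u, v) \<in> ?S)) (st ! k) (st' ! k) \<longleftrightarrow>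
      ?f (st ! k) = ?f (st' ! k) \<and> map_option fst (st ! k) = map_option fst (st' ! k)"
    if "k < length st" "length st' = length st" for k
  proof -
    have "set w \<subseteq> X" if "st ! k = Some (j, w)" for j w
      using that assms(1) \<open>k < length st\<close> unfolding valid_def by blast
    moreover have "set w \<subseteq> X" if "st' ! k = Some (j, w)" for j w
      using that assms(2) \<open>k < length st\<close> \<open>length st' = length st\<close> unfolding valid_def by metis
    ultimately show ?thesis
      by (cases "st ! k"; cases "st' ! k") (auto simp: phi_eq_iff)
  qed
  show ?thesis
  proof (cases "length st' = length st")
    case True
    have "(\<forall>k<length st. rel_option (rel_prod (=) (\<lambda>u v. (u, v) \<in> ?S)) (st ! k) (st' ! k)) \<longleftrightarrow>
      (\<forall>k<length st. ?f (st ! k) = ?f (st' ! k) \<and> map_option fst (st ! k) = map_option fst (st' ! k))"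
      using row[OF _ True] by (intro all_cong) simp
    then show ?thesis
      unfolding rows_mor_eq_rows_iff same_rows_def list_all2_conv_all_nth by (simp only: True simp_thms)
  next
    case False
    then show ?thesis
      unfolding rows_mor_eq_rows_iff same_rows_def list_all2_conv_all_nth by simp
  qed
qed

lemma rows_mor_relation:
  assumes "((m, u, n), (m', v, n')) \<in> wreath_relations X R" "length st = n" "valid X k st"
  shows "rows_mor \<phi> k (foldr act u st) = rows_mor \<phi> k (foldr act v st)"
  using act_relation[OF assms(1,2)]
proof (elim disjE exE conjE)
  fix u' v' i
  assume *: "(u', v') \<in> R" "1 \<le> i" "i \<le> n" "u = word_at u' i n" "v = word_at v' i n"
  then have words: "set u' \<subseteq> X" "set v' \<subseteq> X" using R_lists by auto
  have "(u', v') \<in> monoid_congruence_generated (free_monoid X) R"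
    using *(1) by (auto simp: monoid_congruence_generated_def)
  then have eq: "\<phi> u' = \<phi> v'" using words phi_eq_iff by blast
  let ?r = "st ! (i - 1)"
  have row: "map_option (\<lambda>(j, w). \<phi> w) (map_option (map_prod id ((@) u')) ?r) =
      map_option (\<lambda>(j, w). \<phi> w) (map_option (map_prod id ((@) v')) ?r)"
  proof (cases ?r)
    case (Some p)
    then obtain j w where "?r = Some (j, w)" by (cases p) auto
    then show ?thesis
      using valid_row[OF assms(3), of i j w] * assms(2) eq words by (auto simp: phi_append)
  qed simp
  have fst: "map_option fst (map_option (map_prod id ((@) w)) ?r) = map_option fst ?r" for w
    by (cases ?r) auto
  show ?thesis
    using * assms(2) row fst
    by (simp add: rows_mor_eq_rows_iff act_word_at nth_list_update)
qed simp

abbreviation path_mor :: "'x edge path \<Rightarrow> 'm wreath_mor" where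
  "path_mor \<equiv> wreath_presentation_map M \<phi>"

lemma path_mor_eq_rows_mor:
  assumes "is_path X m p n"
  shows "path_mor (m, p, n) = rows_mor \<phi> n (foldr act p (id_rows n))"
proof -
  have "foldr (\<lambda>e. cmp (wreath_category M) (edge_image M (\<lambda>x. \<phi> [x]) e)) p (ident (wreath_category M) n)
      = rows_mor \<phi> n (foldr act p (id_rows n))"
    using assms
    by (induction p arbitrary: m)
      (auto simp: rows_mor_id_rows rows_mor_act act_path_id)
  then show ?thesis
    by (simp add: wreath_presentation_map_def free_category_extension_def)
qed

lemma src_rows_mor [simp]: "src (wreath_category M) (rows_mor \<phi> n st) = length st"
  and rng_rows_mor [simp]: "rng (wreath_category M) (rows_mor \<phi> n st) = n"
  by (simp_all add: rows_mor_def wreath_category_sel)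

lemma src_edge_image [simp]: "src (wreath_category M) (edge_image M h g) = edge_tail g"
  and rng_edge_image [simp]: "rng (wreath_category M) (edge_image M h g) = edge_head g"
  by (cases g; simp add: wreath_category_sel)+

lemma rows_mor_path:
  assumes "is_path X m p k" "valid X n st" "length st = k"
  shows "rows_mor \<phi> n (foldr act p st) = cmp (wreath_category M) (path_mor (m, p, k)) (rows_mor \<phi> n st)"
proof -
  interpret W: nat_category "wreath_category M" by (rule wreath_nat_category) (rule monoid_axioms)
  let ?W = "wreath_category M"
  show ?thesis
    using assms(1)
  proof (induction p arbitrary: m)
    case Nil
    then show ?case
      using W.cmp_ident_left[OF rows_mor_in_mor[OF assms(2)]] assms(3)
      by (simp add: path_mor_eq_rows_mor rows_mor_id_rows)
  next
    case (Cons g p)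
    then have g: "g \<in> arcs (wreath_digraph X)" and p: "is_path X (edge_head g) p k" and m: "m = edge_tail g"
      by auto
    let ?g = "edge_image M (\<lambda>x. \<phi> [x]) g"
    have len: "length (foldr act p st) = edge_head g" "valid X n (foldr act p st)"
      using act_path[OF p assms(3,2)] by auto
    have Fp: "path_mor (edge_head g, p, k) = rows_mor \<phi> k (foldr act p (id_rows k))"
      using p by (rule path_mor_eq_rows_mor)
    have "rows_mor \<phi> n (foldr act (g # p) st) = cmp ?W ?g (rows_mor \<phi> n (foldr act p st))"
      using len g by (simp add: rows_mor_act)
    also have "\<dots> = cmp ?W ?g (cmp ?W (path_mor (edge_head g, p, k)) (rows_mor \<phi> n st))"
      using Cons.IH[OF p] by simp
    also have "\<dots> = cmp ?W (cmp ?W ?g (path_mor (edge_head g, p, k))) (rows_mor \<phi> n st)"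
      using act_path_id[OF p] assms g
      by (intro W.cmp_assoc[symmetric]) (auto simp: Fp edge_image_mor rows_mor_in_mor)
    also have "cmp ?W ?g (path_mor (edge_head g, p, k)) = path_mor (m, g # p, k)"
      using act_path_id[OF p] g Cons.prems by (simp add: Fp path_mor_eq_rows_mor rows_mor_act)
    finally show ?case .
  qed
qed

lemma rows_mor_surj:
  assumes "f \<in> mor (wreath_category M)"
  obtains n st where "valid X n st" "f = rows_mor \<phi> n st"
proof -
  obtain m a \<alpha> n where f: "f = (m, (a, \<alpha>), n)" "(m, (a, \<alpha>), n) \<in> mor (wreath_category M)"
    using assms by (rule wreath_mor_cases)
  have "\<forall>i\<in>{1..m}. \<exists>r. map_option fst r = \<alpha> i \<and> map_option (\<lambda>(j, w). \<phi> w) r = a i \<and>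
      (\<forall>j w. r = Some (j, w) \<longrightarrow> 1 \<le> j \<and> j \<le> n \<and> set w \<subseteq> X)"
  proof
    fix i assume "i \<in> {1..m}"
    with f(2) show "\<exists>r. map_option fst r = \<alpha> i \<and> map_option (\<lambda>(j, w). \<phi> w) r = a i \<and>
        (\<forall>j w. r = Some (j, w) \<longrightarrow> 1 \<le> j \<and> j \<le> n \<and> set w \<subseteq> X)"
    proof (cases rule: wreath_mor_row)
      case (Some j x)
      obtain w where "set w \<subseteq> X" "\<phi> w = x" using phi_onto[OF Some(4)] by auto
      then show ?thesis using Some by (intro exI[of _ "Some (j, w)"]) auto
    qed (auto intro!: exI[of _ None])
  qed
  then obtain r where rows: "\<forall>i\<in>{1..m}. map_option fst (r i) = \<alpha> i \<and> map_option (\<lambda>(j, w). \<phi> w) (r i) = a i \<and>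
      (\<forall>j w. r i = Some (j, w) \<longrightarrow> 1 \<le> j \<and> j \<le> n \<and> set w \<subseteq> X)"
    unfolding bchoice_iff by (elim exE)
  have r: "map_option fst (r i) = \<alpha> i" "map_option (\<lambda>(j, w). \<phi> w) (r i) = a i"
    "r i = Some (j, w) \<Longrightarrow> 1 \<le> j \<and> j \<le> n \<and> set w \<subseteq> X" if "i \<in> {1..m}" for i j w
    using rows that by blast+
  define st where "st = map r [1..<Suc m]"
  have st: "length st = m" "st ! k = r (Suc k)" if "k < m" for k
    using that by (auto simp: st_def simp del: upt_Suc)
  have len: "length st = m" by (simp add: st_def)
  have "valid X n st"
    unfolding valid_def
  proof (intro conjI allI impI)
    fix k j w assume "k < length st" "st ! k = Some (j, w)"
    then show "1 \<le> j" "j \<le> n" "set w \<subseteq> X" using r(3)[of "Suc k" j w] by (auto simp: len st)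
  next
    fix k l j v w assume *: "k < length st" "l < length st" "st ! k = Some (j, v)" "st ! l = Some (j, w)"
    then have "\<alpha> (Suc k) = Some j" "\<alpha> (Suc l) = Some j"
      using r(1)[of "Suc k"] r(1)[of "Suc l"] by (auto simp: len st)
    then show "k = l" using wreath_morD(3)[OF f(2)] by blast
  qed
  moreover have "f = rows_mor \<phi> n st"
  proof -
    have "a = (\<lambda>i\<in>{1..m}. map_option (\<lambda>(j, w). \<phi> w) (st ! (i - 1)))"
      using wreath_morD(1)[OF f(2)] by (intro extensionalityI[of _ "{1..m}"]) (auto simp: st r)
    moreover have "\<alpha> = (\<lambda>i. if i \<in> {1..m} then map_option fst (st ! (i - 1)) else None)"
      using wreath_morD(2)[OF f(2)] by (auto simp: st r fun_eq_iff)
    ultimately show ?thesis by (simp add: f(1) rows_mor_def len)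
  qed
  ultimately show thesis by (rule that)
qed

end

section \<open>The presentation\<close>

lemma free_category_sel [simp]:
  "(m, p, n) \<in> mor (free_category (wreath_digraph X)) \<longleftrightarrow> is_path X m p n"
  "src (free_category \<Gamma>) (m, p, n) = m"
  "rng (free_category \<Gamma>) (m, p, n) = n"
  "ident (free_category \<Gamma>) n = (n, [], n)"
  "cmp (free_category \<Gamma>) (m, p, n) (n', q, k) = (m, p @ q, k)"
  by (simp_all add: free_category_def)

text \<open>The action of an edge on classes of paths. Defining it through all members of the class avoids the
  choice of a representative.\<close>

definition prepend_edge :: "('x edge path \<times> 'x edge path) set \<Rightarrow> 'x edge \<Rightarrow> 'x edge path set \<Rightarrow> 'x edge path set" where
  "prepend_edge \<sigma> g A = {w. \<exists>m p n. (m, p, n) \<in> A \<and> ((edge_tail g, g # p, n), w) \<in> \<sigma>}"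

locale path_congruence =
  fixes X :: "'x set" and R :: "('x list \<times> 'x list) set" and \<sigma> :: "('x edge path \<times> 'x edge path) set"
  assumes R_lists: "R \<subseteq> lists X \<times> lists X"
    and congruence: "cat_congruence (free_category (wreath_digraph X)) \<sigma>"
    and relations: "wreath_relations X R \<subseteq> \<sigma>"
begin

lemma equiv: "equiv (mor (free_category (wreath_digraph X))) \<sigma>"
  using congruence by (simp add: cat_congruence_def)

lemma parallel: "((m, p, n), (m', q, n')) \<in> \<sigma> \<Longrightarrow> m' = m \<and> n' = n \<and> is_path X m p n \<and> is_path X m q n"
  using congruence by (auto simp: cat_congruence_def parallel_pairs_def)

lemma prepend:
  assumes "((m, p, n), (m, q, n)) \<in> \<sigma>" "is_path X l u m"
  shows "((l, u @ p, n), (l, u @ q, n)) \<in> \<sigma>"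
proof -
  have "(l, u, m) \<in> mor (free_category (wreath_digraph X))" using assms(2) by simp
  then have "(cmp (free_category (wreath_digraph X)) (l, u, m) (m, p, n),
      cmp (free_category (wreath_digraph X)) (l, u, m) (m, q, n)) \<in> \<sigma>"
    using congruence assms(1) unfolding cat_congruence_def by fastforce
  then show ?thesis by simp
qed

lemma append:
  assumes "((m, p, n), (m, q, n)) \<in> \<sigma>" "is_path X n u k"
  shows "((m, p @ u, k), (m, q @ u, k)) \<in> \<sigma>"
proof -
  have "(n, u, k) \<in> mor (free_category (wreath_digraph X))" using assms(2) by simp
  then have "(cmp (free_category (wreath_digraph X)) (m, p, n) (n, u, k),
      cmp (free_category (wreath_digraph X)) (m, q, n) (n, u, k)) \<in> \<sigma>"
    using congruence assms(1) unfolding cat_congruence_def by fastforce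
  then show ?thesis by simp
qed

abbreviation cls :: "nat \<Rightarrow> 'x edge list \<Rightarrow> nat \<Rightarrow> 'x edge path set" where
  "cls m p n \<equiv> \<sigma> `` {(m, p, n)}"

lemma prepend_edge_cls:
  assumes "g \<in> arcs (wreath_digraph X)" "is_path X (edge_head g) p n"
  shows "prepend_edge \<sigma> g (cls (edge_head g) p n) = cls (edge_tail g) (g # p) n"
proof
  show "prepend_edge \<sigma> g (cls (edge_head g) p n) \<subseteq> cls (edge_tail g) (g # p) n"
  proof
    fix w assume "w \<in> prepend_edge \<sigma> g (cls (edge_head g) p n)"
    then obtain m q k where q: "((edge_head g, p, n), (m, q, k)) \<in> \<sigma>" "((edge_tail g, g # q, k), w) \<in> \<sigma>"
      by (auto simp: prepend_edge_def)
    then have [simp]: "m = edge_head g" "k = n" using parallel by blast+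
    have "((edge_tail g, [g] @ p, n), (edge_tail g, [g] @ q, n)) \<in> \<sigma>"
      using q(1) assms(1) by (intro prepend) auto
    then show "w \<in> cls (edge_tail g) (g # p) n"
      using q(2) equiv by (auto elim: equivE dest: transD)
  qed
  have "((edge_head g, p, n), (edge_head g, p, n)) \<in> \<sigma>"
    using equiv assms(2) by (intro refl_onD[of "mor (free_category (wreath_digraph X))"]) (auto simp: equiv_def)
  then show "cls (edge_tail g) (g # p) n \<subseteq> prepend_edge \<sigma> g (cls (edge_head g) p n)"
    by (auto simp: prepend_edge_def)
qed

lemma prepend_path_cls:
  assumes "is_path X m u k" "is_path X k p n"
  shows "foldr (prepend_edge \<sigma>) u (cls k p n) = cls m (u @ p) n"
  using assms(1)
proof (induction u arbitrary: m)
  case (Cons g u)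
  then have "is_path X (edge_head g) (u @ p) n" using assms(2) by auto
  then show ?case using Cons prepend_edge_cls[of g "u @ p" n] by (auto simp del: Image_singleton_iff)
qed simp

lemma model: "wreath_model X R (prepend_edge \<sigma>) (\<lambda>m. {cls m p n | p. is_path X m p n})"
proof
  fix g a assume "g \<in> arcs (wreath_digraph X)" "a \<in> {cls (edge_head g) p n | p. is_path X (edge_head g) p n}"
  then show "prepend_edge \<sigma> g a \<in> {cls (edge_tail g) p n | p. is_path X (edge_tail g) p n}"
    by (force simp: prepend_edge_cls)
next
  fix m u k m' v k' a
  assume rel: "((m, u, k), (m', v, k')) \<in> wreath_relations X R" and "a \<in> {cls k p n | p. is_path X k p n}"
  then obtain p where p: "is_path X k p n" "a = cls k p n" by auto
  have paths: "m' = m" "k' = k" "is_path X m u k" "is_path X m v k"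
    using relation_paths[OF rel R_lists] by auto
  have "((m, u, k), (m, v, k)) \<in> \<sigma>" using rel relations paths by auto
  then have "((m, u @ p, n), (m, v @ p, n)) \<in> \<sigma>" using p(1) by (rule append)
  then have "cls m (u @ p) n = cls m (v @ p) n" using equiv by (rule equiv_class_eq[rotated])
  then show "foldr (prepend_edge \<sigma>) u a = foldr (prepend_edge \<sigma>) v a"
    using p paths by (simp add: prepend_path_cls)
qed

text \<open>Evaluate both paths on the class of the empty path. This yields their own classes, and it depends
  only on the normal form of their rows.\<close>

lemma related_if_same_rows:
  assumes "is_path X m p n" "is_path X m q n"
    and "same_rows (monoid_congruence_generated (free_monoid X) R)
      (foldr act p (id_rows n)) (foldr act q (id_rows n))"
  shows "((m, p, n), (m, q, n)) \<in> \<sigma>"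
proof -
  \<comment> \<open>In the representation all paths end at the common final vertex \<open>n\<close>.\<close>
  let ?a = "cls n [] n"
  have a: "?a \<in> {cls n p n | p. is_path X n p n}" by force
  have "cls m p n = foldr (prepend_edge \<sigma>) p ?a"
    using assms(1) by (simp add: prepend_path_cls)
  also have "\<dots> = foldr (prepend_edge \<sigma>) (nf n (foldr act p (id_rows n))) ?a"
    by (rule path_eq_nf[OF model assms(1) a])
  also have "\<dots> = foldr (prepend_edge \<sigma>) (nf n (foldr act q (id_rows n))) ?a"
    by (rule nf_cong[OF model R_lists assms(3) act_path_id(2)[OF assms(1)] a])
  also have "\<dots> = foldr (prepend_edge \<sigma>) q ?a"
    by (rule path_eq_nf[OF model assms(2) a, symmetric])
  also have "\<dots> = cls m q n"
    using assms(2) by (simp add: prepend_path_cls)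
  finally show ?thesis
    using equiv assms(2) by (intro eq_equiv_class) auto
qed

end

context monoid_presentation
begin

abbreviation paths :: "'x edge path nat_cat" where
  "paths \<equiv> free_category (wreath_digraph X)"

lemma path_mor_cmp:
  assumes "is_path X m p k" "is_path X k q n"
  shows "path_mor (m, p @ q, n) = cmp (wreath_category M) (path_mor (m, p, k)) (path_mor (k, q, n))"
proof -
  have "is_path X m (p @ q) n" using assms by auto
  then show ?thesis
    using rows_mor_path[OF assms(1) act_path_id(2,1)[OF assms(2)]] assms by (simp add: path_mor_eq_rows_mor)
qed

lemma path_mor_in_mor: "is_path X m p n \<Longrightarrow> path_mor (m, p, n) \<in> mor (wreath_category M)"
  by (simp add: path_mor_eq_rows_mor rows_mor_in_mor act_path_id(2))

lemma path_mor_ends: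
  assumes "is_path X m p n"
  shows "src (wreath_category M) (path_mor (m, p, n)) = m" "rng (wreath_category M) (path_mor (m, p, n)) = n"
  using assms act_path_id[OF assms] by (simp_all add: path_mor_eq_rows_mor)

lemma path_mor_functor: "identity_on_objects_functor paths (wreath_category M) path_mor"
  unfolding identity_on_objects_functor_def
  by (auto simp: path_mor_in_mor path_mor_ends path_mor_cmp path_mor_eq_rows_mor[of _ "[]"] rows_mor_id_rows)

lemma path_mor_surj: "path_mor ` mor paths = mor (wreath_category M)"
proof
  show "path_mor ` mor paths \<subseteq> mor (wreath_category M)" using path_mor_in_mor by auto
  show "mor (wreath_category M) \<subseteq> path_mor ` mor paths"
  proof
    fix f assume "f \<in> mor (wreath_category M)"
    then obtain n st where st: "valid X n st" "f = rows_mor \<phi> n st" by (rule rows_mor_surj)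
    then have "f = path_mor (length st, nf n st, n)"
      using is_path_nf[OF st(1)] act_nf[OF st(1)] by (simp add: path_mor_eq_rows_mor)
    then show "f \<in> path_mor ` mor paths" using is_path_nf[OF st(1)] by auto
  qed
qed

definition kernel :: "('x edge path \<times> 'x edge path) set" where
  "kernel = {(u, v). u \<in> mor paths \<and> v \<in> mor paths \<and> path_mor u = path_mor v}"

lemma relations_parallel: "wreath_relations X R \<subseteq> parallel_pairs paths"
proof
  fix z assume "z \<in> wreath_relations X R"
  moreover obtain m u n m' v n' where z: "z = ((m, u, n), (m', v, n'))" by (metis prod.exhaust)
  ultimately show "z \<in> parallel_pairs paths"
    using relation_paths[of m u n m' v n' X R] R_lists by (simp add: parallel_pairs_def)
qed

lemma relations_kernel: "wreath_relations X R \<subseteq> kernel"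
proof
  fix z assume z: "z \<in> wreath_relations X R"
  obtain m u n m' v n' where z': "z = ((m, u, n), (m', v, n'))" by (metis prod.exhaust)
  then have rel: "((m, u, n), (m', v, n')) \<in> wreath_relations X R" using z by simp
  show "z \<in> kernel"
    using relation_paths[OF rel R_lists] rows_mor_relation[OF rel length_id_rows valid_id_rows]
    by (simp add: z' kernel_def path_mor_eq_rows_mor)
qed

lemma kernel_congruence: "cat_congruence paths kernel"
proof -
  have "equiv (mor paths) kernel"
    by (rule equivI) (auto simp: kernel_def intro!: refl_onI symI transI)
  moreover have parallel: "kernel \<subseteq> parallel_pairs paths"
  proof
    fix z assume "z \<in> kernel"
    then show "z \<in> parallel_pairs paths"
      by (auto simp: kernel_def parallel_pairs_def) (metis path_mor_ends)+
  qed
  moreover have "(rng paths c = src paths a \<longrightarrow> (cmp paths c a, cmp paths c b) \<in> kernel) \<and>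
      (rng paths a = src paths c \<longrightarrow> (cmp paths a c, cmp paths b c) \<in> kernel)"
    if ab: "(a, b) \<in> kernel" and c: "c \<in> mor paths" for a b c
  proof -
    obtain m p n m' q n' where ab': "a = (m, p, n)" "b = (m', q, n')" by (metis prod.exhaust)
    have [simp]: "m' = m" "n' = n"
      using ab parallel by (auto simp: parallel_pairs_def ab')
    have eq: "is_path X m p n" "is_path X m q n" "path_mor (m, p, n) = path_mor (m, q, n)"
      using ab by (auto simp: kernel_def ab')
    obtain k u l where c': "c = (k, u, l)" by (metis prod.exhaust)
    have u: "is_path X k u l" using c by (simp add: c')
    show ?thesis
    proof (intro conjI impI)
      assume "rng paths c = src paths a"
      then have "l = m" by (simp add: c' ab')
      then show "(cmp paths c a, cmp paths c b) \<in> kernel"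
        using u eq path_mor_cmp[of k u m p n] path_mor_cmp[of k u m q n] by (auto simp: c' ab' kernel_def)
    next
      assume "rng paths a = src paths c"
      then have "k = n" by (simp add: c' ab')
      then show "(cmp paths a c, cmp paths b c) \<in> kernel"
        using u eq path_mor_cmp[of m p n u l] path_mor_cmp[of m q n u l] by (auto simp: c' ab' kernel_def)
    qed
  qed
  ultimately show ?thesis
    unfolding cat_congruence_def by blast
qed

lemma kernel_eq_generated: "kernel = cat_congruence_generated paths (wreath_relations X R)"
proof
  show "cat_congruence_generated paths (wreath_relations X R) \<subseteq> kernel"
    using kernel_congruence relations_kernel by (auto simp: cat_congruence_generated_def)
  show "kernel \<subseteq> cat_congruence_generated paths (wreath_relations X R)"
    unfolding cat_congruence_generated_def
  proof (intro Inter_greatest subsetI)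
    fix \<sigma> z
    assume "\<sigma> \<in> {\<sigma>. cat_congruence paths \<sigma> \<and> wreath_relations X R \<subseteq> \<sigma>}" and z: "z \<in> kernel"
    then interpret path_congruence X R \<sigma>
      by unfold_locales (use R_lists in auto)
    obtain m p n m' q n' where z': "z = ((m, p, n), (m', q, n'))" by (metis prod.exhaust)
    then have p: "is_path X m p n" and q: "is_path X m' q n'" and eq: "path_mor (m, p, n) = path_mor (m', q, n')"
      using z by (auto simp: kernel_def)
    then have [simp]: "m' = m" "n' = n" using path_mor_ends[OF p] path_mor_ends[OF q] by auto
    have "same_rows (monoid_congruence_generated (free_monoid X) R)
        (foldr act p (id_rows n)) (foldr act q (id_rows n))"
      using eq p q act_path_id(2)[OF p] act_path_id(2)[of X m q n]
      by (simp add: path_mor_eq_rows_mor flip: rows_mor_eq_iff)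
    then show "z \<in> \<sigma>" using p q related_if_same_rows by (simp add: z')
  qed
qed

end

theorem theorem4p11:
  fixes M :: "('m, 'r) monoid_scheme"
    and X :: "'x set"
    and R :: "('x list \<times> 'x list) set"
    and \<phi>M :: "'x list \<Rightarrow> 'm"
  assumes "monoid M"
    and "has_monoid_presentation M X R \<phi>M"
  shows "has_category_presentation (wreath_category M) (wreath_digraph X)
           (wreath_relations X R) (wreath_presentation_map M \<phi>M)"
proof -
  interpret monoid_presentation M X R \<phi>M
    using assms by (simp add: monoid_presentation_def monoid_presentation_axioms_def)
  show ?thesis
    unfolding has_category_presentation_def
    using wreath_nat_category[OF assms(1)] path_mor_functor path_mor_surj relations_parallel
      kernel_eq_generated[unfolded kernel_def]
    by (auto simp: wf_digraph_def)
qed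

end
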